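(* Let $m$ be a positive even integer and assume that the number of column-even Latin $(m,m)$-squares differs from the number of column-odd Latin $(m,m)$-squares. Let $\mathfrak v$ be a complex vector space of dimension $m$, $E=\operatorname{End}(\mathfrak v)$, $Q=\mathcal P^m(E)\simeq S^m(E)^*$, let $\mathscr D\in Q$ be the determinant function, and let $\mathcal X\subset Q$ be the Zariski closure of the $GL(E)$-orbit of $\mathscr D$. Then for any $1\le i\le m$ the polynomial $P_i\in S^i(S^m(E))\simeq \mathcal P^i(Q)$ (the highest weight vector, unique up to a nonzero scalar, of the unique copy of $V_E(m\delta_i)$ in $S^i(S^m(E))$) does not vanish identically on $\mathcal X$. In particular, for any $1\le i\le m$ the irreducible $GL(E)$-module $V_E(m\delta_i)$ occurs with multiplicity one in the affine coordinate ring $\mathbb C[\mathcal X]$. Moreover, for any $0<d<m$ and any $1\le i\le m^2$, the module $V_E(d\delta_i)$ does not occur in $S^{\bullet}(S^m(E))$; in particular, it does not occur in $\mathbb C[\mathcal X]$.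
   Context: $\mathcal P^k(W)$ is the space of homogeneous polynomial functions of degree $k$ on a finite-dimensional complex vector space $W$; it is identified with $S^k(W)^*$ ($S^k(W)\subset\otimes^k W$ being the symmetric tensors) via $\xi(f)(w)=f(w^{\otimes k})$. The group $GL(E)$ acts on $Q$ by $(g\cdot q)(X)=q(g^{-1}X)$. $\mathscr D(X)=\det X$ for $X\in E=\operatorname{End}(\mathfrak v)$. The algebra of polynomial functions on $Q$ is $S^\bullet(S^m(E))$, of which $\mathbb C[\mathcal X]$ is a $GL(E)$-module quotient. Choose an ordered basis $e_1,\dots,e_{m^2}$ of $E$ to identify $GL(E)$ with $GL(m^2)$, with Borel subgroup the upper triangular matrices and maximal torus the diagonal matrices. $\delta_i$ ($1\le i\le m^2$) is the $i$-th fundamental weight, i.e. the partition $(1,\dots,1)$ with $i$ ones; $V_E(\lambda)$ is the irreducible $GL(E)$-module of highest weight $\lambda$. For $m$ even, it is known (Howe) that $V_E(m\delta_i)$ occurs in $S^\bullet(S^m(E))$ with multiplicity exactly one, and that it occurs in $S^i(S^m(E))$. A Latin $(m,m)$-square is an $m\times m$ matrix $A=(a_p^q)$ (row $p$, column $q$) with entries in $[m]=\{1,\dots,m\}$ each of whose rows and columns is a permutation of $[m]$. The sign of column $q$ is $\epsilon(A^q)=$ sign of $\prod_{1\le p<p'\le m}(a_{p'}^q-a_p^q)$; $A$ is column-even if $\prod_{q=1}^m\epsilon(A^q)=+1$ and column-odd otherwise. *)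

theory Defs
  imports Complex_Main "HOL-Combinatorics.Permutations" "HOL-Library.Function_Algebras"
    "HOL-Library.FuncSet"
begin

section \<open>Latin squares\<close>

text \<open>\<open>A p q\<close> is the entry in row \<open>p\<close> and column \<open>q\<close>.\<close>

definition latin_squares :: "nat \<Rightarrow> (nat \<Rightarrow> nat \<Rightarrow> nat) set" where
  "latin_squares m = {A \<in> {1..m} \<rightarrow>\<^sub>E ({1..m} \<rightarrow>\<^sub>E {1..m}).
     (\<forall>p\<in>{1..m}. bij_betw (\<lambda>q. A p q) {1..m} {1..m}) \<and>
     (\<forall>q\<in>{1..m}. bij_betw (\<lambda>p. A p q) {1..m} {1..m})}"

definition column_sign :: "nat \<Rightarrow> (nat \<Rightarrow> nat \<Rightarrow> nat) \<Rightarrow> nat \<Rightarrow> int" where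
  "column_sign m A q =
     sgn (\<Prod>(p, p')\<in>{(p, p'). 1 \<le> p \<and> p < p' \<and> p' \<le> m}. int (A p' q) - int (A p q))"

definition column_even :: "nat \<Rightarrow> (nat \<Rightarrow> nat \<Rightarrow> nat) \<Rightarrow> bool" where
  "column_even m A \<longleftrightarrow> (\<Prod>q=1..m. column_sign m A q) = 1"


section \<open>Polynomial functions on a complex vector space\<close>

text \<open>
  A complex vector space is a pair of a scalar multiplication \<open>s\<close> on a type and a subspace \<open>W\<close>
  of that type.  Functions on a set \<open>Y\<close> are represented by functions on the
  whole type that are \<open>0\<close> outside \<open>Y\<close>, so that equality of functions on \<open>Y\<close> is equality in HOL.
\<close>

definition pointwise :: "('c \<Rightarrow> 'b \<Rightarrow> 'b) \<Rightarrow> 'c \<Rightarrow> ('a \<Rightarrow> 'b) \<Rightarrow> 'a \<Rightarrow> 'b" where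
  "pointwise s c f = (\<lambda>x. s c (f x))"

abbreviation fscale :: "complex \<Rightarrow> ('a \<Rightarrow> complex) \<Rightarrow> 'a \<Rightarrow> complex" where
  "fscale \<equiv> pointwise (*)"

definition linear_on ::
  "(complex \<Rightarrow> 'a::ab_group_add \<Rightarrow> 'a) \<Rightarrow> (complex \<Rightarrow> 'b::ab_group_add \<Rightarrow> 'b) \<Rightarrow> 'a set \<Rightarrow> ('a \<Rightarrow> 'b) \<Rightarrow> bool"
  where "linear_on s t W f \<longleftrightarrow>
     (\<forall>x\<in>W. \<forall>y\<in>W. f (x + y) = f x + f y) \<and> (\<forall>c. \<forall>x\<in>W. f (s c x) = t c (f x))"

text \<open>The values outside \<open>W\<close> are irrelevant here.\<close>

inductive polynomial_on ::
  "(complex \<Rightarrow> 'a::ab_group_add \<Rightarrow> 'a) \<Rightarrow> 'a set \<Rightarrow> ('a \<Rightarrow> complex) \<Rightarrow> bool"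
  for s W where
  linear: "linear_on s (*) W f \<Longrightarrow> polynomial_on s W f"
| const: "polynomial_on s W (\<lambda>x. c)"
| add: "polynomial_on s W f \<Longrightarrow> polynomial_on s W g \<Longrightarrow> polynomial_on s W (\<lambda>x. f x + g x)"
| mult: "polynomial_on s W f \<Longrightarrow> polynomial_on s W g \<Longrightarrow> polynomial_on s W (\<lambda>x. f x * g x)"

text \<open>
  For \<open>Y \<subseteq> W\<close> the ring of restrictions to \<open>Y\<close> of polynomial functions on \<open>W\<close>, that is,
  the polynomial functions on \<open>W\<close> modulo those vanishing on \<open>Y\<close>.  For \<open>Y = W\<close> this is the algebra of
  polynomial functions on \<open>W\<close>.
\<close>

definition coordinate_ring ::
  "(complex \<Rightarrow> 'a::ab_group_add \<Rightarrow> 'a) \<Rightarrow> 'a set \<Rightarrow> 'a set \<Rightarrow> ('a \<Rightarrow> complex) set" where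
  "coordinate_ring s W Y = {(\<lambda>x. if x \<in> Y then f x else 0) | f. polynomial_on s W f}"

definition hom_poly ::
  "(complex \<Rightarrow> 'a::ab_group_add \<Rightarrow> 'a) \<Rightarrow> 'a set \<Rightarrow> nat \<Rightarrow> ('a \<Rightarrow> complex) set" where
  "hom_poly s W k = {f \<in> coordinate_ring s W W. \<forall>c. \<forall>x\<in>W. f (s c x) = c ^ k * f x}"

definition zariski_closure ::
  "(complex \<Rightarrow> 'a::ab_group_add \<Rightarrow> 'a) \<Rightarrow> 'a set \<Rightarrow> 'a set \<Rightarrow> 'a set" where
  "zariski_closure s W S =
     {x \<in> W. \<forall>f. polynomial_on s W f \<longrightarrow> (\<forall>y\<in>S. f y = 0) \<longrightarrow> f x = 0}"


section \<open>The general linear group and its modules\<close>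

text \<open>The values outside \<open>W\<close> of an element of \<open>GL s W\<close> are irrelevant.\<close>

definition GL :: "(complex \<Rightarrow> 'a::ab_group_add \<Rightarrow> 'a) \<Rightarrow> 'a set \<Rightarrow> ('a \<Rightarrow> 'a) set" where
  "GL s W = {g. bij_betw g W W \<and> linear_on s s W g}"

text \<open>The action \<open>(t f)(y) = f (t\<^sup>-\<^sup>1 y)\<close> of a bijection \<open>t\<close> of \<open>Y\<close> on the functions on \<open>Y\<close>.\<close>

definition translate :: "'a set \<Rightarrow> ('a \<Rightarrow> 'a) \<Rightarrow> ('a \<Rightarrow> complex) \<Rightarrow> 'a \<Rightarrow> complex" where
  "translate Y t f = (\<lambda>y. if y \<in> Y then f (inv_into Y t y) else 0)"

definition submodule ::
  "'g set \<Rightarrow> ('g \<Rightarrow> ('a \<Rightarrow> complex) \<Rightarrow> ('a \<Rightarrow> complex)) \<Rightarrow> ('a \<Rightarrow> complex) set \<Rightarrow> bool" where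
  "submodule G \<rho> N \<longleftrightarrow> module.subspace fscale N \<and> (\<forall>g\<in>G. \<forall>v\<in>N. \<rho> g v \<in> N)"

definition irreducible_submodule ::
  "'g set \<Rightarrow> ('g \<Rightarrow> ('a \<Rightarrow> complex) \<Rightarrow> ('a \<Rightarrow> complex)) \<Rightarrow> ('a \<Rightarrow> complex) set \<Rightarrow> bool" where
  "irreducible_submodule G \<rho> N \<longleftrightarrow> submodule G \<rho> N \<and> N \<noteq> {0} \<and>
     (\<forall>N'. submodule G \<rho> N' \<longrightarrow> N' \<subseteq> N \<longrightarrow> N' = {0} \<or> N' = N)"

definition ordered_basis ::
  "(complex \<Rightarrow> 'a::ab_group_add \<Rightarrow> 'a) \<Rightarrow> 'a set \<Rightarrow> nat \<Rightarrow> (nat \<Rightarrow> 'a) \<Rightarrow> bool" where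
  "ordered_basis s W n e \<longleftrightarrow> inj_on e {1..n} \<and>
     \<not> module.dependent s (e ` {1..n}) \<and> module.span s (e ` {1..n}) = W"

definition matrix_entry ::
  "(complex \<Rightarrow> 'a::ab_group_add \<Rightarrow> 'a) \<Rightarrow> nat \<Rightarrow> (nat \<Rightarrow> 'a) \<Rightarrow> ('a \<Rightarrow> 'a) \<Rightarrow> nat \<Rightarrow> nat \<Rightarrow> complex" where
  "matrix_entry s n e g i j = module.representation s (e ` {1..n}) (g (e j)) (e i)"

definition borel ::
  "(complex \<Rightarrow> 'a::ab_group_add \<Rightarrow> 'a) \<Rightarrow> 'a set \<Rightarrow> nat \<Rightarrow> (nat \<Rightarrow> 'a) \<Rightarrow> ('a \<Rightarrow> 'a) set" where
  "borel s W n e =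
     {g \<in> GL s W. \<forall>i\<in>{1..n}. \<forall>j\<in>{1..n}. j < i \<longrightarrow> matrix_entry s n e g i j = 0}"

text \<open>
  The character \<open>diag(t\<^sub>1,\<dots>,t\<^sub>n) \<mapsto> t\<^sub>1^(\<mu> 1) \<cdots> t\<^sub>n^(\<mu> n)\<close> of the diagonal torus, extended
  to the Borel subgroup by being trivial on unipotent elements.
\<close>

definition weight_char ::
  "(complex \<Rightarrow> 'a::ab_group_add \<Rightarrow> 'a) \<Rightarrow> nat \<Rightarrow> (nat \<Rightarrow> 'a) \<Rightarrow> (nat \<Rightarrow> nat) \<Rightarrow> ('a \<Rightarrow> 'a) \<Rightarrow> complex" where
  "weight_char s n e \<mu> g = (\<Prod>j=1..n. matrix_entry s n e g j j ^ \<mu> j)"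

definition fundamental_weight :: "nat \<Rightarrow> nat \<Rightarrow> nat" where
  "fundamental_weight i = (\<lambda>j. if 1 \<le> j \<and> j \<le> i then 1 else 0)"

definition highest_weight_vector ::
  "(complex \<Rightarrow> 'a::ab_group_add \<Rightarrow> 'a) \<Rightarrow> 'a set \<Rightarrow> nat \<Rightarrow> (nat \<Rightarrow> 'a) \<Rightarrow>
   (('a \<Rightarrow> 'a) \<Rightarrow> ('b \<Rightarrow> complex) \<Rightarrow> ('b \<Rightarrow> complex)) \<Rightarrow> (nat \<Rightarrow> nat) \<Rightarrow> ('b \<Rightarrow> complex) \<Rightarrow> bool" where
  "highest_weight_vector s W n e \<rho> \<mu> v \<longleftrightarrow> v \<noteq> 0 \<and>
     (\<forall>b\<in>borel s W n e. \<rho> b v = fscale (weight_char s n e \<mu> b) v)"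

text \<open>\<open>N\<close> is a submodule of \<open>M\<close> which is an irreducible module of highest weight \<open>\<mu>\<close>.\<close>

definition irreducible_copy ::
  "(complex \<Rightarrow> 'a::ab_group_add \<Rightarrow> 'a) \<Rightarrow> 'a set \<Rightarrow> nat \<Rightarrow> (nat \<Rightarrow> 'a) \<Rightarrow>
   (('a \<Rightarrow> 'a) \<Rightarrow> ('b \<Rightarrow> complex) \<Rightarrow> ('b \<Rightarrow> complex)) \<Rightarrow> (nat \<Rightarrow> nat) \<Rightarrow>
   ('b \<Rightarrow> complex) set \<Rightarrow> ('b \<Rightarrow> complex) set \<Rightarrow> bool" where
  "irreducible_copy s W n e \<rho> \<mu> M N \<longleftrightarrow> N \<subseteq> M \<and> irreducible_submodule (GL s W) \<rho> N \<and>
     (\<exists>v\<in>N. highest_weight_vector s W n e \<rho> \<mu> v)"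

definition occurs ::
  "(complex \<Rightarrow> 'a::ab_group_add \<Rightarrow> 'a) \<Rightarrow> 'a set \<Rightarrow> nat \<Rightarrow> (nat \<Rightarrow> 'a) \<Rightarrow>
   (('a \<Rightarrow> 'a) \<Rightarrow> ('b \<Rightarrow> complex) \<Rightarrow> ('b \<Rightarrow> complex)) \<Rightarrow> (nat \<Rightarrow> nat) \<Rightarrow>
   ('b \<Rightarrow> complex) set \<Rightarrow> bool" where
  "occurs s W n e \<rho> \<mu> M \<longleftrightarrow> (\<exists>N. irreducible_copy s W n e \<rho> \<mu> M N)"

text \<open>
  The isotypic component of \<open>M\<close> (the sum of all irreducible submodules of highest weight \<open>\<mu>\<close>)
  is the direct sum of exactly \<open>k\<close> such submodules.
\<close>

definition occurs_with_multiplicity ::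
  "(complex \<Rightarrow> 'a::ab_group_add \<Rightarrow> 'a) \<Rightarrow> 'a set \<Rightarrow> nat \<Rightarrow> (nat \<Rightarrow> 'a) \<Rightarrow>
   (('a \<Rightarrow> 'a) \<Rightarrow> ('b \<Rightarrow> complex) \<Rightarrow> ('b \<Rightarrow> complex)) \<Rightarrow> (nat \<Rightarrow> nat) \<Rightarrow>
   ('b \<Rightarrow> complex) set \<Rightarrow> nat \<Rightarrow> bool" where
  "occurs_with_multiplicity s W n e \<rho> \<mu> M k \<longleftrightarrow>
     (\<exists>F. finite F \<and> card F = k \<and> F \<subseteq> Collect (irreducible_copy s W n e \<rho> \<mu> M) \<and>
       (\<forall>v. (\<forall>N\<in>F. v N \<in> N) \<longrightarrow> (\<Sum>N\<in>F. v N) = 0 \<longrightarrow> (\<forall>N\<in>F. v N = 0)) \<and>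
       module.span fscale (\<Union>F) =
         module.span fscale (\<Union>(Collect (irreducible_copy s W n e \<rho> \<mu> M))))"


section \<open>The determinant and the closure of its orbit\<close>

text \<open>In the following, \<open>s\<close> is the scalar multiplication of the vector space on which \<open>endos s\<close> acts.\<close>

definition endos :: "(complex \<Rightarrow> 'v::ab_group_add \<Rightarrow> 'v) \<Rightarrow> ('v \<Rightarrow> 'v) set" where
  "endos s = {X. Vector_Spaces.linear s s X}"

text \<open>
  The determinant function on \<open>endos s\<close>: the Leibniz formula for the matrix with respect to
  some basis (\<open>extend_basis {}\<close>), whose rows and columns are indexed by the basis vectors.
\<close>

definition det_fun :: "(complex \<Rightarrow> 'v::ab_group_add \<Rightarrow> 'v) \<Rightarrow> ('v \<Rightarrow> 'v) \<Rightarrow> complex" where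
  "det_fun s = (\<lambda>X. if X \<in> endos s then
     (let B = vector_space.extend_basis s {} in
        \<Sum>\<pi> | \<pi> permutes B. of_int (sign \<pi>) * (\<Prod>b\<in>B. module.representation s B (X b) (\<pi> b)))
     else 0)"

definition forms :: "(complex \<Rightarrow> 'v::ab_group_add \<Rightarrow> 'v) \<Rightarrow> nat \<Rightarrow> (('v \<Rightarrow> 'v) \<Rightarrow> complex) set" where
  "forms s m = hom_poly (pointwise s) (endos s) m"

definition det_orbit_closure ::
  "(complex \<Rightarrow> 'v::ab_group_add \<Rightarrow> 'v) \<Rightarrow> nat \<Rightarrow> (('v \<Rightarrow> 'v) \<Rightarrow> complex) set" where
  "det_orbit_closure s m = zariski_closure fscale (forms s m)
     ((\<lambda>g. translate (endos s) g (det_fun s)) ` GL (pointwise s) (endos s))"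

text \<open>
  The action of \<open>GL (pointwise s) (endos s)\<close> on the functions on a stable set \<open>Y\<close> of forms,
  \<open>(g F)(q) = F (g\<^sup>-\<^sup>1 q)\<close> where \<open>(g q)(X) = q (g\<^sup>-\<^sup>1 X)\<close>.
\<close>

definition form_action ::
  "(complex \<Rightarrow> 'v::ab_group_add \<Rightarrow> 'v) \<Rightarrow> (('v \<Rightarrow> 'v) \<Rightarrow> complex) set \<Rightarrow> (('v \<Rightarrow> 'v) \<Rightarrow> ('v \<Rightarrow> 'v)) \<Rightarrow>
   ((('v \<Rightarrow> 'v) \<Rightarrow> complex) \<Rightarrow> complex) \<Rightarrow> (('v \<Rightarrow> 'v) \<Rightarrow> complex) \<Rightarrow> complex" where
  "form_action s Y g F = translate Y (translate (endos s) g) F"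

end

theory Submission
  imports Defs "Jordan_Normal_Form.Determinant"
begin

text \<open>
  A polynomial function on \<open>Q\<close> is viewed through \<open>A \<mapsto> F (q \<circ> A)\<close>. If \<open>F\<close> is a highest weight vector of
  weight \<open>d \<delta>\<^sub>i\<close> on a stable \<open>Y \<subseteq> Q\<close>, then \<open>F\<close> depends only on the restriction of \<open>q\<close> to the span of
  \<open>e\<^sub>1, \<dots>, e\<^sub>i\<close> and transforms by \<open>det ^ d\<close> under matrices of size \<open>i\<close>. Pairing \<open>A \<mapsto> F (q \<circ> A)\<close>
  with \<open>det ^ d\<close> replaces \<open>F\<close> by a form on \<open>Q\<close> with the same values on \<open>Y\<close> which is semi-invariant on
  all of \<open>Q\<close>; this stands in for complete reducibility. A form of degree \<open>K = i d / m\<close> is determined by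
  its values on sums of \<open>K\<close> powers of linear forms, and such a sum is the image of \<open>x\<^sub>1 ^ m + \<dots> + x\<^sub>i ^ m\<close>
  under a matrix of size \<open>i\<close>, which is singular if \<open>K < i\<close>. Hence there is no semi-invariant for \<open>d < m\<close>
  and at most one for \<open>d = m\<close>.

  For \<open>d = m\<close> the semi-invariant sends \<open>l\<^sub>1 ^ m + \<dots> + l\<^sub>n ^ m\<close> to the sum of the
  \<open>m\<close>-th powers of the minors of size \<open>i\<close> of the \<open>l\<^sub>j\<close> in \<open>i\<close> vectors. Expanding minors of size \<open>i + 1\<close> shows that
  if it vanishes at \<open>q\<close> for all choices of \<open>i\<close> vectors, then the one for \<open>i + 1\<close> does so as well. For \<open>i = m\<close>
  its value at \<open>det\<close> and the \<open>m\<close> diagonal matrix units is, up to a nonzero factor, the number of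
  column-even minus the number of column-odd Latin squares.
\<close>

section \<open>Combinatorial identities\<close>

text \<open>The difficulty on \<open>Y = X\<close> is that a highest weight vector is only the
  restriction of a polynomial \<open>F\<close> that transforms correctly at the points of
  \<open>Y\<close>, while evaluation at sums of powers leaves \<open>Y\<close>. Once
  \<open>F\<close> is replaced by a form that is semi-invariant on all of \<open>Q\<close>, the
  whole space and the orbit closure are handled by one argument. Singular matrices have to act as
  well, because restricting \<open>q\<close> to a span is a limit of torus translations; so the sets
  considered are stable under all matrices, which a Zariski closure of an orbit is by density.

  Multiplicity one is obtained by identifying the submodule itself. Any copy contains the
  restriction of the invariant, hence the restriction of the cyclic module generated by it. This
  module is irreducible: a translate of any nonzero element has a torus limit that is a nonzero
  multiple of the invariant. Such limits stay inside a submodule for a purely algebraic reason,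
  namely that the curves are polynomial of bounded degree.\<close>

lemma sum_interval_sign:
  assumes "finite S" "R \<subseteq> S"
  shows "(\<Sum>U\<in>{U. R \<subseteq> U \<and> U \<subseteq> S}. (- 1) ^ card (S - U)) = (if R = S then 1 else (0::'a::comm_ring_1))"
proof -
  have fin: "finite (S - R)" using assms by simp
  have "(\<Sum>U\<in>{U. R \<subseteq> U \<and> U \<subseteq> S}. (- 1) ^ card (S - U)) = (\<Sum>V\<in>Pow (S - R). (- 1) ^ card V :: 'a)"
    by (rule sum.reindex_bij_witness[where i="\<lambda>V. S - V" and j="\<lambda>U. S - U"])
      (use assms in \<open>auto simp: double_diff\<close>)
  also have "\<dots> = (\<Prod>x\<in>S - R. (1 + (- 1)))"
    using prod_add[OF fin, of "\<lambda>_. - 1 :: 'a" "\<lambda>_. 1"] 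
    by (simp add: add.commute)
  also have "\<dots> = (if R = S then 1 else 0)"
    using fin assms(2) by (auto simp: power_0_left)
  finally show ?thesis .
qed

text \<open>Ryser's formula for the permanent: expanding the products gives a sum over maps
  \<open>g\<close> of \<open>S\<close> into \<open>U\<close>, and inclusion-exclusion over the sets
  \<open>U\<close> containing the image of \<open>g\<close> cancels every \<open>g\<close> that is
  not onto.\<close>

lemma sum_subset_signed_prod:
  fixes a :: "'i \<Rightarrow> 'i \<Rightarrow> 'a::comm_ring_1"
  assumes "finite S"
  shows "(\<Sum>U\<in>Pow S. (- 1) ^ card (S - U) * (\<Prod>j\<in>S. \<Sum>r\<in>U. a r j)) =
    (\<Sum>\<pi> | \<pi> permutes S. \<Prod>j\<in>S. a (\<pi> j) j)"
proof -
  let ?h = "\<lambda>g. \<Prod>j\<in>S. a (g j) j"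
  have finP: "finite (S \<rightarrow>\<^sub>E S)" using assms by (simp add: finite_PiE)
  \<comment> \<open>Maps into \<open>U\<close> are counted among all maps into \<open>S\<close>, so
    that the order of summation can be exchanged.\<close>
  have "(\<Sum>U\<in>Pow S. (- 1) ^ card (S - U) * (\<Prod>j\<in>S. \<Sum>r\<in>U. a r j)) =
     (\<Sum>U\<in>Pow S. \<Sum>g\<in>S \<rightarrow>\<^sub>E S. if g ` S \<subseteq> U then (- 1) ^ card (S - U) * ?h g else 0)"
  proof (rule sum.cong[OF refl])
    fix U assume U: "U \<in> Pow S"
    then have finU: "finite U" using assms finite_subset by blast
    have "(\<Prod>j\<in>S. \<Sum>r\<in>U. a r j) = (\<Sum>g\<in>S \<rightarrow>\<^sub>E U. ?h g)"
      by (subst prod_sum_PiE) (use assms finU in auto)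
    also have "\<dots> = (\<Sum>g\<in>S \<rightarrow>\<^sub>E S. if g ` S \<subseteq> U then ?h g else 0)"
      by (rule sum.mono_neutral_cong_left[OF finP]) (use U in \<open>auto simp: PiE_iff\<close>)
    finally show "(- 1) ^ card (S - U) * (\<Prod>j\<in>S. \<Sum>r\<in>U. a r j) =
       (\<Sum>g\<in>S \<rightarrow>\<^sub>E S. if g ` S \<subseteq> U then (- 1) ^ card (S - U) * ?h g else 0)"
      by (simp add: sum_distrib_left if_distrib cong: if_cong)
  qed
  also have "\<dots> = (\<Sum>g\<in>S \<rightarrow>\<^sub>E S. \<Sum>U\<in>Pow S. if g ` S \<subseteq> U then (- 1) ^ card (S - U) * ?h g else 0)"
    by (rule sum.swap)
  also have "\<dots> = (\<Sum>g\<in>S \<rightarrow>\<^sub>E S. if g ` S = S then ?h g else 0)"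
  proof (rule sum.cong[OF refl])
    fix g assume g: "g \<in> S \<rightarrow>\<^sub>E S"
    have "(\<Sum>U\<in>Pow S. if g ` S \<subseteq> U then (- 1) ^ card (S - U) * ?h g else 0) =
       (\<Sum>U\<in>{U. g ` S \<subseteq> U \<and> U \<subseteq> S}. (- 1) ^ card (S - U)) * ?h g"
      unfolding sum_distrib_right
      by (rule sum.mono_neutral_cong_right) (use assms in auto)
    also have "\<dots> = (if g ` S = S then ?h g else 0)"
      by (subst sum_interval_sign) (use assms g in auto)
    finally show "(\<Sum>U\<in>Pow S. if g ` S \<subseteq> U then (- 1) ^ card (S - U) * ?h g else 0) =
      (if g ` S = S then ?h g else 0)" .
  qed
  also have "\<dots> = (\<Sum>g\<in>{g \<in> S \<rightarrow>\<^sub>E S. g ` S = S}. ?h g)"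
    by (rule sum.mono_neutral_cong_right[OF finP]) auto
  also have "\<dots> = (\<Sum>\<pi> | \<pi> permutes S. ?h \<pi>)"
  proof (rule sum.reindex_bij_witness[where i="\<lambda>\<pi>. restrict \<pi> S" and j="\<lambda>g x. if x \<in> S then g x else x"])
    fix g assume g: "g \<in> {g \<in> S \<rightarrow>\<^sub>E S. g ` S = S}"
    then have "bij_betw g S S" using assms by (auto simp: bij_betw_def intro: eq_card_imp_inj_on)
    then have "bij_betw (\<lambda>x. if x \<in> S then g x else x) S S"
      by (subst bij_betw_cong[of S _ g]) auto
    then show "(\<lambda>x. if x \<in> S then g x else x) \<in> {\<pi>. \<pi> permutes S}"
      by (auto intro!: bij_imp_permutes)
    show "restrict (\<lambda>x. if x \<in> S then g x else x) S = g"
      using g by (auto simp: restrict_def PiE_def extensional_def fun_eq_iff)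
    show "?h (\<lambda>x. if x \<in> S then g x else x) = ?h g" by (rule prod.cong) auto
  next
    fix \<pi> assume p: "\<pi> \<in> {\<pi>. \<pi> permutes S}"
    then show "(\<lambda>x. if x \<in> S then restrict \<pi> S x else x) = \<pi>"
      by (auto simp: fun_eq_iff permutes_def)
    show "restrict \<pi> S \<in> {g \<in> S \<rightarrow>\<^sub>E S. g ` S = S}"
      using p by (auto simp: permutes_in_image permutes_image)
  qed
  finally show ?thesis .
qed

text \<open>The polarization identity: when all columns of the matrix are equal, every permutation
  contributes the same product to the permanent.\<close>

lemma sum_subset_signed_power:
  fixes a :: "'i \<Rightarrow> 'a::comm_ring_1"
  assumes "finite S"
  shows "(\<Sum>U\<in>Pow S. (- 1) ^ card (S - U) * (\<Sum>r\<in>U. a r) ^ card S) = of_nat (fact (card S)) * (\<Prod>r\<in>S. a r)"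
proof -
  have "(\<Sum>U\<in>Pow S. (- 1) ^ card (S - U) * (\<Sum>r\<in>U. a r) ^ card S) = (\<Sum>\<pi> | \<pi> permutes S. \<Prod>j\<in>S. a (\<pi> j))"
    using sum_subset_signed_prod[OF assms, of "\<lambda>r j. a r"] by simp
  also have "\<dots> = (\<Sum>\<pi> | \<pi> permutes S. \<Prod>j\<in>S. a j)"
    by (rule sum.cong[OF refl]) (simp add: permutes_imp_bij prod.reindex_bij_betw)
  finally show ?thesis using card_permutations[OF refl assms] by simp
qed

section \<open>Signs of permutations as products of differences\<close>

abbreviation index_pairs :: "nat \<Rightarrow> (nat \<times> nat) set" where
  "index_pairs m \<equiv> {(p, p'). 1 \<le> p \<and> p < p' \<and> p' \<le> m}"

lemma finite_index_pairs: "finite (index_pairs m)"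
  by (rule finite_subset[of _ "{1..m} \<times> {1..m}"]) auto

text \<open>An adjacent transposition preserves the order of every pair except
  \<open>(x, Suc x)\<close>, so it permutes the other factors and reverses the sign of this
  one.\<close>

lemma diff_prod_adj_transpose:
  fixes f :: "nat \<Rightarrow> int"
  assumes "1 \<le> x" "Suc x \<le> m"
  shows "(\<Prod>(p, p')\<in>index_pairs m. f (transpose x (Suc x) p') - f (transpose x (Suc x) p)) =
     - (\<Prod>(p, p')\<in>index_pairs m. f p' - f p)"
proof -
  let ?t = "transpose x (Suc x)"
  let ?P = "index_pairs m" let ?P' = "index_pairs m - {(x, Suc x)}"
  have x: "(x, Suc x) \<in> ?P" using assms by auto
  have "(\<Prod>(p, p')\<in>?P'. f (?t p') - f (?t p)) = (\<Prod>(p, p')\<in>?P'. f p' - f p)"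
    by (rule prod.reindex_bij_witness[where i="\<lambda>(p, p'). (?t p, ?t p')" and j="\<lambda>(p, p'). (?t p, ?t p')"])
      (use assms in \<open>auto simp: transpose_def split: if_splits\<close>)
  then show ?thesis
    unfolding prod.remove[OF finite_index_pairs x] by (simp add: algebra_simps)
qed

lemma diff_prod_adj_transps:
  fixes f :: "nat \<Rightarrow> int"
  assumes "\<forall>x\<in>set xs. 1 \<le> x \<and> Suc x \<le> m"
  shows "(\<Prod>(p, p')\<in>index_pairs m. f (apply_adj_transps xs p') - f (apply_adj_transps xs p)) =
     (- 1) ^ length xs * (\<Prod>(p, p')\<in>index_pairs m. f p' - f p)"
  using assms
proof (induction xs arbitrary: f)
  case (Cons x xs)
  have "(\<Prod>(p, p')\<in>index_pairs m. f (apply_adj_transps (x # xs) p') - f (apply_adj_transps (x # xs) p)) =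
    (- 1) ^ length xs * (\<Prod>(p, p')\<in>index_pairs m. (f \<circ> transpose x (Suc x)) p' - (f \<circ> transpose x (Suc x)) p)"
    using Cons.IH[of "f \<circ> transpose x (Suc x)"] Cons.prems by simp
  also have "\<dots> = (- 1) ^ length (x # xs) * (\<Prod>(p, p')\<in>index_pairs m. f p' - f p)"
    using diff_prod_adj_transpose[of x m f] Cons.prems by (simp add: comp_def)
  finally show ?case .
qed simp

lemma diff_prod_transpose:
  fixes f :: "nat \<Rightarrow> int"
  assumes "a \<in> {1..m}" "b \<in> {1..m}" "a < b"
  shows "(\<Prod>(p, p')\<in>index_pairs m. f (transpose a b p') - f (transpose a b p)) =
     - (\<Prod>(p, p')\<in>index_pairs m. f p' - f p)"
proof -
  have "odd (length (adj_transp_seq a b))" using assms by (simp add: length_adj_transp_seq)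
  then show ?thesis
    using diff_prod_adj_transps[of "adj_transp_seq a b" m f] assms
    by (auto simp: adj_transp_seq_correct set_adj_transp_seq)
qed

text \<open>Links the differences over \<open>1..m\<close> in \<open>column_sign\<close> with
  \<open>sign\<close> on permutations of \<open>{0..<m}\<close>: both equal 1 at the identity and
  change sign under composition with a transposition.\<close>

lemma sgn_diff_prod_permutes:
  assumes "\<pi> permutes {0..<m}"
  shows "sgn (\<Prod>(p, p')\<in>index_pairs m. int (\<pi> (p' - 1)) - int (\<pi> (p - 1))) = sign \<pi>"
  using finite_atLeastLessThan assms
proof (induction rule: permutes_rev_induct)
  case id
  have "(\<Prod>(p, p')\<in>index_pairs m. int (p' - 1) - int (p - 1)) > 0" by (rule prod_pos) auto
  then show ?case by simp
next
  case (swap a b \<pi>)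
  let ?W = "\<lambda>f. \<Prod>(p, p')\<in>index_pairs m. int (f (p' - 1)) - int (f (p - 1))"
  have *: "?W (\<pi> \<circ> transpose a b) = - ?W \<pi>" if "a < m" "b < m" "a < b" for a b
  proof -
    have shift: "transpose (Suc a) (Suc b) p - 1 = transpose a b (p - 1)" if "1 \<le> p" for p
      using that by (auto simp: transpose_def)
    have "?W (\<pi> \<circ> transpose a b) = (\<Prod>(p, p')\<in>index_pairs m.
        int (\<pi> (transpose (Suc a) (Suc b) p' - 1)) - int (\<pi> (transpose (Suc a) (Suc b) p - 1)))"
      by (rule prod.cong) (auto simp: shift simp del: One_nat_def)
    then show ?thesis
      using diff_prod_transpose[of "Suc a" m "Suc b" "\<lambda>p. int (\<pi> (p - 1))"] that by simp
  qed
  have perm: "permutation \<pi>" using swap by (auto simp: permutation_permutes)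
  have "?W (\<pi> \<circ> transpose a b) = - ?W \<pi>"
  proof (cases "a < b")
    case True
    then show ?thesis using * swap by simp
  next
    case False
    then have "b < a" using swap by simp
    then show ?thesis using *[of b a] swap by (simp add: transpose_commute)
  qed
  then have "sgn (?W (\<pi> \<circ> transpose a b)) = - sign \<pi>" using swap by (simp add: sgn_minus)
  also have "\<dots> = sign (\<pi> \<circ> transpose a b)"
    using swap perm by (simp add: sign_compose permutation_swap_id sign_swap_id)
  finally show ?case .
qed

section \<open>Polynomial functions on a vector space\<close>

interpretation fs: vector_space fscale
  by unfold_locales (auto simp: pointwise_def fun_eq_iff algebra_simps)

lemma fscale_apply [simp]: "fscale c f x = c * f x"
  by (simp add: pointwise_def)

lemma sum_fun_apply: "(\<Sum>i\<in>I. f i) x = (\<Sum>i\<in>I. f i x)"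
  by (induction I rule: infinite_finite_induct) auto

lemma minus_fun_apply [simp]: "(f - g) x = f x - g x"
  by (simp add: fun_diff_def)

lemma linear_on_add:
  "linear_on s (*) W f \<Longrightarrow> linear_on s (*) W g \<Longrightarrow> linear_on s (*) W (\<lambda>x. f x + g x)"
  by (simp add: linear_on_def algebra_simps)

lemma linear_on_zero: "linear_on s (*) W (\<lambda>x. 0)"
  by (simp add: linear_on_def)

lemma linear_on_sum_fun:
  "(\<And>i. i \<in> I \<Longrightarrow> linear_on s (*) W (f i)) \<Longrightarrow> linear_on s (*) W (\<lambda>x. \<Sum>i\<in>I. f i x)"
  by (induction I rule: infinite_finite_induct) (auto simp: linear_on_zero intro: linear_on_add)

lemma linear_on_cmult:
  "linear_on s (*) W f \<Longrightarrow> linear_on s (*) W (\<lambda>x. c * f x)"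
  by (simp add: linear_on_def algebra_simps)

lemma polynomial_on_sum:
  "(\<And>i. i \<in> I \<Longrightarrow> polynomial_on s W (f i)) \<Longrightarrow> polynomial_on s W (\<lambda>x. \<Sum>i\<in>I. f i x)"
  by (induction I rule: infinite_finite_induct) (auto intro: polynomial_on.intros)

lemma polynomial_on_prod:
  "(\<And>i. i \<in> I \<Longrightarrow> polynomial_on s W (f i)) \<Longrightarrow> polynomial_on s W (\<lambda>x. \<Prod>i\<in>I. f i x)"
  by (induction I rule: infinite_finite_induct) (auto intro: polynomial_on.intros)

lemma polynomial_on_power: "polynomial_on s W f \<Longrightarrow> polynomial_on s W (\<lambda>x. f x ^ k)"
  by (induction k) (auto intro: polynomial_on.intros)

lemma polynomial_on_cmult: "polynomial_on s W f \<Longrightarrow> polynomial_on s W (\<lambda>x. c * f x)"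
  by (intro polynomial_on.mult polynomial_on.const)

lemma polynomial_on_uminus: "polynomial_on s W f \<Longrightarrow> polynomial_on s W (\<lambda>x. - f x)"
  using polynomial_on_cmult[of s W f "- 1"] by simp

lemma polynomial_on_diff:
  "polynomial_on s W f \<Longrightarrow> polynomial_on s W g \<Longrightarrow> polynomial_on s W (\<lambda>x. f x - g x)"
  using polynomial_on.add[of s W f "\<lambda>x. - g x"] polynomial_on_uminus[of s W g] by simp

text \<open>The difference \<open>g - f\<close> vanishes on \<open>W\<close> and therefore counts as
  linear on \<open>W\<close>, whatever it does elsewhere; adding it corrects the values outside
  \<open>W\<close>.\<close>

lemma polynomial_on_cong:
  assumes "polynomial_on s W f" "\<And>x. x \<in> W \<Longrightarrow> f x = g x"
    and closed: "\<And>x y. x \<in> W \<Longrightarrow> y \<in> W \<Longrightarrow> x + y \<in> W" "\<And>c x. x \<in> W \<Longrightarrow> s c x \<in> W"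
  shows "polynomial_on s W g"
proof -
  have "linear_on s (*) W (\<lambda>x. g x - f x)"
    using assms by (simp add: linear_on_def)
  from polynomial_on.add[OF assms(1) polynomial_on.linear[OF this]] show ?thesis by simp
qed

lemma polynomial_on_comp:
  assumes "polynomial_on t V f" "linear_on s t W \<phi>" "\<phi> ` W \<subseteq> V"
  shows "polynomial_on s W (\<lambda>x. f (\<phi> x))"
  using assms(1)
proof induction
  case (linear f)
  then have "linear_on s (*) W (\<lambda>x. f (\<phi> x))"
    using assms(2,3) by (auto simp: linear_on_def image_subset_iff)
  then show ?case by (rule polynomial_on.linear)
qed (auto intro: polynomial_on.intros)

text \<open>Multiplying \<open>p - q\<close> by the variable removes the exception at
  \<open>0\<close>. Torus parameters give identities only away from \<open>0\<close>, and this
  carries them over to the limit.\<close>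

lemma poly_eqI_nonzero:
  fixes p q :: "'a :: {idom,ring_char_0} poly"
  assumes "\<And>c. c \<noteq> 0 \<Longrightarrow> poly p c = poly q c"
  shows "p = q"
proof -
  have "poly ((p - q) * [:0, 1:]) c = 0" for c
    using assms[of c] by auto
  then have "(p - q) * [:0, 1:] = 0" using poly_all_0_iff_0 by blast
  then show ?thesis by simp
qed

locale cspace = vector_space s for s :: "complex \<Rightarrow> 'a::ab_group_add \<Rightarrow> 'a" +
  fixes W :: "'a set"
  assumes W: "subspace W"
begin

lemma W_add: "x \<in> W \<Longrightarrow> y \<in> W \<Longrightarrow> x + y \<in> W"
  and W_scale: "x \<in> W \<Longrightarrow> s c x \<in> W"
  and W_zero: "0 \<in> W"
  using W by (auto simp: subspace_def)

lemma W_sum: "(\<And>i. i \<in> I \<Longrightarrow> f i \<in> W) \<Longrightarrow> sum f I \<in> W"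
  using W by (rule subspace_sum)

lemma linear_onD:
  assumes "linear_on s (*) W l"
  shows "x \<in> W \<Longrightarrow> y \<in> W \<Longrightarrow> l (x + y) = l x + l y" "x \<in> W \<Longrightarrow> l (s c x) = c * l x" "l 0 = 0"
proof -
  have "l (s 0 0) = 0 * l 0" using assms W_zero unfolding linear_on_def by blast
  then show "l 0 = 0" by simp
qed (use assms in \<open>auto simp: linear_on_def\<close>)

lemma linear_on_sum:
  assumes "linear_on s (*) W l" "\<And>i. i \<in> I \<Longrightarrow> f i \<in> W"
  shows "l (\<Sum>i\<in>I. f i) = (\<Sum>i\<in>I. l (f i))"
  using assms(2)
  by (induction I rule: infinite_finite_induct)
    (auto simp: linear_onD[OF assms(1)] W_sum)

lemma polynomial_on_curve:
  assumes "polynomial_on s W f" "\<And>k. w k \<in> W"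
  shows "\<exists>p. \<forall>t. f (\<Sum>k\<le>D. s (t ^ k) (w k)) = poly p t"
  using assms(1)
proof induction
  case (linear f)
  have "f (\<Sum>k\<le>D. s (t ^ k) (w k)) = poly (\<Sum>k\<le>D. monom (f (w k)) k) t" for t
    using assms(2) by (subst linear_on_sum[OF linear])
      (auto simp: W_scale linear_onD[OF linear] poly_sum poly_monom mult.commute)
  then show ?case by blast
next
  case (const c)
  show ?case by (rule exI[of _ "[:c:]"]) simp
next
  case (add f g)
  then obtain p q where "\<forall>t. f (\<Sum>k\<le>D. s (t ^ k) (w k)) = poly p t" "\<forall>t. g (\<Sum>k\<le>D. s (t ^ k) (w k)) = poly q t"
    by blast
  then show ?case by (intro exI[of _ "p + q"]) simp
next
  case (mult f g)
  then obtain p q where "\<forall>t. f (\<Sum>k\<le>D. s (t ^ k) (w k)) = poly p t" "\<forall>t. g (\<Sum>k\<le>D. s (t ^ k) (w k)) = poly q t"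
    by blast
  then show ?case by (intro exI[of _ "p * q"]) simp
qed

lemma polynomial_on_line:
  assumes "polynomial_on s W f" "a \<in> W" "b \<in> W"
  shows "\<exists>p. \<forall>t. f (a + s t b) = poly p t"
proof -
  have "a + s t b = (\<Sum>k\<le>Suc 0. s (t ^ k) ((\<lambda>k. if k = 0 then a else b) k))" for t
    by simp
  then show ?thesis
    using polynomial_on_curve[OF assms(1), of "\<lambda>k. if k = 0 then a else b" "Suc 0"] assms by simp
qed

section \<open>Homogeneous forms as sums of powers of linear forms\<close>

definition prod_forms :: "nat \<Rightarrow> ('a \<Rightarrow> complex) set" where
  "prod_forms k = {(\<lambda>x. if x \<in> W then \<Prod>a<k. l a x else 0) | l. \<forall>a. linear_on s (*) W (l a)}"

definition power_forms :: "nat \<Rightarrow> ('a \<Rightarrow> complex) set" where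
  "power_forms k = {(\<lambda>x. if x \<in> W then l x ^ k else 0) | l. linear_on s (*) W l}"

lemma span_prod_forms_mult:
  assumes "f \<in> fs.span (prod_forms k)" "g \<in> fs.span (prod_forms l)"
  shows "(\<lambda>x. f x * g x) \<in> fs.span (prod_forms (k + l))"
  using assms(1)
proof (induction rule: fs.span_induct_alt)
  case base
  have "(\<lambda>x. 0 x * g x) = (0 :: 'a \<Rightarrow> complex)" by (simp add: fun_eq_iff)
  then show ?case by (simp only: fs.span_zero)
next
  case (step c f' f)
  have "(\<lambda>x. f' x * g x) \<in> fs.span (prod_forms (k + l))"
    using assms(2)
  proof (induction rule: fs.span_induct_alt)
    case base
    have "(\<lambda>x. f' x * 0 x) = (0 :: 'a \<Rightarrow> complex)" by (simp add: fun_eq_iff)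
    then show ?case by (simp only: fs.span_zero)
  next
    case (step c g' g)
    obtain u where u: "f' = (\<lambda>x. if x \<in> W then \<Prod>a<k. u a x else 0)" "\<forall>a. linear_on s (*) W (u a)"
      using \<open>f' \<in> prod_forms k\<close> unfolding prod_forms_def by blast
    obtain v where v: "g' = (\<lambda>x. if x \<in> W then \<Prod>a<l. v a x else 0)" "\<forall>a. linear_on s (*) W (v a)"
      using step(1) unfolding prod_forms_def by blast
    let ?w = "\<lambda>a. if a < k then u a else v (a - k)"
    have "(\<Prod>a<k. u a x) * (\<Prod>a<l. v a x) = (\<Prod>a<k + l. ?w a x)" for x
    proof -
      have "(\<Prod>a<k + l. ?w a x) = (\<Prod>a\<in>{..<k} \<union> {k..<k+l}. ?w a x)"
        by (rule prod.cong) auto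
      also have "\<dots> = (\<Prod>a<k. ?w a x) * (\<Prod>a\<in>{k..<k+l}. ?w a x)"
        by (rule prod.union_disjoint) auto
      also have "(\<Prod>a<k. ?w a x) = (\<Prod>a<k. u a x)" by simp
      also have "(\<Prod>a\<in>{k..<k+l}. ?w a x) = (\<Prod>a<l. v a x)"
        by (rule prod.reindex_bij_witness[where i="\<lambda>a. a + k" and j="\<lambda>a. a - k"]) auto
      finally show ?thesis by simp
    qed
    then have "(\<lambda>x. f' x * g' x) \<in> prod_forms (k + l)"
      unfolding prod_forms_def using u v
      by (intro CollectI exI[of _ ?w]) (auto simp: fun_eq_iff)
    then have "fscale c (\<lambda>x. f' x * g' x) + (\<lambda>x. f' x * g x) \<in> fs.span (prod_forms (k + l))"
      using step by (metis fs.span_add fs.span_scale fs.span_base)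
    also have "fscale c (\<lambda>x. f' x * g' x) + (\<lambda>x. f' x * g x) = (\<lambda>x. f' x * (fscale c g' + g) x)"
      by (simp add: fun_eq_iff algebra_simps)
    finally show ?case .
  qed
  then have "fscale c (\<lambda>x. f' x * g x) + (\<lambda>x. f x * g x) \<in> fs.span (prod_forms (k + l))"
    using step by (intro fs.span_add fs.span_scale)
  also have "fscale c (\<lambda>x. f' x * g x) + (\<lambda>x. f x * g x) = (\<lambda>x. (fscale c f' + f) x * g x)"
    by (simp add: fun_eq_iff algebra_simps)
  finally show ?case .
qed

text \<open>The polarization identity writes a product of \<open>k\<close> linear forms as a
  combination of \<open>k\<close>-th powers of their partial sums, divided by
  \<open>fact k\<close>.\<close>

lemma span_prod_forms_sub_power_forms: "fs.span (prod_forms k) \<subseteq> fs.span (power_forms k)"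
proof (rule fs.span_minimal)
  show "prod_forms k \<subseteq> fs.span (power_forms k)"
  proof
    fix f assume "f \<in> prod_forms k"
    then obtain l where l: "f = (\<lambda>x. if x \<in> W then \<Prod>a<k. l a x else 0)" "\<forall>a. linear_on s (*) W (l a)"
      unfolding prod_forms_def by blast
    let ?g = "\<lambda>U x. if x \<in> W then (\<Sum>a\<in>U. l a x) ^ k else 0"
    have "f = fscale (1 / fact k) (\<Sum>U\<in>Pow {..<k}. fscale ((- 1) ^ card ({..<k} - U)) (?g U))"
    proof
      fix x
      show "f x = fscale (1 / fact k) (\<Sum>U\<in>Pow {..<k}. fscale ((- 1) ^ card ({..<k} - U)) (?g U)) x"
        using sum_subset_signed_power[of "{..<k}" "\<lambda>a. l a x"] l
        by (simp add: sum_fun_apply)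
    qed
    moreover have "?g U \<in> power_forms k" for U
      unfolding power_forms_def using l(2)
      by (intro CollectI exI[of _ "\<lambda>x. \<Sum>a\<in>U. l a x"]) (auto intro: linear_on_sum_fun)
    ultimately show "f \<in> fs.span (power_forms k)"
      by (metis (no_types, lifting) fs.span_scale fs.span_sum fs.span_base)
  qed
qed (rule fs.subspace_span)

lemma span_power_forms_hom_poly: "fs.span (power_forms k) \<subseteq> hom_poly s W k"
proof
  fix f assume "f \<in> fs.span (power_forms k)"
  then have "polynomial_on s W f \<and> (\<forall>x. x \<notin> W \<longrightarrow> f x = 0) \<and> (\<forall>c. \<forall>x\<in>W. f (s c x) = c ^ k * f x)"
  proof (induction rule: fs.span_induct_alt)
    case base
    then show ?case using polynomial_on.const[of s W 0] by (simp add: zero_fun_def)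
  next
    case (step c f g)
    then obtain l where l: "f = (\<lambda>x. if x \<in> W then l x ^ k else 0)" "linear_on s (*) W l"
      unfolding power_forms_def by blast
    have "polynomial_on s W f"
      by (rule polynomial_on_cong[OF polynomial_on_power[OF polynomial_on.linear[OF l(2)], of k]])
        (auto simp: l W_add W_scale)
    then have "polynomial_on s W (\<lambda>x. c * f x + g x)"
      using step by (intro polynomial_on.add polynomial_on_cmult) auto
    moreover have "fscale c f + g = (\<lambda>x. c * f x + g x)" by (simp add: fun_eq_iff)
    ultimately show ?case
      using step l by (auto simp: W_scale linear_onD algebra_simps)
  qed
  then show "f \<in> hom_poly s W k"
    by (auto simp: hom_poly_def coordinate_ring_def fun_eq_iff intro!: exI[of _ f])
qed

lemma polynomial_on_graded:
  assumes "polynomial_on s W f"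
  shows "\<exists>D h. (\<forall>k. h k \<in> fs.span (prod_forms k)) \<and> (\<forall>x\<in>W. f x = (\<Sum>k\<le>D. h k x))"
  using assms
proof induction
  case (linear f)
  define h where "h = (\<lambda>(k::nat) x. if k = 1 \<and> x \<in> W then f x else 0)"
  have "h k \<in> fs.span (prod_forms k)" for k :: nat
  proof (cases "k = 1")
    case True
    then have "h k \<in> prod_forms k"
      unfolding prod_forms_def h_def using linear by (intro CollectI exI[of _ "\<lambda>_. f"]) auto
    then show ?thesis by (rule fs.span_base)
  next
    case False
    then have "h k = 0" by (simp add: h_def fun_eq_iff)
    then show ?thesis using fs.span_zero by metis
  qed
  moreover have "f x = (\<Sum>k\<le>1. h k x)" if "x \<in> W" for x
    using that by (simp add: h_def)
  ultimately show ?case by blast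
next
  case (const c)
  \<comment> \<open>In degree \<open>0\<close> the empty product makes the indicator function of
    \<open>W\<close> a product of linear forms.\<close>
  define h where "h = (\<lambda>k::nat. fscale (if k = 0 then c else 0) (\<lambda>x. if x \<in> W then \<Prod>a<k. 0 else 0))"
  have "(\<lambda>x. if x \<in> W then \<Prod>a<k. 0 else 0) \<in> prod_forms k" for k :: nat
    unfolding prod_forms_def using linear_on_zero
    by (intro CollectI exI[of _ "\<lambda>_ _. 0"]) auto
  then have "h k \<in> fs.span (prod_forms k)" for k
    unfolding h_def by (intro fs.span_scale fs.span_base)
  moreover have "c = (\<Sum>k\<le>0. h k x)" if "x \<in> W" for x
    using that by (simp add: h_def)
  ultimately show ?case by blast
next
  case (add f g)
  then obtain D h D' h' where h: "\<forall>k. h k \<in> fs.span (prod_forms k)" "\<forall>x\<in>W. f x = (\<Sum>k\<le>D. h k x)"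
    and h': "\<forall>k. h' k \<in> fs.span (prod_forms k)" "\<forall>x\<in>W. g x = (\<Sum>k\<le>D'. h' k x)"
    by blast
  define H where "H = (\<lambda>k. (if k \<le> D then h k else 0) + (if k \<le> D' then h' k else 0))"
  have "H k \<in> fs.span (prod_forms k)" for k
    unfolding H_def using h h' fs.span_zero by (intro fs.span_add) auto
  moreover have "f x + g x = (\<Sum>k\<le>max D D'. H k x)" if "x \<in> W" for x
  proof -
    have "(\<Sum>k\<le>max D D'. H k x) = (\<Sum>k\<le>max D D'. if k \<le> D then h k x else 0) + (\<Sum>k\<le>max D D'. if k \<le> D' then h' k x else 0)"
      unfolding sum.distrib[symmetric] by (rule sum.cong) (auto simp: H_def)
    also have "(\<Sum>k\<le>max D D'. if k \<le> D then h k x else 0) = (\<Sum>k\<le>D. h k x)"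
      by (rule sum.mono_neutral_cong_right) auto
    also have "(\<Sum>k\<le>max D D'. if k \<le> D' then h' k x else 0) = (\<Sum>k\<le>D'. h' k x)"
      by (rule sum.mono_neutral_cong_right) auto
    finally show ?thesis using h h' that by simp
  qed
  ultimately show ?case by blast
next
  case (mult f g)
  then obtain D h D' h' where h: "\<forall>k. h k \<in> fs.span (prod_forms k)" "\<forall>x\<in>W. f x = (\<Sum>k\<le>D. h k x)"
    and h': "\<forall>k. h' k \<in> fs.span (prod_forms k)" "\<forall>x\<in>W. g x = (\<Sum>k\<le>D'. h' k x)"
    by blast
  define H where "H = (\<lambda>n. \<Sum>z\<in>{z \<in> {..D} \<times> {..D'}. fst z + snd z = n}. (\<lambda>x. h (fst z) x * h' (snd z) x))"
  have "H n \<in> fs.span (prod_forms n)" for n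
    unfolding H_def using h h' by (intro fs.span_sum) (auto dest!: span_prod_forms_mult)
  moreover have "f x * g x = (\<Sum>n\<le>D + D'. H n x)" if "x \<in> W" for x
  proof -
    have "f x * g x = (\<Sum>z\<in>{..D} \<times> {..D'}. h (fst z) x * h' (snd z) x)"
      using h h' that by (simp add: sum_product sum.cartesian_product case_prod_beta)
    also have "\<dots> = (\<Sum>n\<le>D + D'. \<Sum>z\<in>{z \<in> {..D} \<times> {..D'}. fst z + snd z = n}. h (fst z) x * h' (snd z) x)"
      by (rule sum.group[symmetric]) auto
    finally show ?thesis by (simp add: H_def sum_fun_apply)
  qed
  ultimately show ?case by blast
qed

lemma polynomial_on_graded_hom:
  assumes "polynomial_on s W f"
  shows "\<exists>D h. (\<forall>k. h k \<in> hom_poly s W k) \<and> (\<forall>x\<in>W. f x = (\<Sum>k\<le>D. h k x))"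
  using polynomial_on_graded[OF assms] span_prod_forms_sub_power_forms span_power_forms_hom_poly by blast

lemma hom_poly_homogeneous: "f \<in> hom_poly s W k \<Longrightarrow> x \<in> W \<Longrightarrow> f (s c x) = c ^ k * f x"
  by (simp add: hom_poly_def)

lemma hom_poly_outside: "f \<in> hom_poly s W k \<Longrightarrow> x \<notin> W \<Longrightarrow> f x = 0"
  by (auto simp: hom_poly_def coordinate_ring_def)

lemma hom_poly_polynomial: "f \<in> hom_poly s W k \<Longrightarrow> polynomial_on s W f"
  by (auto simp: hom_poly_def coordinate_ring_def intro: polynomial_on_cong W_add W_scale)

lemma hom_polyI:
  assumes "polynomial_on s W f" "\<And>x. x \<notin> W \<Longrightarrow> f x = 0" "\<And>c x. x \<in> W \<Longrightarrow> f (s c x) = c ^ k * f x"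
  shows "f \<in> hom_poly s W k"
  using assms by (auto simp: hom_poly_def coordinate_ring_def fun_eq_iff intro!: exI[of _ f])

text \<open>Comparing coefficients of \<open>c\<close> in \<open>f (s c x)\<close>.\<close>

lemma graded_component:
  assumes "\<And>k. h k \<in> hom_poly s W k" "x \<in> W" "\<And>c. c \<noteq> 0 \<Longrightarrow> (\<Sum>k\<le>D. h k (s (c ^ r) x)) = c ^ n * (\<Sum>k\<le>D. h k x)"
  shows "(\<Sum>k\<le>D. h k x) = (\<Sum>k\<le>D. if r * k = n then h k x else 0)"
proof -
  let ?v = "\<Sum>k\<le>D. h k x"
  have "poly (\<Sum>k\<le>D. monom (h k x) (r * k)) c = poly (monom ?v n) c" if "c \<noteq> 0" for c
  proof -
    have "(\<Sum>k\<le>D. h k (s (c ^ r) x)) = (\<Sum>k\<le>D. h k x * c ^ (r * k))"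
      by (simp add: hom_poly_homogeneous[OF assms(1,2)] mult.commute flip: power_mult)
    then show ?thesis using assms(3)[OF that] by (simp add: poly_sum poly_monom mult.commute)
  qed
  then have "(\<Sum>k\<le>D. monom (h k x) (r * k)) = monom ?v n" by (rule poly_eqI_nonzero)
  then have "coeff (\<Sum>k\<le>D. monom (h k x) (r * k)) n = ?v" by simp
  then show ?thesis by (simp add: coeff_sum)
qed

text \<open>A polynomial is a sum of components that are combinations of powers; homogeneity of
  \<open>f\<close> leaves only the component of degree \<open>n\<close>, if there is one.\<close>

lemma hom_poly_sub_span: "hom_poly s W n \<subseteq> fs.span (power_forms n)"
proof
  fix f assume f: "f \<in> hom_poly s W n"
  obtain D h where h: "\<And>k. h k \<in> fs.span (prod_forms k)" "\<And>x. x\<in>W \<Longrightarrow> f x = (\<Sum>k\<le>D. h k x)"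
    using polynomial_on_graded[OF hom_poly_polynomial[OF f]] by blast
  have hom: "h k \<in> hom_poly s W k" for k
    using h span_prod_forms_sub_power_forms span_power_forms_hom_poly by blast
  have "f x = (if n \<le> D then h n else 0) x" for x
  proof (cases "x \<in> W")
    case True
    have "(\<Sum>k\<le>D. h k x) = (\<Sum>k\<le>D. if 1 * k = n then h k x else 0)"
    proof (rule graded_component[OF hom True])
      fix c
      show "(\<Sum>k\<le>D. h k (s (c ^ 1) x)) = c ^ n * (\<Sum>k\<le>D. h k x)"
        using hom_poly_homogeneous[OF f True, of c] h(2)[OF True] h(2)[OF W_scale[OF True], of c] by simp
    qed
    then show ?thesis using h(2)[OF True] by auto
  next
    case False
    then show ?thesis using hom_poly_outside[OF f] hom_poly_outside[OF hom] by simp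
  qed
  then have "f = (if n \<le> D then h n else 0)" by blast
  then show "f \<in> fs.span (power_forms n)"
    using h(1)[of n] span_prod_forms_sub_power_forms fs.span_zero by (auto split: if_splits)
qed

lemma hom_poly_eq_span: "hom_poly s W k = fs.span (power_forms k)"
  using hom_poly_sub_span span_power_forms_hom_poly by blast

lemma subspace_hom_poly: "fs.subspace (hom_poly s W k)"
  by (simp add: hom_poly_eq_span)

text \<open>A form of degree \<open>k\<close> on a sum of any number of vectors is determined by its
  values on sums of at most \<open>k\<close> of them. By linearity it suffices to treat the
  \<open>k\<close>-th power of a linear form, whose expansion is polarized term by term.\<close>

lemma hom_poly_polarization:
  assumes "F \<in> hom_poly s W k" "finite J" "\<And>j. j \<in> J \<Longrightarrow> q j \<in> W"
  shows "fact k * F (\<Sum>j\<in>J. q j) =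
    (\<Sum>\<xi>\<in>{..<k} \<rightarrow>\<^sub>E J. \<Sum>U\<in>Pow {..<k}. (- 1) ^ card ({..<k} - U) * F (\<Sum>a\<in>U. q (\<xi> a)))"
  using assms(1)[unfolded hom_poly_eq_span]
proof (induction rule: fs.span_induct_alt)
  case base
  then show ?case by simp
next
  case (step c f g)
  then obtain l where l: "f = (\<lambda>x. if x \<in> W then l x ^ k else 0)" "linear_on s (*) W l"
    unfolding power_forms_def by blast
  have "fact k * f (\<Sum>j\<in>J. q j) = fact k * (\<Prod>a<k. \<Sum>j\<in>J. l (q j))"
    using assms(3) by (simp add: l W_sum linear_on_sum[OF l(2)])
  also have "\<dots> = fact k * (\<Sum>\<xi>\<in>{..<k} \<rightarrow>\<^sub>E J. \<Prod>a<k. l (q (\<xi> a)))"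
    by (subst prod_sum_PiE) (use assms in auto)
  also have "\<dots> = (\<Sum>\<xi>\<in>{..<k} \<rightarrow>\<^sub>E J. fact k * (\<Prod>a<k. l (q (\<xi> a))))"
    by (simp add: sum_distrib_left)
  also have "\<dots> = (\<Sum>\<xi>\<in>{..<k} \<rightarrow>\<^sub>E J. \<Sum>U\<in>Pow {..<k}. (- 1) ^ card ({..<k} - U) * f (\<Sum>a\<in>U. q (\<xi> a)))"
  proof (rule sum.cong[OF refl])
    fix \<xi> assume xi: "\<xi> \<in> {..<k} \<rightarrow>\<^sub>E J"
    have "f (\<Sum>a\<in>U. q (\<xi> a)) = (\<Sum>a\<in>U. l (q (\<xi> a))) ^ k" if "U \<in> Pow {..<k}" for U
    proof -
      have "q (\<xi> a) \<in> W" if "a \<in> U" for a using xi that \<open>U \<in> Pow {..<k}\<close> assms(3) by auto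
      then show ?thesis by (simp add: l W_sum linear_on_sum[OF l(2)])
    qed
    then show "fact k * (\<Prod>a<k. l (q (\<xi> a))) =
      (\<Sum>U\<in>Pow {..<k}. (- 1) ^ card ({..<k} - U) * f (\<Sum>a\<in>U. q (\<xi> a)))"
      using sum_subset_signed_power[of "{..<k}" "\<lambda>a. l (q (\<xi> a))"] by simp
  qed
  finally show ?case using step
    by (simp add: algebra_simps sum.distrib sum_distrib_left)
qed

text \<open>\<open>C\<close> is a spanning cone, so coefficients are absorbed into its elements and
  polarization leaves only sums of at most \<open>k\<close> of them; the element \<open>0\<close>
  pads shorter sums to length \<open>k\<close>.\<close>

lemma hom_poly_zero_if_zero_on_sums:
  assumes F: "F \<in> hom_poly s W k" and C: "W \<subseteq> span C" "C \<subseteq> W" "0 \<in> C" "\<And>c x. x \<in> C \<Longrightarrow> s c x \<in> C"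
    and zero: "\<And>y. (\<And>a. y a \<in> C) \<Longrightarrow> F (\<Sum>a<k. y a) = 0"
  shows "F = 0"
proof
  fix x
  show "F x = 0 x"
  proof (cases "x \<in> W")
    case True
    then obtain J r where J: "finite J" "J \<subseteq> C" "x = (\<Sum>j\<in>J. s (r j) j)"
      using C(1) unfolding span_explicit by blast
    define q where "q = (\<lambda>j. s (r j) j)"
    have q: "q j \<in> C" if "j \<in> J" for j using that J C(4) by (auto simp: q_def)
    have "F (\<Sum>a\<in>U. q (\<xi> a)) = 0" if "\<xi> \<in> {..<k} \<rightarrow>\<^sub>E J" "U \<in> Pow {..<k}" for \<xi> U
    proof -
      have "(\<Sum>a\<in>U. q (\<xi> a)) = (\<Sum>a<k. if a \<in> U then q (\<xi> a) else 0)"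
        by (rule sum.mono_neutral_cong_left) (use that in auto)
      also have "F \<dots> = F (\<Sum>a<k. if a \<in> U \<inter> {..<k} then q (\<xi> a) else 0)"
        by (intro arg_cong[where f=F] sum.cong) auto
      also have "\<dots> = 0" by (rule zero) (use that q C(3) in auto)
      finally show ?thesis .
    qed
    moreover have "x = (\<Sum>j\<in>J. q j)" using J(3) by (simp add: q_def)
    ultimately have "fact k * F x = 0"
      using hom_poly_polarization[OF F J(1), of q] q C(2) by (simp add: subset_iff)
    then show ?thesis by simp
  next
    case False
    then show ?thesis using hom_poly_outside[OF F] by simp
  qed
qed

end

section \<open>Coordinates\<close>

lemma det_mat_poly: "polynomial_on fscale UNIV (\<lambda>g. det (mat n n g))"
proof -
  have "linear_on fscale (*) UNIV (\<lambda>g :: nat \<times> nat \<Rightarrow> complex. g y)" for y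
    by (simp add: linear_on_def)
  then have "polynomial_on fscale UNIV (\<lambda>g. \<Sum>p | p permutes {0..<n}. signof p * (\<Prod>i=0..<n. g (i, p i)))"
    by (intro polynomial_on_sum polynomial_on_cmult polynomial_on_prod polynomial_on.linear)
  moreover have "det (mat n n g) = (\<Sum>p | p permutes {0..<n}. signof p * (\<Prod>i=0..<n. g (i, p i)))"
    for g :: "nat \<times> nat \<Rightarrow> complex"
    by (subst det_def'[of _ n]) (auto intro!: sum.cong prod.cong simp: permutes_in_image)
  ultimately show ?thesis by simp
qed

text \<open>Matrices are treated as functions on index pairs, which form a vector space on a whole
  type; the theory of polynomial functions then applies to functions of the matrix entries, of which
  only finitely many matter each time.\<close>

interpretation UN: cspace fscale UNIV
  by unfold_locales (auto simp: fs.subspace_def)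

text \<open>On the line from \<open>g\<close> to the identity matrix the determinant is a nonzero polynomial.\<close>

lemma polynomial_density:
  assumes f: "polynomial_on fscale UNIV f" and zero: "\<And>g. det (mat n n g) \<noteq> 0 \<Longrightarrow> f g = 0"
  shows "f g = (0::complex)"
proof -
  let ?I = "\<lambda>y. if fst y = snd y then 1 else 0 :: complex"
  let ?l = "\<lambda>t. g + fscale t (?I - g)"
  obtain p where p: "\<And>t. f (?l t) = poly p t"
    using UN.polynomial_on_line[OF f, of g "?I - g"] by auto
  obtain d where d: "\<And>t. det (mat n n (?l t)) = poly d t"
    using UN.polynomial_on_line[OF det_mat_poly, of g "?I - g" n] by auto
  have "?l 1 = ?I" by (simp add: fun_eq_iff)
  moreover have "mat n n ?I = 1\<^sub>m n" by (rule eq_matI) auto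
  ultimately have "poly d 1 = 1" using d[of 1] by simp
  then have "d \<noteq> 0" by auto
  moreover have "poly (p * d) t = 0" for t
    using zero[of "?l t"] p[of t] d[of t] by auto
  then have "p * d = 0" using poly_all_0_iff_0 by blast
  ultimately have "p = 0" by simp
  moreover have "?l 0 = g" by (simp add: fun_eq_iff)
  ultimately show ?thesis using p[of 0] by simp
qed

locale based_space = cspace s E for s :: "complex \<Rightarrow> 'a::ab_group_add \<Rightarrow> 'a" and E +
  fixes N :: nat and e :: "nat \<Rightarrow> 'a"
  assumes basis: "ordered_basis s E N e"
begin

text \<open>Renumbered from \<open>0\<close>, to agree with the indices of matrices;
  \<open>matrix_entry\<close> and the weights keep indices from \<open>1\<close>.\<close>

definition b :: "nat \<Rightarrow> 'a" where "b j = e (Suc j)"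

lemma b_image: "e ` {1..N} = b ` {..<N}"
proof -
  have "{1..N} = Suc ` {..<N}" by (simp add: image_Suc_lessThan)
  then show ?thesis by (auto simp: b_def)
qed

definition coord :: "nat \<Rightarrow> 'a \<Rightarrow> complex" where
  "coord j x = representation (b ` {..<N}) x (b j)"

lemma span_b: "span (b ` {..<N}) = E" and indep_b: "independent (b ` {..<N})"
  and inj_b: "inj_on b {..<N}"
proof -
  show "span (b ` {..<N}) = E" "independent (b ` {..<N})"
    using basis unfolding ordered_basis_def b_image by blast+
  show "inj_on b {..<N}"
  proof -
    have "inj_on e (Suc ` {..<N})" using basis unfolding ordered_basis_def image_Suc_lessThan by blast
    then have "inj_on (e \<circ> Suc) {..<N}" by (intro comp_inj_on inj_Suc) (auto intro: inj_on_subset[OF inj_Suc])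
    then show ?thesis by (simp only: b_def[abs_def] comp_def)
  qed
qed

lemma b_in: "j < N \<Longrightarrow> b j \<in> E"
  by (subst span_b[symmetric]) (auto intro: span_base)

lemma coord_sum: "x \<in> E \<Longrightarrow> (\<Sum>j<N. s (coord j x) (b j)) = x"
  using sum_representation_eq[OF indep_b, of x "b ` {..<N}"] span_b
  by (simp add: coord_def sum.reindex[OF inj_b])

lemma coord_add: "x \<in> E \<Longrightarrow> y \<in> E \<Longrightarrow> coord j (x + y) = coord j x + coord j y"
  using representation_add[OF indep_b] span_b by (simp add: coord_def)

lemma coord_scale: "x \<in> E \<Longrightarrow> coord j (s c x) = c * coord j x"
  using representation_scale[OF indep_b] span_b by (simp add: coord_def)

lemma linear_coord: "linear_on s (*) E (coord j)"
  by (simp add: linear_on_def coord_add coord_scale)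

lemma coord_b: "j < N \<Longrightarrow> k < N \<Longrightarrow> coord j (b k) = (if j = k then 1 else 0)"
  using representation_basis[OF indep_b, of "b k"] inj_b
  by (auto simp: coord_def inj_on_def)

lemma coord_comb:
  assumes "k < N"
  shows "coord k (\<Sum>j<N. s (c j) (b j)) = c k"
proof -
  have "coord k (\<Sum>j<N. s (c j) (b j)) = (\<Sum>j<N. coord k (s (c j) (b j)))"
    by (intro linear_on_sum[OF linear_coord] W_scale b_in) auto
  also have "\<dots> = (\<Sum>j<N. if k = j then c j else 0)"
    using assms by (intro sum.cong) (auto simp: coord_scale b_in coord_b)
  also have "\<dots> = c k" using assms by simp
  finally show ?thesis .
qed

lemma linear_expand:
  assumes l: "linear_on s (*) E l" and x: "x \<in> E"
  shows "l x = (\<Sum>j<N. coord j x * l (b j))"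
proof -
  have "l (\<Sum>j<N. s (coord j x) (b j)) = (\<Sum>j<N. l (s (coord j x) (b j)))"
    by (intro linear_on_sum[OF l] W_scale b_in) auto
  also have "\<dots> = (\<Sum>j<N. coord j x * l (b j))"
    by (intro sum.cong refl linear_onD(2)[OF l] b_in) auto
  finally show ?thesis using coord_sum[OF x] by simp
qed

definition T :: "complex mat \<Rightarrow> 'a \<Rightarrow> 'a" where
  "T A x = (\<Sum>k<N. s (\<Sum>j<N. A $$ (k, j) * coord j x) (b k))"

lemma T_in: "T A x \<in> E"
  unfolding T_def by (intro W_sum W_scale b_in) auto

lemma coord_T: "k < N \<Longrightarrow> coord k (T A x) = (\<Sum>j<N. A $$ (k, j) * coord j x)"
  using coord_comb[of k "\<lambda>k. \<Sum>j<N. A $$ (k, j) * coord j x"] by (simp only: T_def)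

lemma E_eqI:
  assumes "x \<in> E" "y \<in> E" "\<And>k. k < N \<Longrightarrow> coord k x = coord k y"
  shows "x = y"
proof -
  have "(\<Sum>j<N. s (coord j x) (b j)) = (\<Sum>j<N. s (coord j y) (b j))"
    using assms(3) by (intro sum.cong) auto
  then show ?thesis using coord_sum[OF assms(1)] coord_sum[OF assms(2)] by simp
qed

lemma T_mult:
  assumes "A \<in> carrier_mat N N" "B \<in> carrier_mat N N"
  shows "T (A * B) x = T A (T B x)"
proof (rule E_eqI)
  fix k assume k: "k < N"
  have "coord k (T (A * B) x) = (\<Sum>j<N. (\<Sum>l<N. A $$ (k, l) * B $$ (l, j)) * coord j x)"
    unfolding coord_T[OF k] using assms k
    by (intro sum.cong) (auto simp: scalar_prod_def lessThan_atLeast0)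
  also have "\<dots> = (\<Sum>l<N. \<Sum>j<N. A $$ (k, l) * B $$ (l, j) * coord j x)"
    unfolding sum_distrib_right by (rule sum.swap)
  also have "\<dots> = coord k (T A (T B x))"
    by (simp add: coord_T k sum_distrib_left mult.assoc)
  finally show "coord k (T (A * B) x) = coord k (T A (T B x))" .
qed (rule T_in)+

lemma T_one:
  assumes "x \<in> E"
  shows "T (1\<^sub>m N) x = x"
proof (rule E_eqI)
  fix k assume k: "k < N"
  have "coord k (T (1\<^sub>m N) x) = (\<Sum>j<N. if k = j then coord j x else 0)"
    unfolding coord_T[OF k] using k by (intro sum.cong) auto
  then show "coord k (T (1\<^sub>m N) x) = coord k x" using k by simp
qed (use assms T_in in auto)

lemma T_linear: "linear_on s s E (T A)"
proof -
  have "T A (x + y) = T A x + T A y" if "x \<in> E" "y \<in> E" for x y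
    by (rule E_eqI) (use that in \<open>auto simp: T_in W_add coord_T coord_add algebra_simps sum.distrib\<close>)
  moreover have "T A (s c x) = s c (T A x)" if "x \<in> E" for c x
    by (rule E_eqI) (use that in \<open>auto simp: T_in W_scale coord_T coord_scale algebra_simps sum_distrib_left\<close>)
  ultimately show ?thesis by (simp add: linear_on_def)
qed

lemma sum_coord_b: "j < N \<Longrightarrow> (\<Sum>l<N. f l * coord l (b j)) = f j"
proof -
  assume j: "j < N"
  have "(\<Sum>l<N. f l * coord l (b j)) = (\<Sum>l<N. if l = j then f l else 0)"
    using j by (intro sum.cong) (auto simp: coord_b)
  then show ?thesis using j by simp
qed

lemma T_b: "j < N \<Longrightarrow> T A (b j) = (\<Sum>k<N. s (A $$ (k, j)) (b k))"
  unfolding T_def by (simp only: sum_coord_b)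

definition mat_of :: "('a \<Rightarrow> 'a) \<Rightarrow> complex mat" where
  "mat_of g = mat N N (\<lambda>(k, j). coord k (g (b j)))"

lemma mat_of_carrier: "mat_of g \<in> carrier_mat N N"
  by (simp add: mat_of_def)

lemma T_mat_of:
  assumes "linear_on s s E g" "\<And>y. y \<in> E \<Longrightarrow> g y \<in> E" "x \<in> E"
  shows "T (mat_of g) x = g x"
proof (rule E_eqI)
  fix k assume k: "k < N"
  have "linear_on s (*) E (\<lambda>x. coord k (g x))"
    using assms by (simp add: linear_on_def coord_add coord_scale)
  from linear_expand[OF this assms(3)] show "coord k (T (mat_of g) x) = coord k (g x)"
    using k by (simp add: coord_T mat_of_def mult.commute)
qed (use assms T_in in auto)

lemma mat_of_T: "A \<in> carrier_mat N N \<Longrightarrow> mat_of (T A) = A"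
  by (rule eq_matI) (auto simp: mat_of_def coord_T sum_coord_b)

lemma matrix_entry_eq:
  assumes "i \<in> {1..N}" "j \<in> {1..N}"
  shows "matrix_entry s N e g i j = mat_of g $$ (i - 1, j - 1)"
proof -
  have "e i = b (i - 1)" "e j = b (j - 1)" "i - 1 < N" "j - 1 < N" using assms by (auto simp: b_def)
  then show ?thesis by (simp only: matrix_entry_def b_image mat_of_def coord_def index_mat prod.case)
qed

lemma GL_inverse:
  assumes "A \<in> carrier_mat N N" "det A \<noteq> (0::complex)"
  obtains B where "B \<in> carrier_mat N N" "A * B = 1\<^sub>m N" "B * A = 1\<^sub>m N" "det B \<noteq> 0"
proof -
  have "A \<in> Units (ring_mat TYPE(complex) N ())"
    by (rule det_non_zero_imp_unit[OF assms])
  then obtain B where B: "B \<in> carrier_mat N N" "A * B = 1\<^sub>m N" "B * A = 1\<^sub>m N"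
    by (auto simp: Units_def ring_mat_def)
  then have "det A * det B = 1" using det_mult[OF assms(1) B(1)] by simp
  then have "det B \<noteq> 0" by auto
  then show ?thesis using that B by blast
qed

lemma T_GL:
  assumes "A \<in> carrier_mat N N" "det A \<noteq> 0"
  shows "T A \<in> GL s E"
proof -
  obtain B where B: "B \<in> carrier_mat N N" "A * B = 1\<^sub>m N" "B * A = 1\<^sub>m N"
    using GL_inverse[OF assms] by blast
  have "bij_betw (T A) E E"
    by (rule bij_betw_byWitness[where f'="T B"])
      (use B assms T_one T_in in \<open>auto simp flip: T_mult\<close>)
  then show ?thesis using T_linear by (simp add: GL_def)
qed

text \<open>The inverse of a linear bijection is linear, so it has a matrix too, and the two
  matrices multiply to the identity because the maps do so on the basis.\<close>

lemma GL_mat: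
  assumes "g \<in> GL s E"
  shows "\<And>x. x \<in> E \<Longrightarrow> g x = T (mat_of g) x" "det (mat_of g) \<noteq> 0"
proof -
  have g: "linear_on s s E g" "bij_betw g E E" using assms by (auto simp: GL_def)
  then have gE: "g y \<in> E" if "y \<in> E" for y using that by (auto simp: bij_betw_def)
  show T: "g x = T (mat_of g) x" if "x \<in> E" for x using T_mat_of[OF g(1) gE that] by simp
  let ?h = "inv_into E g"
  have hE: "?h y \<in> E" and gh: "g (?h y) = y" if "y \<in> E" for y
    using that g(2) by (auto simp: bij_betw_def inv_into_into f_inv_into_f)
  have hg: "?h (g x) = x" if "x \<in> E" for x
    using that g(2) by (auto simp: bij_betw_def)
  have "linear_on s s E ?h"
    unfolding linear_on_def
  proof (intro conjI ballI allI)
    fix x y assume xy: "x \<in> E" "y \<in> E"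
    have "g (?h x + ?h y) = x + y" using g(1) xy hE gh by (simp add: linear_on_def)
    then show "?h (x + y) = ?h x + ?h y" using hg hE xy W_add by metis
  next
    fix c x assume x: "x \<in> E"
    have "g (s c (?h x)) = s c x" using g(1) x hE gh by (simp add: linear_on_def)
    then show "?h (s c x) = s c (?h x)" using hg hE x W_scale by metis
  qed
  then have Th: "T (mat_of ?h) x = ?h x" if "x \<in> E" for x using T_mat_of hE that by blast
  have "mat_of g * mat_of ?h = mat_of (T (mat_of g * mat_of ?h))"
    by (intro mat_of_T[symmetric] mult_carrier_mat[OF mat_of_carrier mat_of_carrier])
  also have "\<dots> = mat_of (T (1\<^sub>m N))"
  proof -
    have "T (mat_of g * mat_of ?h) (b j) = T (1\<^sub>m N) (b j)" if "j < N" for j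
      unfolding T_mult[OF mat_of_carrier mat_of_carrier] T_one[OF b_in[OF that]] Th[OF b_in[OF that]]
        T[OF hE[OF b_in[OF that]], symmetric]
      by (rule gh[OF b_in[OF that]])
    then show ?thesis unfolding mat_of_def by (intro cong_mat) auto
  qed
  also have "\<dots> = 1\<^sub>m N" by (simp add: mat_of_T)
  finally have "det (mat_of g) * det (mat_of ?h) = 1"
    using det_mult[OF mat_of_carrier[of g] mat_of_carrier[of ?h]] by simp
  then show "det (mat_of g) \<noteq> 0" by auto
qed

lemma T_borel:
  assumes "A \<in> carrier_mat N N" "\<And>k j. j < k \<Longrightarrow> k < N \<Longrightarrow> A $$ (k, j) = 0"
    "\<And>j. j < N \<Longrightarrow> A $$ (j, j) \<noteq> 0"
  shows "T A \<in> borel s E N e"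
    and "i \<le> N \<Longrightarrow> weight_char s N e (\<lambda>j. d * fundamental_weight i j) (T A) = (\<Prod>j<i. A $$ (j, j) ^ d)"
proof -
  have "det A = prod_list (diag_mat A)"
    using assms by (intro det_upper_triangular) auto
  also have "\<dots> \<noteq> 0" using assms(1,3) by (auto simp: prod_list_zero_iff diag_mat_def)
  finally show "T A \<in> borel s E N e"
    using assms by (auto simp: borel_def T_GL matrix_entry_eq mat_of_T)
  show "weight_char s N e (\<lambda>j. d * fundamental_weight i j) (T A) = (\<Prod>j<i. A $$ (j, j) ^ d)" if "i \<le> N"
  proof -
    have "weight_char s N e (\<lambda>j. d * fundamental_weight i j) (T A) =
      (\<Prod>j=1..N. if j \<le> i then A $$ (j - 1, j - 1) ^ d else 1)"
      unfolding weight_char_def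
      by (intro prod.cong refl) (auto simp: matrix_entry_eq mat_of_T assms(1) fundamental_weight_def)
    also have "\<dots> = (\<Prod>j\<in>{1..i}. A $$ (j - 1, j - 1) ^ d)"
      by (rule prod.mono_neutral_cong_right) (use that in auto)
    also have "\<dots> = (\<Prod>j<i. A $$ (j, j) ^ d)"
      by (rule prod.reindex_bij_witness[where i="Suc" and j="\<lambda>j. j - 1"]) auto
    finally show ?thesis .
  qed
qed

lemma borel_mat:
  assumes "g \<in> borel s E N e"
  shows "g \<in> GL s E" "\<And>k j. j < k \<Longrightarrow> k < N \<Longrightarrow> mat_of g $$ (k, j) = 0"
    and "i \<le> N \<Longrightarrow> weight_char s N e (\<lambda>j. d * fundamental_weight i j) g = (\<Prod>j<i. mat_of g $$ (j, j) ^ d)"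
proof -
  show g: "g \<in> GL s E" using assms by (simp add: borel_def)
  show "mat_of g $$ (k, j) = 0" if "j < k" "k < N" for k j
    using assms that matrix_entry_eq[of "Suc k" "Suc j" g] by (auto simp: borel_def)
  show "weight_char s N e (\<lambda>j. d * fundamental_weight i j) g = (\<Prod>j<i. mat_of g $$ (j, j) ^ d)" if "i \<le> N"
  proof -
    have "weight_char s N e (\<lambda>j. d * fundamental_weight i j) g =
      (\<Prod>j=1..N. if j \<le> i then mat_of g $$ (j - 1, j - 1) ^ d else 1)"
      unfolding weight_char_def
      by (intro prod.cong refl) (auto simp: matrix_entry_eq fundamental_weight_def)
    also have "\<dots> = (\<Prod>j\<in>{1..i}. mat_of g $$ (j - 1, j - 1) ^ d)"
      by (rule prod.mono_neutral_cong_right) (use that in auto)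
    also have "\<dots> = (\<Prod>j<i. mat_of g $$ (j, j) ^ d)"
      by (rule prod.reindex_bij_witness[where i="Suc" and j="\<lambda>j. j - 1"]) auto
    finally show ?thesis .
  qed
qed

end

section \<open>The action of matrices on forms\<close>

text \<open>As rewrite rules these would eta-expand sums and multiples of functions everywhere.\<close>

lemmas fun_apply = plus_fun_apply zero_fun_apply fscale_apply minus_fun_apply
declare fun_apply [simp del]

text \<open>Makes every multiple of an \<open>m\<close>-th power of a linear form again such a
  power, so that elements of \<open>Q\<close> are sums of powers without coefficients.\<close>

lemma complex_root_exists: "n > 0 \<Longrightarrow> \<exists>r :: complex. r ^ n = c"
proof (cases "c = 0")
  case False
  assume "n > 0"
  then have "card {z. z ^ n = c} = n" using False by (rule card_nth_roots[rotated])
  then have "{z. z ^ n = c} \<noteq> {}" using \<open>n > 0\<close> by force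
  then show ?thesis by blast
qed (auto intro: exI[of _ 0])

locale form_space = based_space +
  fixes m :: nat
  assumes m_pos: "m > 0"
begin

definition Q :: "('a \<Rightarrow> complex) set" where "Q = hom_poly s E m"

lemma subspace_Q: "fs.subspace Q"
  by (simp only: Q_def subspace_hom_poly)

sublocale Q: cspace fscale Q
  by (intro cspace.intro cspace_axioms.intro fs.vector_space_axioms subspace_Q)

definition pw :: "('a \<Rightarrow> complex) \<Rightarrow> 'a \<Rightarrow> complex" where
  "pw l = (\<lambda>x. if x \<in> E then l x ^ m else 0)"

lemma Q_outside: "q \<in> Q \<Longrightarrow> x \<notin> E \<Longrightarrow> q x = 0"
  unfolding Q_def by (rule hom_poly_outside)

lemma Q_span: "Q = fs.span {pw l | l. linear_on s (*) E l}"
  unfolding Q_def hom_poly_eq_span power_forms_def pw_def ..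

lemma pw_in: "linear_on s (*) E l \<Longrightarrow> pw l \<in> Q"
  unfolding Q_span by (intro fs.span_base) blast

lemma pw_cmult: "fscale (c ^ m) (pw l) = pw (\<lambda>x. c * l x)"
  by (auto simp: fun_eq_iff pw_def power_mult_distrib fun_apply)

lemma pw_zero: "pw (\<lambda>x. 0) = 0"
  using m_pos by (auto simp: fun_eq_iff pw_def fun_apply)

lemma Q_sum_pw:
  assumes "q \<in> Q"
  shows "\<exists>n l. (\<forall>j<n. linear_on s (*) E (l j)) \<and> q = (\<Sum>j<(n::nat). pw (l j))"
  using assms unfolding Q_span
proof (induction rule: fs.span_induct_alt)
  case base
  show ?case by (rule exI[of _ 0]) simp
next
  case (step c f q)
  then obtain n l where l: "\<forall>j<n. linear_on s (*) E (l j)" "q = (\<Sum>j<(n::nat). pw (l j))" by blast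
  obtain u where u: "f = pw u" "linear_on s (*) E u" using step by blast
  obtain r where "r ^ m = c" using complex_root_exists[OF m_pos] by blast
  then have "fscale c f = pw (\<lambda>x. r * u x)" using u pw_cmult by metis
  then have "fscale c f + q = (\<Sum>j<Suc n. pw ((l(n := \<lambda>x. r * u x)) j))"
    by (simp add: l(2) add.commute)
  moreover have "\<forall>j<Suc n. linear_on s (*) E ((l(n := \<lambda>x. r * u x)) j)"
    using l(1) u(2) by (auto simp: less_Suc_eq intro: linear_on_cmult)
  ultimately show ?case by blast
qed

text \<open>Substitution of any matrix, singular ones included. It reverses products
  (\<open>act_mult\<close>), and for invertible \<open>A\<close> it is the action of the inverse of
  \<open>T A\<close>.\<close>

definition act :: "complex mat \<Rightarrow> ('a \<Rightarrow> complex) \<Rightarrow> 'a \<Rightarrow> complex" where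
  "act A q = (\<lambda>x. if x \<in> E then q (T A x) else 0)"

lemma act_apply: "x \<in> E \<Longrightarrow> act A q x = q (T A x)"
  by (simp add: act_def)

lemma linear_T: "linear_on s (*) E l \<Longrightarrow> linear_on s (*) E (\<lambda>x. l (T A x))"
  using T_linear T_in by (simp add: linear_on_def)

lemma act_pw: "act A (pw l) = pw (\<lambda>x. l (T A x))"
  by (auto simp: act_def pw_def T_in)

lemma act_add: "act A (q + r) = act A q + act A r"
  and act_scale: "act A (fscale c q) = fscale c (act A q)"
  and act_0: "act A 0 = 0"
  by (auto simp: act_def fun_eq_iff fun_apply)

lemma act_sum: "act A (\<Sum>i\<in>I. f i) = (\<Sum>i\<in>I. act A (f i))"
  by (induction I rule: infinite_finite_induct) (auto simp: act_add act_0)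

lemma act_linear: "linear_on fscale fscale W (act A)"
  by (simp add: linear_on_def act_add act_scale)

lemma act_in:
  assumes "q \<in> Q"
  shows "act A q \<in> Q"
  using assms unfolding Q_span
proof (induction rule: fs.span_induct_alt)
  case base
  show ?case by (simp only: act_0 fs.span_zero)
next
  case (step c f q)
  then obtain u where u: "f = pw u" "linear_on s (*) E u" by blast
  then have "act A f \<in> Q" by (simp add: act_pw pw_in linear_T)
  moreover have "act A q \<in> Q" using step unfolding Q_span by blast
  ultimately show ?case unfolding Q_span[symmetric] act_add act_scale by (intro Q.W_add Q.W_scale)
qed

lemma act_mult:
  assumes "A \<in> carrier_mat N N" "B \<in> carrier_mat N N"
  shows "act (A * B) q = act B (act A q)"
  using assms by (auto simp: act_def T_mult T_in)

lemma act_one: "q \<in> Q \<Longrightarrow> act (1\<^sub>m N) q = q"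
  using Q_outside by (auto simp: act_def T_one fun_eq_iff)

lemma T_mat_sum: "T (mat N N g) x = (\<Sum>y\<in>{..<N} \<times> {..<N}. s (g y * coord (snd y) x) (b (fst y)))"
  unfolding T_def
  by (simp add: sum.cartesian_product scale_sum_left case_prod_beta)

text \<open>Expanding the \<open>m\<close>-th power of a linear form, \<open>A \<mapsto> act A q\<close> is a form of degree \<open>m\<close> in the
  entries of \<open>A\<close> with coefficients in \<open>Q\<close>.\<close>

lemma act_expand:
  assumes "q \<in> Q"
  shows "\<exists>c. (\<forall>\<xi>. c \<xi> \<in> Q) \<and> (\<forall>g. act (mat N N g) q =
    (\<Sum>\<xi>\<in>{..<m} \<rightarrow>\<^sub>E ({..<N} \<times> {..<N}). fscale (\<Prod>r<m. g (\<xi> r)) (c \<xi>)))"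
  using assms unfolding Q_span
proof (induction rule: fs.span_induct_alt)
  case base
  have "\<forall>g. act (mat N N g) 0 =
    (\<Sum>\<xi>\<in>{..<m} \<rightarrow>\<^sub>E ({..<N} \<times> {..<N}). fscale (\<Prod>r<m. g (\<xi> r)) 0)"
    by (auto simp: act_0)
  then show ?case by (intro exI[of _ "\<lambda>_. 0"] conjI allI fs.span_zero) blast
next
  case (step a f q)
  then obtain c where c: "\<And>\<xi>. c \<xi> \<in> Q" "\<And>g. act (mat N N g) q =
    (\<Sum>\<xi>\<in>{..<m} \<rightarrow>\<^sub>E ({..<N} \<times> {..<N}). fscale (\<Prod>r<m. g (\<xi> r)) (c \<xi>))"
    unfolding Q_span[symmetric] by blast
  obtain u where u: "f = pw u" "linear_on s (*) E u" using step by blast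
  \<comment> \<open>The coefficient of a word \<open>\<xi>\<close> of matrix positions: row indices
    go to the linear form, column indices to the coordinates.\<close>
  define d where "d = (\<lambda>(\<xi> :: nat \<Rightarrow> nat \<times> nat) x. if x \<in> E then \<Prod>r<m. u (b (fst (\<xi> r))) * coord (snd (\<xi> r)) x else 0)"
  have d: "d \<xi> \<in> Q" for \<xi>
  proof -
    have "d \<xi> \<in> prod_forms m"
      unfolding d_def prod_forms_def
      by (intro CollectI exI[of _ "\<lambda>r x. u (b (fst (\<xi> r))) * coord (snd (\<xi> r)) x"])
        (auto intro: linear_on_cmult linear_coord)
    then show ?thesis
      unfolding Q_def hom_poly_eq_span using span_prod_forms_sub_power_forms fs.span_base by blast
  qed
  have "act (mat N N g) f = (\<Sum>\<xi>\<in>{..<m} \<rightarrow>\<^sub>E ({..<N} \<times> {..<N}). fscale (\<Prod>r<m. g (\<xi> r)) (d \<xi>))" for g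
  proof
    fix x
    show "act (mat N N g) f x = (\<Sum>\<xi>\<in>{..<m} \<rightarrow>\<^sub>E ({..<N} \<times> {..<N}). fscale (\<Prod>r<m. g (\<xi> r)) (d \<xi>)) x"
    proof (cases "x \<in> E")
      case True
      have "u (T (mat N N g) x) = (\<Sum>y\<in>{..<N} \<times> {..<N}. u (s (g y * coord (snd y) x) (b (fst y))))"
        unfolding T_mat_sum by (intro linear_on_sum[OF u(2)] W_scale b_in) auto
      also have "\<dots> = (\<Sum>y\<in>{..<N} \<times> {..<N}. g y * (u (b (fst y)) * coord (snd y) x))"
        by (intro sum.cong refl) (auto simp: linear_onD(2)[OF u(2)] b_in)
      finally have "act (mat N N g) f x = (\<Prod>r<m. \<Sum>y\<in>{..<N} \<times> {..<N}. g y * (u (b (fst y)) * coord (snd y) x))"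
        unfolding u(1) act_pw using True by (simp add: pw_def)
      also have "\<dots> = (\<Sum>\<xi>\<in>{..<m} \<rightarrow>\<^sub>E ({..<N} \<times> {..<N}). \<Prod>r<m. g (\<xi> r) * (u (b (fst (\<xi> r))) * coord (snd (\<xi> r)) x))"
        by (rule prod_sum_PiE) auto
      finally show ?thesis
        using True by (simp add: sum_fun_apply d_def prod.distrib fun_apply)
    qed (simp add: act_def d_def sum_fun_apply fun_apply)
  qed
  then have "act (mat N N g) (fscale a f + q) =
    (\<Sum>\<xi>\<in>{..<m} \<rightarrow>\<^sub>E ({..<N} \<times> {..<N}). fscale (\<Prod>r<m. g (\<xi> r)) (fscale a (d \<xi>) + c \<xi>))" for g
    by (simp add: act_add act_scale c(2) fs.scale_sum_right fs.scale_right_distrib sum.distrib mult.commute)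
  moreover have "fscale a (d \<xi>) + c \<xi> \<in> Q" for \<xi> using c(1) d by (intro Q.W_add Q.W_scale)
  ultimately show ?case unfolding Q_span[symmetric] by (intro exI[of _ "\<lambda>\<xi>. fscale a (d \<xi>) + c \<xi>"]) blast
qed

text \<open>For linear \<open>F\<close> this is \<open>F\<close> applied to the coefficients in
  \<open>act_expand\<close>; constants, sums and products are immediate.\<close>

lemma polynomial_act:
  assumes "polynomial_on fscale Q F" "q \<in> Q"
  shows "polynomial_on fscale UNIV (\<lambda>g. F (act (mat N N g) q))"
proof -
  obtain c where c: "\<And>\<xi>. c \<xi> \<in> Q" "\<And>g. act (mat N N g) q =
    (\<Sum>\<xi>\<in>{..<m} \<rightarrow>\<^sub>E ({..<N} \<times> {..<N}). fscale (\<Prod>r<m. g (\<xi> r)) (c \<xi>))"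
    using act_expand[OF assms(2)] by blast
  show ?thesis
    using assms(1)
  proof induction
    case (linear l)
    have "l (act (mat N N g) q) = (\<Sum>\<xi>\<in>{..<m} \<rightarrow>\<^sub>E ({..<N} \<times> {..<N}). (\<Prod>r<m. g (\<xi> r)) * l (c \<xi>))" for g
    proof -
      have "l (act (mat N N g) q) = (\<Sum>\<xi>\<in>{..<m} \<rightarrow>\<^sub>E ({..<N} \<times> {..<N}). l (fscale (\<Prod>r<m. g (\<xi> r)) (c \<xi>)))"
        unfolding c(2) by (intro Q.linear_on_sum[OF linear] Q.W_scale c(1))
      then show ?thesis by (simp add: Q.linear_onD(2)[OF linear] c(1))
    qed
    moreover have "polynomial_on fscale UNIV (\<lambda>g :: nat \<times> nat \<Rightarrow> complex. g y)" for y
      by (rule polynomial_on.linear) (simp add: linear_on_def fun_apply)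
    ultimately show ?case
      by (simp only:) (intro polynomial_on_sum polynomial_on.mult polynomial_on_prod polynomial_on.const)
  qed (auto intro: polynomial_on.intros)
qed

lemma act_mat_scale: "act (mat N N (fscale c g)) q = act (mat N N g) (act (c \<cdot>\<^sub>m 1\<^sub>m N) q)"
proof -
  have "mat N N (fscale c g) = (c \<cdot>\<^sub>m 1\<^sub>m N) * mat N N g"
    by (rule eq_matI) (auto simp: fun_apply)
  then show ?thesis by (simp add: act_mult)
qed

lemma act_scalar:
  assumes "q \<in> Q"
  shows "act (c \<cdot>\<^sub>m 1\<^sub>m N) q = fscale (c ^ m) q"
proof
  fix x
  show "act (c \<cdot>\<^sub>m 1\<^sub>m N) q x = fscale (c ^ m) q x"
  proof (cases "x \<in> E")
    case True
    have "T (c \<cdot>\<^sub>m 1\<^sub>m N) x = s c x"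
    proof (rule E_eqI)
      fix k assume k: "k < N"
      have "coord k (T (c \<cdot>\<^sub>m 1\<^sub>m N) x) = (\<Sum>j<N. if k = j then c * coord j x else 0)"
        unfolding coord_T[OF k] using k by (intro sum.cong) auto
      then show "coord k (T (c \<cdot>\<^sub>m 1\<^sub>m N) x) = coord k (s c x)" using k True by (simp add: coord_scale)
    qed (use True T_in W_scale in auto)
    then show ?thesis
      using True hom_poly_homogeneous[OF assms[unfolded Q_def] True] by (simp add: act_apply fun_apply)
  qed (use assms Q_outside in \<open>auto simp: act_def fun_apply\<close>)
qed

text \<open>Scaling the matrix by \<open>c\<close> scales the form by \<open>c ^ m\<close>, and
  hence the value of \<open>F\<close> by \<open>c ^ (m * K)\<close>. Comparison with the degree
  \<open>i * d\<close> of a power of the determinant fixes \<open>K\<close> later.\<close>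

lemma hom_act:
  assumes "F \<in> hom_poly fscale Q K" "q \<in> Q"
  shows "(\<lambda>g. F (act (mat N N g) q)) \<in> hom_poly fscale UNIV (m * K)"
proof (rule UN.hom_polyI)
  show "polynomial_on fscale UNIV (\<lambda>g. F (act (mat N N g) q))"
    using polynomial_act[OF Q.hom_poly_polynomial[OF assms(1)] assms(2)] .
  show "F (act (mat N N (fscale c g)) q) = c ^ (m * K) * F (act (mat N N g) q)" for c g
    unfolding act_mat_scale act_scalar[OF assms(2)] act_scale
    by (simp add: Q.hom_poly_homogeneous[OF assms(1)] act_in assms(2) power_mult)
qed simp

lemma act_line:
  assumes "polynomial_on fscale Q F" "q \<in> Q" "A \<in> carrier_mat N N" "B \<in> carrier_mat N N"
  shows "\<exists>p. \<forall>t. F (act (A + t \<cdot>\<^sub>m B) q) = poly p t"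
proof -
  have "mat N N ((\<lambda>y. A $$ y) + fscale t (\<lambda>y. B $$ y)) = A + t \<cdot>\<^sub>m B" for t
    by (rule eq_matI) (use assms in \<open>auto simp: fun_apply\<close>)
  then show ?thesis
    using UN.polynomial_on_line[OF polynomial_act[OF assms(1,2)], of "\<lambda>y. A $$ y" "\<lambda>y. B $$ y"] by simp
qed

text \<open>Invertible matrices are Zariski dense, so equations obtained from the group also hold
  for singular substitutions.\<close>

lemma act_density:
  assumes "polynomial_on fscale Q F" "q \<in> Q" "A \<in> carrier_mat N N"
    and "\<And>A. A \<in> carrier_mat N N \<Longrightarrow> det A \<noteq> 0 \<Longrightarrow> F (act A q) = 0"
  shows "F (act A q) = 0"
proof -
  have "F (act (mat N N (\<lambda>y. A $$ y)) q) = 0"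
    by (rule polynomial_density[OF polynomial_act[OF assms(1,2)], where n=N]) (rule assms(4), auto)
  moreover have "mat N N (\<lambda>y. A $$ y) = A" by (rule eq_matI) (use assms(3) in auto)
  ultimately show ?thesis by simp
qed

lemma polynomial_on_act:
  assumes "polynomial_on fscale Q F"
  shows "polynomial_on fscale Q (\<lambda>q. F (act A q))"
  by (rule polynomial_on_comp[OF assms act_linear]) (auto simp: act_in)

text \<open>The \<open>m\<close>-th powers of linear forms are a cone spanning \<open>Q\<close>:
  they are closed under scalars because complex numbers have \<open>m\<close>-th roots.\<close>

lemma hom_poly_zero_on_few_powers:
  assumes "F \<in> hom_poly fscale Q K"
    and "\<And>l. (\<And>a. linear_on s (*) E (l a)) \<Longrightarrow> F (\<Sum>a<K. pw (l a)) = 0"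
  shows "F = 0"
proof (rule Q.hom_poly_zero_if_zero_on_sums[OF assms(1), of "{pw l | l. linear_on s (*) E l}"])
  show "0 \<in> {pw l | l. linear_on s (*) E l}"
    using pw_zero linear_on_zero[of s E] by (metis (mono_tags, lifting) mem_Collect_eq)
  show "fscale c x \<in> {pw l | l. linear_on s (*) E l}" if x: "x \<in> {pw l | l. linear_on s (*) E l}" for c x
  proof -
    obtain l where l: "x = pw l" "linear_on s (*) E l" using x by blast
    obtain r where "r ^ m = c" using complex_root_exists[OF m_pos] by blast
    then have "fscale c x = pw (\<lambda>x. r * l x)" using l pw_cmult by metis
    then show ?thesis using linear_on_cmult[OF l(2)] by blast
  qed
  show "F (\<Sum>a<K. y a) = 0" if "\<And>a. y a \<in> {pw l | l. linear_on s (*) E l}" for y :: "nat \<Rightarrow> _"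
  proof -
    have "\<forall>a. \<exists>l. y a = pw l \<and> linear_on s (*) E l" using that by blast
    then obtain l where "\<And>a. y a = pw (l a)" "\<And>a. linear_on s (*) E (l a)" by metis
    then show ?thesis using assms(2) by simp
  qed
qed (auto simp: pw_in simp flip: Q_span)

text \<open>Singular matrices are included since projections to the first coordinates must map
  \<open>Y\<close> into itself.\<close>

definition stable :: "('a \<Rightarrow> complex) set \<Rightarrow> bool" where
  "stable Y \<longleftrightarrow> Y \<subseteq> Q \<and> (\<forall>A\<in>carrier_mat N N. \<forall>q\<in>Y. act A q \<in> Y)"

lemma stable_Q: "stable Q"
  by (simp add: stable_def act_in)

lemma translate_eq:
  assumes "g \<in> GL s E" "B \<in> carrier_mat N N" "B * mat_of g = 1\<^sub>m N"
  shows "translate E g q = act B q"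
proof
  fix y
  show "translate E g q y = act B q y"
  proof (cases "y \<in> E")
    case True
    have g: "bij_betw g E E" using assms(1) by (auto simp: GL_def)
    let ?x = "inv_into E g y"
    have x: "?x \<in> E" "g ?x = y" using True g by (auto simp: bij_betw_def inv_into_into f_inv_into_f)
    have "T B y = T B (T (mat_of g) ?x)" using GL_mat(1)[OF assms(1) x(1)] x(2) by simp
    also have "\<dots> = ?x" using assms x(1) by (simp add: T_one mat_of_carrier flip: T_mult)
    finally show ?thesis using True by (simp add: translate_def act_def)
  qed (simp add: translate_def act_def)
qed

text \<open>One inversion comes from the action on forms and one from the action on functions of
  forms; they cancel, so \<open>g\<close> acts through substitution of its own matrix.\<close>

lemma translate_translate:
  assumes "stable Y" "g \<in> GL s E"
  shows "translate Y (translate E g) F = (\<lambda>q. if q \<in> Y then F (act (mat_of g) q) else 0)"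
proof -
  obtain B where B: "B \<in> carrier_mat N N" "mat_of g * B = 1\<^sub>m N" "B * mat_of g = 1\<^sub>m N"
    using GL_inverse[OF mat_of_carrier GL_mat(2)[OF assms(2)]] by blast
  have tr: "translate E g = act B" using translate_eq[OF assms(2) B(1,3)] by blast
  have "inv_into Y (act B) q = act (mat_of g) q" if q: "q \<in> Y" for q
  proof -
    have Aq: "act (mat_of g) q \<in> Y" using assms(1) q mat_of_carrier by (auto simp: stable_def)
    have qQ: "r \<in> Q" if "r \<in> Y" for r using assms(1) that by (auto simp: stable_def)
    have "inj_on (act B) Y"
    proof (rule inj_on_inverseI[where g="act (mat_of g)"])
      fix r assume "r \<in> Y"
      then show "act (mat_of g) (act B r) = r"
        using qQ B by (simp add: act_one mat_of_carrier flip: act_mult)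
    qed
    moreover have "act B (act (mat_of g) q) = q"
      using qQ[OF q] B by (simp add: act_one mat_of_carrier flip: act_mult)
    ultimately show ?thesis using Aq by (metis inv_into_f_f)
  qed
  then show ?thesis unfolding translate_def[of Y] tr by (intro ext if_cong) auto
qed

end

section \<open>The pairing with a power of the determinant\<close>

text \<open>\<open>f\<close> is a combination of \<open>D\<close>-th powers of linear functionals,
  and after restriction to the variables in \<open>I\<close> each functional is given by its values
  at the unit functions.\<close>

lemma hom_poly_pairing:
  assumes f: "f \<in> hom_poly fscale UNIV D" and I: "finite I"
    and dep: "\<And>g. f (\<lambda>y. if y \<in> I then g y else 0) = f g"
  shows "\<exists>K C A. \<forall>g. f g = (\<Sum>k<(K::nat). C k * (\<Sum>y\<in>I. g y * A k y) ^ D)"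
proof -
  let ?r = "\<lambda>g y. if y \<in> I then g y else (0::complex)"
  have "\<exists>K C A. \<forall>g. f (?r g) = (\<Sum>k<(K::nat). C k * (\<Sum>y\<in>I. g y * A k y) ^ D)"
    using f[THEN subsetD[OF UN.hom_poly_sub_span]]
  proof (induction rule: fs.span_induct_alt)
    case base
    show ?case by (rule exI[of _ 0]) (simp add: fun_apply)
  next
    case (step c h f)
    then obtain K C A where KCA: "\<And>g. f (?r g) = (\<Sum>k<(K::nat). C k * (\<Sum>y\<in>I. g y * A k y) ^ D)"
      by blast
    obtain l where l: "h = (\<lambda>x. l x ^ D)" "linear_on fscale (*) UNIV l"
      using step(1) unfolding UN.power_forms_def by auto
    let ?\<delta> = "\<lambda>y z. if z = y then 1 else 0 :: complex"
    have "l (?r g) = (\<Sum>y\<in>I. g y * l (?\<delta> y))" for g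
    proof -
      have "?r g = (\<Sum>y\<in>I. fscale (g y) (?\<delta> y))"
        using I by (auto simp: fun_eq_iff sum_fun_apply fun_apply if_distrib cong: if_cong)
      then have "l (?r g) = (\<Sum>y\<in>I. l (fscale (g y) (?\<delta> y)))"
        using UN.linear_on_sum[OF l(2), of I "\<lambda>y. fscale (g y) (?\<delta> y)"] by simp
      then show ?thesis by (simp add: UN.linear_onD(2)[OF l(2)])
    qed
    then have "(fscale c h + f) (?r g) =
      (\<Sum>k<Suc K. (C(K := c)) k * (\<Sum>y\<in>I. g y * (A(K := \<lambda>y. l (?\<delta> y))) k y) ^ D)" for g
      by (simp add: fun_apply l(1) KCA add.commute)
    then show ?case by blast
  qed
  then show ?thesis using dep by simp
qed

definition mmul :: "nat \<Rightarrow> (nat \<times> nat \<Rightarrow> complex) \<Rightarrow> (nat \<times> nat \<Rightarrow> complex) \<Rightarrow> nat \<times> nat \<Rightarrow> complex" where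
  "mmul n h g = (\<lambda>(k, j). \<Sum>l<n. h (k, l) * g (l, j))"

lemma mat_mmul: "mat n n (mmul n h g) = mat n n h * mat n n g"
  by (rule eq_matI) (auto simp: mmul_def scalar_prod_def lessThan_atLeast0)

lemma det_power_hom: "(\<lambda>g. det (mat n n g) ^ d) \<in> hom_poly fscale UNIV (n * d)"
proof (rule UN.hom_polyI)
  show "polynomial_on fscale UNIV (\<lambda>g. det (mat n n g) ^ d)"
    by (intro polynomial_on_power det_mat_poly)
  show "det (mat n n (fscale c g)) ^ d = c ^ (n * d) * det (mat n n g) ^ d" for c g
  proof -
    have "mat n n (fscale c g) = c \<cdot>\<^sub>m mat n n g" by (rule eq_matI) (auto simp: fun_apply)
    then show ?thesis by (simp add: power_mult_distrib power_mult)
  qed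
qed simp

lemma det_mat_cnj: "det (mat n n (\<lambda>y. cnj (g y))) = cnj (det (mat n n g))"
proof -
  have "det (mat n n g) = (\<Sum>p | p permutes {0..<n}. signof p * (\<Prod>i=0..<n. g (i, p i)))"
    for g :: "nat \<times> nat \<Rightarrow> complex"
    by (subst det_def'[of _ n]) (auto intro!: sum.cong prod.cong simp: permutes_in_image)
  moreover have "cnj (signof p) = signof p" for p :: "nat \<Rightarrow> nat" by (simp add: sign_def)
  ultimately show ?thesis by simp
qed

text \<open>
  The functional is the pairing with \<open>det ^ d\<close> for the Hermitian inner product on forms of degree \<open>n * d\<close>
  in which the pairing of \<open>f\<close> with \<open>g \<mapsto> (\<Sum>y. g y * a y) ^ (n * d)\<close> is the value of \<open>f\<close> at the conjugate
  of \<open>a\<close>; it is nonzero on \<open>det ^ d\<close> by positivity.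
\<close>

lemma apolar_functional:
  fixes n d :: nat
  defines "D \<equiv> n * d" and "I \<equiv> {..<n} \<times> {..<n}"
  shows "\<exists>(K::nat) C A.
    (\<forall>f h. f \<in> hom_poly fscale UNIV D \<longrightarrow> (\<forall>g. f (\<lambda>y. if y \<in> I then g y else 0) = f g) \<longrightarrow>
      (\<Sum>k<K. C k * f (mmul n h (A k))) = det (mat n n h) ^ d * (\<Sum>k<K. C k * f (A k))) \<and>
    (\<Sum>k<K. C k * det (mat n n (A k)) ^ d) \<noteq> 0"
proof -
  let ?P = "\<lambda>g. det (mat n n g) ^ d :: complex"
  have fin: "finite I" by (simp add: I_def)
  have dep: "mat n n (\<lambda>y. if y \<in> I then g y else 0) = mat n n g" for g :: "nat \<times> nat \<Rightarrow> complex"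
    by (rule eq_matI) (auto simp: I_def)
  have "\<exists>K C A. \<forall>g. ?P g = (\<Sum>k<(K::nat). C k * (\<Sum>y\<in>I. g y * A k y) ^ (n * d))"
    by (rule hom_poly_pairing[OF det_power_hom fin]) (simp only: dep)
  then obtain K C A where P: "\<And>g. ?P g = (\<Sum>k<(K::nat). C k * (\<Sum>y\<in>I. g y * A k y) ^ D)"
    unfolding D_def by blast
  define C' where "C' = (\<lambda>k. cnj (C k))"
  define A' where "A' = (\<lambda>k y. cnj (A k y))"
  \<comment> \<open>On the power of a linear form the functional returns \<open>?P\<close> at the
    coefficient vector; the conjugations cancel because the determinant has real
    coefficients.\<close>
  have LP: "(\<Sum>k<K. C' k * (\<Sum>y\<in>I. A' k y * B y) ^ D) = ?P B" for B
  proof -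
    have "(\<Sum>k<K. C' k * (\<Sum>y\<in>I. A' k y * B y) ^ D) = cnj (?P (\<lambda>y. cnj (B y)))"
      unfolding P by (simp add: C'_def A'_def mult.commute)
    also have "\<dots> = ?P B" by (simp add: det_mat_cnj)
    finally show ?thesis .
  qed
  have "(\<Sum>k<K. C' k * f (mmul n h (A' k))) = det (mat n n h) ^ d * (\<Sum>k<K. C' k * f (A' k))"
    if hf: "f \<in> hom_poly fscale UNIV D" and df: "\<And>g. f (\<lambda>y. if y \<in> I then g y else 0) = f g" for f h
  proof -
    obtain R c B where f: "\<And>g. f g = (\<Sum>k<(R::nat). c k * (\<Sum>y\<in>I. g y * B k y) ^ D)"
      using hom_poly_pairing[OF hf fin df] by blast
    \<comment> \<open>Multiplication by \<open>h\<close> is moved to the other argument of the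
      pairing, where it becomes multiplication by the transpose, which has the same
      determinant.\<close>
    let ?h = "\<lambda>(k, l). h (l, k)"
    have sumI: "(\<Sum>y\<in>I. f y) = (\<Sum>k<n. \<Sum>j<n. f (k, j))" for f :: "nat \<times> nat \<Rightarrow> complex"
      by (simp add: I_def sum.cartesian_product)
    have pair: "(\<Sum>y\<in>I. mmul n h g y * b y) = (\<Sum>y\<in>I. g y * mmul n ?h b y)" for g b
    proof -
      have "(\<Sum>y\<in>I. mmul n h g y * b y) = (\<Sum>k<n. \<Sum>j<n. \<Sum>l<n. h (k, l) * g (l, j) * b (k, j))"
        by (simp add: sumI mmul_def sum_distrib_right)
      also have "\<dots> = (\<Sum>k<n. \<Sum>l<n. \<Sum>j<n. h (k, l) * g (l, j) * b (k, j))"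
        by (intro sum.cong refl sum.swap)
      also have "\<dots> = (\<Sum>l<n. \<Sum>k<n. \<Sum>j<n. h (k, l) * g (l, j) * b (k, j))"
        by (rule sum.swap)
      also have "\<dots> = (\<Sum>l<n. \<Sum>j<n. \<Sum>k<n. h (k, l) * g (l, j) * b (k, j))"
        by (intro sum.cong refl sum.swap)
      also have "\<dots> = (\<Sum>y\<in>I. g y * mmul n ?h b y)"
        by (simp add: sumI mmul_def sum_distrib_left mult_ac)
      finally show ?thesis .
    qed
    have L: "(\<Sum>k<K. C' k * (\<Sum>r<R. c r * (\<Sum>y\<in>I. A' k y * b r y) ^ D)) = (\<Sum>r<R. c r * ?P (b r))" for b
      unfolding LP[symmetric] sum_distrib_left
      by (subst sum.swap) (simp add: mult_ac)
    have T: "?P (mmul n ?h b) = det (mat n n h) ^ d * ?P b" for b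
    proof -
      have "mat n n ?h = transpose_mat (mat n n h)" by (rule eq_matI) auto
      then show ?thesis by (simp add: mat_mmul det_mult[of _ n] det_transpose[of _ n] power_mult_distrib)
    qed
    show ?thesis
      unfolding f pair L T by (simp add: sum_distrib_left mult_ac)
  qed
  moreover have "(\<Sum>k<K. C' k * ?P (A' k)) \<noteq> 0"
  proof
    assume zero: "(\<Sum>k<K. C' k * ?P (A' k)) = 0"
    let ?X = "{..<D} \<rightarrow>\<^sub>E I"
    \<comment> \<open>The coefficient tensor of \<open>?P\<close>, with equal monomials left
      uncollected; the functional sends \<open>?P\<close> to the squared norm of this
      tensor.\<close>
    define t where "t = (\<lambda>\<xi>. \<Sum>k<K. C k * (\<Prod>r<D. A k (\<xi> r)))"
    have finX: "finite ?X" using fin by (simp add: finite_PiE)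
    have power: "(\<Sum>y\<in>I. g y * a y) ^ D = (\<Sum>\<xi>\<in>?X. (\<Prod>r<D. g (\<xi> r)) * (\<Prod>r<D. a (\<xi> r)))"
      for g a :: "nat \<times> nat \<Rightarrow> complex"
      using prod_sum_PiE[of "{..<D}" "\<lambda>_. I" "\<lambda>_ y. g y * a y"] fin by (simp add: prod.distrib)
    have Pt: "?P g = (\<Sum>\<xi>\<in>?X. (\<Prod>r<D. g (\<xi> r)) * t \<xi>)" for g
      unfolding P power t_def sum_distrib_left by (subst sum.swap) (simp add: mult_ac)
    have cnj_t: "cnj (t \<xi>) = (\<Sum>k<K. C' k * (\<Prod>r<D. A' k (\<xi> r)))" for \<xi>
      by (simp add: t_def C'_def A'_def)
    have "(\<Sum>k<K. C' k * ?P (A' k)) = (\<Sum>\<xi>\<in>?X. cnj (t \<xi>) * t \<xi>)"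
      unfolding Pt sum_distrib_left
      by (subst sum.swap) (simp add: cnj_t sum_distrib_left mult_ac)
    also have "\<dots> = of_real (\<Sum>\<xi>\<in>?X. (cmod (t \<xi>))\<^sup>2)"
      unfolding of_real_sum complex_norm_square by (simp add: mult.commute)
    finally have "(\<Sum>\<xi>\<in>?X. (cmod (t \<xi>))\<^sup>2) = 0" 
      using zero of_real_eq_0_iff by metis
    then have "t \<xi> = 0" if "\<xi> \<in> ?X" for \<xi>
      using that finX by (subst (asm) sum_nonneg_eq_0_iff) auto
    then have "?P g = 0" for g unfolding Pt by simp
    moreover have "mat n n (\<lambda>(i, j). if i = j then 1 else 0) = (1\<^sub>m n :: complex mat)"
      by (rule eq_matI) auto
    then have "?P (\<lambda>(i, j). if i = j then 1 else 0) = 1" by simp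
    ultimately show False using zero_neq_one by metis
  qed
  ultimately show ?thesis by blast
qed

section \<open>Semi-invariants\<close>

definition idf :: "nat \<times> nat \<Rightarrow> complex" where
  "idf = (\<lambda>(k, j). if k = j then 1 else 0)"

lemma mat_idf: "mat n n idf = 1\<^sub>m n"
  by (rule eq_matI) (auto simp: idf_def)

context form_space
begin

text \<open>Outside the leading block the entries are zero, not those of the identity:
  \<open>emb i idf\<close> is the projection to the first \<open>i\<close> coordinates, so
  semi-invariance under these matrices includes independence of the other coordinates.\<close>

definition emb :: "nat \<Rightarrow> (nat \<times> nat \<Rightarrow> complex) \<Rightarrow> complex mat" where
  "emb i g = mat N N (\<lambda>y. if y \<in> {..<i} \<times> {..<i} then g y else 0)"

lemma emb_carrier [simp]: "emb i g \<in> carrier_mat N N"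
  by (simp add: emb_def)

lemma sum_lessThan_le: "i \<le> N \<Longrightarrow> (\<Sum>l<N. if l < i then f l else 0) = (\<Sum>l<i. f l :: complex)"
  by (rule sum.mono_neutral_cong_right) auto

lemma emb_mmul:
  assumes "i \<le> N"
  shows "emb i (mmul i h g) = emb i h * emb i g"
proof (rule eq_matI)
  fix k j assume kj: "k < dim_row (emb i h * emb i g)" "j < dim_col (emb i h * emb i g)"
  then have "(emb i h * emb i g) $$ (k, j) = (\<Sum>l<N. if l < i then (if k < i then h (k, l) else 0) * (if j < i then g (l, j) else 0) else 0)"
    by (auto simp: emb_def scalar_prod_def lessThan_atLeast0 intro!: sum.cong)
  also have "\<dots> = (if k < i \<and> j < i then mmul i h g (k, j) else 0)"
    by (subst sum_lessThan_le[OF assms]) (auto simp: mmul_def)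
  finally show "emb i (mmul i h g) $$ (k, j) = (emb i h * emb i g) $$ (k, j)"
    using kj by (auto simp: emb_def)
qed (auto simp: emb_def)

lemma emb_cong: "(\<And>k j. k < i \<Longrightarrow> j < i \<Longrightarrow> g (k, j) = h (k, j)) \<Longrightarrow> emb i g = emb i h"
  unfolding emb_def by (intro cong_mat) auto

lemma act_emb_emb: "i \<le> N \<Longrightarrow> act (emb i g) (act (emb i h) q) = act (emb i (mmul i h g)) q"
  by (simp add: emb_mmul act_mult)

lemma polynomial_emb:
  assumes "polynomial_on fscale Q F" "q \<in> Q"
  shows "polynomial_on fscale UNIV (\<lambda>g. F (act (emb i g) q))"
proof -
  let ?r = "\<lambda>g y. if y \<in> {..<i} \<times> {..<i} then g y else (0::complex)"
  have "linear_on fscale fscale UNIV ?r"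
    by (auto simp: linear_on_def fun_eq_iff fun_apply)
  from polynomial_on_comp[OF polynomial_act[OF assms] this] show ?thesis by (simp add: emb_def)
qed

lemma hom_emb:
  assumes "F \<in> hom_poly fscale Q K" "q \<in> Q"
  shows "(\<lambda>g. F (act (emb i g) q)) \<in> hom_poly fscale UNIV (m * K)"
proof (rule UN.hom_polyI)
  show "polynomial_on fscale UNIV (\<lambda>g. F (act (emb i g) q))"
    by (rule polynomial_emb[OF Q.hom_poly_polynomial[OF assms(1)] assms(2)])
  fix c g
  have "emb i (fscale c g) = mat N N (fscale c (\<lambda>y. if y \<in> {..<i} \<times> {..<i} then g y else 0))"
    unfolding emb_def by (intro cong_mat) (auto simp: fun_apply)
  then show "F (act (emb i (fscale c g)) q) = c ^ (m * K) * F (act (emb i g) q)"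
    using UN.hom_poly_homogeneous[OF hom_act[OF assms], of "\<lambda>y. if y \<in> {..<i} \<times> {..<i} then g y else 0" c]
    by (simp add: emb_def)
qed simp

definition semi_invariant :: "nat \<Rightarrow> nat \<Rightarrow> (('a \<Rightarrow> complex) \<Rightarrow> complex) \<Rightarrow> bool" where
  "semi_invariant i d G \<longleftrightarrow> (\<forall>h. \<forall>q\<in>Q. G (act (emb i h) q) = det (mat i i h) ^ d * G q)"

text \<open>\<open>G q\<close> is the apolar functional applied to
  \<open>g \<mapsto> F (act (emb i g) q)\<close>, divided by its value at the power of the
  determinant. Where \<open>F\<close> already transforms correctly this function is
  \<open>F q\<close> times that power, so \<open>F q\<close> comes back. The condition on
  \<open>K\<close> makes the degrees match.\<close>

lemma reynolds:
  assumes F: "F \<in> hom_poly fscale Q K" and K: "m * K = i * d" and i: "i \<le> N"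
  shows "\<exists>G\<in>hom_poly fscale Q K. semi_invariant i d G \<and>
    (\<forall>q\<in>Q. (\<forall>h. F (act (emb i h) q) = det (mat i i h) ^ d * F q) \<longrightarrow> G q = F q)"
proof -
  obtain R C A where
    L: "\<And>f h. f \<in> hom_poly fscale UNIV (i * d) \<Longrightarrow> (\<And>g. f (\<lambda>y. if y \<in> {..<i} \<times> {..<i} then g y else 0) = f g) \<Longrightarrow>
      (\<Sum>k<R. C k * f (mmul i h (A k))) = det (mat i i h) ^ d * (\<Sum>k<(R::nat). C k * f (A k))"
    and nz: "(\<Sum>k<R. C k * det (mat i i (A k)) ^ d) \<noteq> 0"
    using apolar_functional[of i d] by blast
  let ?c = "\<Sum>k<R. C k * det (mat i i (A k)) ^ d"
  define S where "S = (\<lambda>q. \<Sum>k<R. C k * F (act (emb i (A k)) q))"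
  define G where "G = (\<lambda>q. if q \<in> Q then 1 / ?c * S q else 0)"
  have G: "G \<in> hom_poly fscale Q K"
  proof (rule Q.hom_polyI)
    have "polynomial_on fscale Q (\<lambda>q. 1 / ?c * S q)"
      unfolding S_def
      by (intro polynomial_on_cmult polynomial_on_sum polynomial_on_act Q.hom_poly_polynomial[OF F])
    then show "polynomial_on fscale Q G"
      by (rule polynomial_on_cong) (auto simp: G_def Q.W_add Q.W_scale)
    show "G (fscale c q) = c ^ K * G q" if "q \<in> Q" for c q
      using that by (simp add: G_def S_def Q.W_scale act_scale Q.hom_poly_homogeneous[OF F] act_in
          sum_distrib_left sum_distrib_right mult_ac)
  qed (simp add: G_def)
  moreover have "semi_invariant i d G"
    unfolding semi_invariant_def
  proof (intro allI ballI)
    fix h q assume q: "q \<in> Q"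
    have "(\<Sum>k<R. C k * F (act (emb i (mmul i h (A k))) q)) = det (mat i i h) ^ d * (\<Sum>k<R. C k * F (act (emb i (A k)) q))"
    proof (rule L)
      show "(\<lambda>g. F (act (emb i g) q)) \<in> hom_poly fscale UNIV (i * d)"
        using hom_emb[OF F q] K by simp
      show "F (act (emb i (\<lambda>y. if y \<in> {..<i} \<times> {..<i} then g y else 0)) q) = F (act (emb i g) q)" for g
        by (intro arg_cong[where f="\<lambda>M. F (act M q)"] emb_cong) auto
    qed
    then show "G (act (emb i h) q) = det (mat i i h) ^ d * G q"
      using q by (simp add: G_def S_def act_in act_emb_emb[OF i])
  qed
  moreover have "G q = F q" if "q \<in> Q" "\<And>h. F (act (emb i h) q) = det (mat i i h) ^ d * F q" for q
  proof -
    have "S q = ?c * F q" unfolding S_def that(2) by (simp add: sum_distrib_left mult_ac)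
    then show ?thesis using nz that(1) by (simp add: G_def)
  qed
  ultimately show ?thesis by blast
qed

definition q0 :: "nat \<Rightarrow> 'a \<Rightarrow> complex" where
  "q0 i = (\<Sum>j<i. pw (coord j))"

lemma q0_in: "q0 i \<in> Q"
  unfolding q0_def by (intro Q.W_sum pw_in linear_coord)

lemma coord_T_emb:
  assumes "i \<le> N" "k < i"
  shows "coord k (T (emb i h) x) = (\<Sum>j<i. h (k, j) * coord j x)"
proof -
  have "coord k (T (emb i h) x) = (\<Sum>j<N. if j < i then h (k, j) * coord j x else 0)"
    using assms by (subst coord_T) (auto simp: emb_def intro!: sum.cong)
  then show ?thesis using sum_lessThan_le[OF assms(1)] by simp
qed

lemma coord_T_emb_high: "i \<le> k \<Longrightarrow> k < N \<Longrightarrow> coord k (T (emb i h) x) = 0"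
  by (simp add: coord_T emb_def)

lemma linear_T_emb:
  assumes "i \<le> N" "linear_on s (*) E l"
  shows "l (T (emb i h) x) = (\<Sum>j<i. (\<Sum>k<i. l (b k) * h (k, j)) * coord j x)"
proof -
  have "l (T (emb i h) x) = (\<Sum>k<N. coord k (T (emb i h) x) * l (b k))"
    by (rule linear_expand[OF assms(2) T_in])
  also have "\<dots> = (\<Sum>k<N. if k < i then (\<Sum>j<i. h (k, j) * coord j x) * l (b k) else 0)"
    using assms by (intro sum.cong) (auto simp: coord_T_emb coord_T_emb_high)
  also have "\<dots> = (\<Sum>k<i. (\<Sum>j<i. h (k, j) * coord j x) * l (b k))"
    by (rule sum_lessThan_le[OF assms(1)])
  also have "\<dots> = (\<Sum>k<i. \<Sum>j<i. h (k, j) * coord j x * l (b k))"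
    by (simp add: sum_distrib_right)
  also have "\<dots> = (\<Sum>j<i. \<Sum>k<i. h (k, j) * coord j x * l (b k))"
    by (rule sum.swap)
  finally show ?thesis by (simp add: sum_distrib_left mult_ac)
qed

text \<open>After projection each \<open>l j\<close> is given by its values at the first
  \<open>i\<close> basis vectors; these form row \<open>j\<close> of the matrix that is substituted
  into \<open>q0 i\<close>.\<close>

lemma act_proj_powers:
  assumes "i \<le> N" "\<And>j. j < i \<Longrightarrow> linear_on s (*) E (l j)"
  shows "act (emb i idf) (\<Sum>j<i. pw (l j)) = act (emb i (\<lambda>(j, k). l j (b k))) (q0 i)"
proof -
  have "l j (T (emb i idf) x) = coord j (T (emb i (\<lambda>(j, k). l j (b k))) x)" if "j < i" for j x
    unfolding linear_T_emb[OF assms(1) assms(2)[OF that]] coord_T_emb[OF assms(1) that]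
    by (intro sum.cong refl) (auto simp: idf_def if_distrib cong: if_cong)
  then show ?thesis
    by (simp add: q0_def act_sum act_pw)
qed

lemma semi_invariant_proj: "semi_invariant i d G \<Longrightarrow> q \<in> Q \<Longrightarrow> G (act (emb i idf) q) = G q"
  by (simp add: semi_invariant_def mat_idf)

lemma semi_invariant_powers:
  assumes "semi_invariant i d G" "i \<le> N" "\<And>j. j < i \<Longrightarrow> linear_on s (*) E (l j)"
  shows "G (\<Sum>j<i. pw (l j)) = det (mat i i (\<lambda>(j, k). l j (b k))) ^ d * G (q0 i)"
proof -
  have "(\<Sum>j<i. pw (l j)) \<in> Q" using assms(3) by (auto intro: Q.W_sum pw_in)
  from semi_invariant_proj[OF assms(1) this, symmetric] show ?thesis
    using assms(1) q0_in by (simp add: act_proj_powers[OF assms(2,3)] semi_invariant_def)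
qed

text \<open>A sum of fewer than \<open>i\<close> powers is the image of \<open>q0 i\<close> under a matrix with a zero row.\<close>

lemma semi_invariant_zero:
  assumes "semi_invariant i d G" "i \<le> N" "G \<in> hom_poly fscale Q K" "K < i" "d > 0"
  shows "G = 0"
proof (rule hom_poly_zero_on_few_powers[OF assms(3)])
  fix l :: "nat \<Rightarrow> 'a \<Rightarrow> complex" assume l: "\<And>a. linear_on s (*) E (l a)"
  let ?l = "\<lambda>j. if j < K then l j else (\<lambda>x. 0)"
  have "(\<Sum>a<K. pw (l a)) = (\<Sum>j<i. pw (?l j))"
    using assms(4) by (intro sum.mono_neutral_cong_left) (auto simp: pw_zero)
  then have "G (\<Sum>a<K. pw (l a)) = G (\<Sum>j<i. pw (?l j))" by simp
  also have "\<dots> = det (mat i i (\<lambda>(j, k). ?l j (b k))) ^ d * G (q0 i)"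
    by (rule semi_invariant_powers[OF assms(1,2)]) (simp add: l linear_on_zero)
  also have "det (mat i i (\<lambda>(j, k). ?l j (b k))) = (0::complex)"
    using assms(4) by (subst laplace_expansion_row[where i=K]) auto
  finally show "G (\<Sum>a<K. pw (l a)) = 0" using assms(5) by simp
qed

text \<open>On sums of \<open>i\<close> powers both forms are the same determinant power times their
  value at \<open>q0 i\<close>, and a form of degree \<open>i\<close> is determined by such sums. In
  particular \<open>P (q0 i)\<close> cannot vanish, so the quotient of the two values makes
  sense.\<close>

lemma semi_invariant_unique:
  assumes "semi_invariant i d G" "semi_invariant i d P" "i \<le> N" "G \<in> hom_poly fscale Q i" "P \<in> hom_poly fscale Q i" "P \<noteq> 0"
  shows "\<exists>c. G = fscale c P"
proof -
  have "P (q0 i) \<noteq> 0"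
  proof
    assume "P (q0 i) = 0"
    then have "P = 0"
      by (intro hom_poly_zero_on_few_powers[OF assms(5)]) (simp add: semi_invariant_powers[OF assms(2,3)])
    then show False using assms(6) by simp
  qed
  let ?c = "G (q0 i) / P (q0 i)"
  have "G - fscale ?c P = 0"
  proof (rule hom_poly_zero_on_few_powers)
    show "G - fscale ?c P \<in> hom_poly fscale Q i"
      using assms(4,5) Q.subspace_hom_poly by (intro fs.subspace_diff fs.subspace_scale)
    show "(G - fscale ?c P) (\<Sum>a<i. pw (l a)) = 0" if "\<And>a. linear_on s (*) E (l a)" for l
      using \<open>P (q0 i) \<noteq> 0\<close> that
      by (simp add: fun_apply semi_invariant_powers[OF assms(1,3)] semi_invariant_powers[OF assms(2,3)])
  qed
  then show ?thesis by auto
qed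

end

section \<open>Highest weight vectors are semi-invariant\<close>

text \<open>Clearing denominators by the power \<open>degree r\<close> turns \<open>r\<close> into
  its reflected polynomial, whose degree is at most \<open>degree r\<close>; no degree is left for
  \<open>p\<close>.\<close>

lemma poly_const_if_poly_inverse:
  fixes p r :: "complex poly"
  assumes "\<And>s. s \<noteq> 0 \<Longrightarrow> poly p s = poly r (1 / s)"
  shows "poly p s = poly p 0"
proof -
  have "monom 1 (degree r) * p = reflect_poly r"
    by (rule poly_eqI_nonzero) (simp add: poly_monom assms poly_reflect_poly_nz divide_inverse)
  then have "degree (monom 1 (degree r) * p) \<le> degree r"
    by (simp add: degree_reflect_poly_le)
  then have "degree p = 0"
    by (cases "p = 0") (auto simp: degree_mult_eq degree_monom_eq)
  then obtain c where "p = [:c:]" using degree_eq_zeroE by blast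
  then show ?thesis by simp
qed

lemma mat_mult_entry:
  "A \<in> carrier_mat n n \<Longrightarrow> B \<in> carrier_mat n n \<Longrightarrow> k < n \<Longrightarrow> j < n \<Longrightarrow>
    (A * B) $$ (k, j) = (\<Sum>l<n. A $$ (k, l) * B $$ (l, j))"
  by (auto simp: scalar_prod_def lessThan_atLeast0 intro!: sum.cong)

context form_space
begin

definition elem :: "nat \<Rightarrow> nat \<Rightarrow> complex \<Rightarrow> nat \<times> nat \<Rightarrow> complex" where
  "elem r c t = (\<lambda>y. if y = (r, c) then t else idf y)"

definition proj_compl :: "nat \<Rightarrow> complex mat" where
  "proj_compl i = mat N N (\<lambda>(k, j). if k = j \<and> i \<le> k then 1 else 0)"

lemma proj_compl_carrier [simp]: "proj_compl i \<in> carrier_mat N N"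
  by (simp add: proj_compl_def)

text \<open>\<open>highest_on Y i d F\<close> says that \<open>F\<close> restricts to a highest weight vector of weight \<open>d \<delta>\<^sub>i\<close>
  (or to zero) on \<open>Y\<close>.\<close>

definition highest_on :: "('a \<Rightarrow> complex) set \<Rightarrow> nat \<Rightarrow> nat \<Rightarrow> (('a \<Rightarrow> complex) \<Rightarrow> complex) \<Rightarrow> bool" where
  "highest_on Y i d F \<longleftrightarrow> (\<forall>A\<in>carrier_mat N N. (\<forall>j k. j < k \<longrightarrow> k < N \<longrightarrow> A $$ (k, j) = 0) \<longrightarrow>
     (\<forall>j<N. A $$ (j, j) \<noteq> 0) \<longrightarrow> (\<forall>q\<in>Y. F (act A q) = (\<Prod>j<i. A $$ (j, j) ^ d) * F q))"

lemma highest_onD: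
  assumes "highest_on Y i d F" "A \<in> carrier_mat N N" "\<And>j k. j < k \<Longrightarrow> k < N \<Longrightarrow> A $$ (k, j) = 0"
    "\<And>j. j < N \<Longrightarrow> A $$ (j, j) \<noteq> 0" "q \<in> Y"
  shows "F (act A q) = (\<Prod>j<i. A $$ (j, j) ^ d) * F q"
  using assms unfolding highest_on_def by blast

context
  fixes Y i d F
  assumes Y: "stable Y" and i: "i \<le> N" and F: "polynomial_on fscale Q F" and high: "highest_on Y i d F"
begin

lemma Y_Q: "q \<in> Y \<Longrightarrow> q \<in> Q"
  using Y by (auto simp: stable_def)

lemma Y_act: "q \<in> Y \<Longrightarrow> A \<in> carrier_mat N N \<Longrightarrow> act A q \<in> Y"
  using Y by (auto simp: stable_def)

text \<open>The torus elements with \<open>1\<close> in the first \<open>i\<close> places and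
  \<open>t\<close> in the others have weight \<open>1\<close>, so \<open>F\<close> is constant along
  them; at \<open>t = 0\<close> they become the projection.\<close>

lemma highest_proj:
  assumes "q \<in> Y"
  shows "F (act (emb i idf) q) = F q"
proof -
  obtain p where p: "\<And>t. F (act (emb i idf + t \<cdot>\<^sub>m proj_compl i) q) = poly p t"
    using act_line[OF F Y_Q[OF assms], of "emb i idf" "proj_compl i"] by auto
  have "poly p t = poly [:F q:] t" if "t \<noteq> 0" for t
  proof -
    let ?A = "emb i idf + t \<cdot>\<^sub>m proj_compl i"
    have "F (act ?A q) = (\<Prod>j<i. ?A $$ (j, j) ^ d) * F q"
      by (rule highest_onD[OF high]) (use that assms in \<open>auto simp: emb_def proj_compl_def idf_def\<close>)
    also have "(\<Prod>j<i. ?A $$ (j, j) ^ d) = 1"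
      using i by (intro prod.neutral) (auto simp: emb_def proj_compl_def idf_def)
    finally show ?thesis by (simp add: p)
  qed
  then have "p = [:F q:]" by (rule poly_eqI_nonzero)
  moreover have "emb i idf + 0 \<cdot>\<^sub>m proj_compl i = emb i idf"
    by (rule eq_matI) (auto simp: emb_def proj_compl_def)
  ultimately show ?thesis using p[of 0] by simp
qed

text \<open>The matrices for which the transformation law is already known. They are closed under
  products and limits, and are enlarged from triangular matrices to all matrices.\<close>

definition semi_mats :: "(nat \<times> nat \<Rightarrow> complex) set" where
  "semi_mats = {h. \<forall>q\<in>Y. F (act (emb i h) q) = det (mat i i h) ^ d * F q}"

lemma semi_mats_mult:
  assumes "h \<in> semi_mats" "g \<in> semi_mats"
  shows "mmul i h g \<in> semi_mats"
  unfolding semi_mats_def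
proof (intro CollectI ballI)
  fix q assume q: "q \<in> Y"
  have "F (act (emb i (mmul i h g)) q) = F (act (emb i g) (act (emb i h) q))"
    by (simp add: act_emb_emb i)
  also have "\<dots> = det (mat i i h) ^ d * det (mat i i g) ^ d * F q"
    using assms q Y_act[OF q emb_carrier[of i h]] by (simp add: semi_mats_def mult_ac)
  finally show "F (act (emb i (mmul i h g)) q) = det (mat i i (mmul i h g)) ^ d * F q"
    by (simp add: mat_mmul det_mult[of _ i] power_mult_distrib)
qed

lemma semi_mats_cong: "h \<in> semi_mats \<Longrightarrow> (\<And>k j. k < i \<Longrightarrow> j < i \<Longrightarrow> g (k, j) = h (k, j)) \<Longrightarrow> g \<in> semi_mats"
proof -
  assume h: "h \<in> semi_mats" and eq: "\<And>k j. k < i \<Longrightarrow> j < i \<Longrightarrow> g (k, j) = h (k, j)"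
  have "emb i g = emb i h" using eq by (rule emb_cong)
  moreover have "mat i i g = mat i i h" using eq by (intro cong_mat) auto
  ultimately show "g \<in> semi_mats" using h by (simp add: semi_mats_def)
qed

text \<open>Completed by an identity block, \<open>h\<close> gives an element of the Borel subgroup
  whose weight is the determinant power; a following projection returns \<open>emb i h\<close> and
  does not change the value of \<open>F\<close>.\<close>

lemma semi_mats_upper:
  assumes "\<And>k j. j < k \<Longrightarrow> k < i \<Longrightarrow> h (k, j) = 0" "\<And>j. j < i \<Longrightarrow> h (j, j) \<noteq> 0"
  shows "h \<in> semi_mats"
  unfolding semi_mats_def
proof (intro CollectI ballI)
  fix q assume q: "q \<in> Y"
  let ?U = "emb i h + proj_compl i"
  have U: "?U \<in> carrier_mat N N" by simp
  have "emb i h = ?U * emb i idf"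
  proof (rule eq_matI)
    fix k j assume "k < dim_row (?U * emb i idf)" "j < dim_col (?U * emb i idf)"
    then have kj: "k < N" "j < N" by (auto simp: emb_def proj_compl_def)
    have "(?U * emb i idf) $$ (k, j) = (\<Sum>l<N. ?U $$ (k, l) * emb i idf $$ (l, j))"
      by (rule mat_mult_entry[OF U emb_carrier kj])
    also have "\<dots> = (\<Sum>l<N. if l = j then emb i h $$ (k, j) else 0)"
      using kj by (intro sum.cong) (auto simp: emb_def proj_compl_def idf_def)
    finally show "emb i h $$ (k, j) = (?U * emb i idf) $$ (k, j)" using kj by simp
  qed (auto simp: emb_def proj_compl_def)
  then have "F (act (emb i h) q) = F (act (emb i idf) (act ?U q))"
    using act_mult[OF U emb_carrier] by metis
  also have "\<dots> = F (act ?U q)" by (rule highest_proj[OF Y_act[OF q U]])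
  also have "\<dots> = (\<Prod>j<i. ?U $$ (j, j) ^ d) * F q"
    by (rule highest_onD[OF high U]) (use assms q in \<open>auto simp: emb_def proj_compl_def\<close>)
  also have "(\<Prod>j<i. ?U $$ (j, j) ^ d) = det (mat i i h) ^ d"
  proof -
    have "det (mat i i h) = prod_list (diag_mat (mat i i h))"
      by (rule det_upper_triangular) (use assms in auto)
    also have "\<dots> = (\<Prod>j<i. h (j, j))"
      by (simp add: diag_mat_def prod.distinct_set_conv_list[symmetric] lessThan_atLeast0)
    also have "\<dots> = (\<Prod>j<i. ?U $$ (j, j))"
      using i by (intro prod.cong) (auto simp: emb_def proj_compl_def)
    finally show ?thesis by (simp add: prod_power_distrib)
  qed
  finally show "F (act (emb i h) q) = det (mat i i h) ^ d * F q" .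
qed

text \<open>Both sides of the transformation law are polynomial along the line, so it extends to
  \<open>t = 0\<close>. This covers matrices with a zero pivot.\<close>

lemma semi_mats_limit:
  assumes "\<And>t. t \<noteq> 0 \<Longrightarrow> g + fscale t h \<in> semi_mats"
  shows "g \<in> semi_mats"
  unfolding semi_mats_def
proof (intro CollectI ballI)
  fix q assume q: "q \<in> Y"
  have "polynomial_on fscale UNIV (\<lambda>g. F (act (emb i g) q) - det (mat i i g) ^ d * F q)"
    by (intro polynomial_on_diff polynomial_on.mult polynomial_on_power polynomial_on.const det_mat_poly
        polynomial_emb[OF F Y_Q[OF q]])
  then obtain p where p: "\<And>t. F (act (emb i (g + fscale t h)) q) - det (mat i i (g + fscale t h)) ^ d * F q = poly p t"
    using UN.polynomial_on_line[of _ g h] by blast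
  have "poly p t = poly 0 t" if "t \<noteq> 0" for t
    using assms[OF that] q p[of t, symmetric] by (simp add: semi_mats_def)
  then have "p = 0" by (rule poly_eqI_nonzero)
  moreover have "g + fscale 0 h = g" by (simp add: fun_eq_iff fun_apply)
  ultimately show "F (act (emb i g) q) = det (mat i i g) ^ d * F q"
    using p[of 0] by simp
qed

text \<open>The \<open>2 \<times> 2\<close> identity \<open>(1, 0; t, 1) = (1/t, -1; 1, 0) (t, 1; 0, 1/t)\<close> turns invariance under
  upper triangular matrices into a function that is a polynomial both in \<open>t\<close> and in \<open>1/t\<close>.\<close>

lemma semi_mats_lower:
  assumes cr: "c < r" "r < i"
  shows "elem r c t \<in> semi_mats"
  unfolding semi_mats_def
proof (intro CollectI ballI)
  fix q assume q: "q \<in> Y"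
  \<comment> \<open>The two factors of the identity, placed in rows and columns \<open>c\<close> and
    \<open>r\<close>: \<open>g u\<close> is \<open>(u, -1; 1, 0)\<close> and is affine in
    \<open>u = 1/t\<close>, while \<open>b t\<close> is upper triangular with determinant
    \<open>1\<close>.\<close>
  define g where "g = (\<lambda>u (k, l). if k = c then (if l = c then u else 0) + (if l = r then - 1 else 0)
     else if k = r then (if l = c then 1 else 0) else if l = k then 1 else (0::complex))"
  define b where "b = (\<lambda>t (k, l). if k = c then (if l = c then t else if l = r then 1 else 0)
     else if k = r then (if l = r then 1 / t else 0) else if l = k then 1 else (0::complex))"
  have gb: "mmul i (g (1 / t)) (b t) (k, j) = elem r c t (k, j)"
    if "t \<noteq> 0" "k < i" "j < i" for t k j
  proof -
    have "mmul i (g (1 / t)) (b t) (k, j) = (if k = c then 1 / t * b t (c, j) - b t (r, j)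
       else if k = r then b t (c, j) else b t (k, j))"
      using cr that(2) unfolding mmul_def g_def
      by (auto simp: distrib_right sum.distrib if_distrib[of "\<lambda>x. x * _"] cong: if_cong)
    also have "\<dots> = elem r c t (k, j)"
      using cr that by (auto simp: b_def elem_def idf_def)
    finally show ?thesis .
  qed
  have poly: "polynomial_on fscale UNIV (\<lambda>g. F (act (emb i g) q))"
    by (rule polynomial_emb[OF F Y_Q[OF q]])
  let ?E = "\<lambda>a b y. if y = (a, b) then 1 else 0 :: complex"
  obtain p where p: "\<And>t. F (act (emb i (idf + fscale t (?E r c))) q) = poly p t"
    using UN.polynomial_on_line[OF poly, of idf "?E r c"] by auto
  have pt: "F (act (emb i (elem r c t)) q) = poly p t" for t
  proof -
    have "idf + fscale t (?E r c) = elem r c t"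
      using cr by (auto simp: fun_eq_iff fun_apply elem_def idf_def)
    then show ?thesis using p[of t] by simp
  qed
  obtain p' where p': "\<And>t. F (act (emb i (g 0 + fscale t (?E c c))) q) = poly p' t"
    using UN.polynomial_on_line[OF poly, of "g 0" "?E c c"] by auto
  have pt': "F (act (emb i (g t)) q) = poly p' t" for t
  proof -
    have "g 0 + fscale t (?E c c) = g t"
      using cr by (auto simp: fun_eq_iff fun_apply g_def)
    then show ?thesis using p'[of t] by simp
  qed
  have "poly p t = poly p' (1 / t)" if t: "t \<noteq> 0" for t
  proof -
    have bZ: "b t \<in> semi_mats" by (rule semi_mats_upper) (use cr t in \<open>auto simp: b_def\<close>)
    have "det (mat i i (b t)) = prod_list (diag_mat (mat i i (b t)))"
      by (rule det_upper_triangular) (use cr in \<open>auto simp: b_def\<close>)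
    also have "\<dots> = (\<Prod>j<i. b t (j, j))"
      by (simp add: diag_mat_def prod.distinct_set_conv_list[symmetric] lessThan_atLeast0)
    also have "\<dots> = (\<Prod>j\<in>{c, r}. b t (j, j))"
      using cr by (intro prod.mono_neutral_right) (auto simp: b_def)
    also have "\<dots> = 1" using cr t by (simp add: b_def)
    finally have det: "det (mat i i (b t)) = 1" .
    have "poly p t = F (act (emb i (mmul i (g (1 / t)) (b t))) q)"
      unfolding pt[symmetric] using gb[OF t] by (intro arg_cong[where f="\<lambda>M. F (act M q)"] emb_cong) auto
    \<comment> \<open>Substitution reverses products, so the triangular factor acts last and is
      removed by its semi-invariance, leaving a polynomial in \<open>1/t\<close>.\<close>
    also have "\<dots> = F (act (emb i (b t)) (act (emb i (g (1 / t))) q))"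
      by (simp add: act_emb_emb i)
    also have "\<dots> = F (act (emb i (g (1 / t))) q)"
      using bZ Y_act[OF q emb_carrier[of i "g (1 / t)"]] by (simp add: semi_mats_def det)
    finally show ?thesis by (simp add: pt')
  qed
  then have "poly p t = poly p 0" by (rule poly_const_if_poly_inverse)
  moreover have "elem r c 0 = idf" using cr by (auto simp: elem_def idf_def fun_eq_iff)
  ultimately have "F (act (emb i (elem r c t)) q) = F q"
    using pt[of t] pt[of 0] highest_proj[OF q] by simp
  moreover have "det (mat i i (elem r c t)) = 1"
  proof -
    have "det (mat i i (elem r c t)) = prod_list (diag_mat (mat i i (elem r c t)))"
      by (rule det_lower_triangular[of i]) (use cr in \<open>auto simp: elem_def idf_def\<close>)
    also have "\<dots> = (\<Prod>j<i. elem r c t (j, j))"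
      by (simp add: diag_mat_def prod.distinct_set_conv_list[symmetric] lessThan_atLeast0)
    also have "\<dots> = 1" using cr by (intro prod.neutral) (auto simp: elem_def idf_def)
    finally show ?thesis .
  qed
  ultimately show "F (act (emb i (elem r c t)) q) = det (mat i i (elem r c t)) ^ d * F q" by simp
qed

text \<open>Elementary matrices changing different entries of the same column below the diagonal
  multiply by simply collecting these entries.\<close>

lemma semi_mats_lower_column:
  assumes k: "k < i" and "finite S" "S \<subseteq> {k<..<i}"
  shows "(\<lambda>(x, j). if j = k \<and> x \<in> S then c x else idf (x, j)) \<in> semi_mats"
  using assms(2,3)
proof (induction S rule: finite_induct)
  case empty
  have "idf \<in> semi_mats" by (rule semi_mats_upper) (auto simp: idf_def)
  then show ?case by (rule semi_mats_cong) auto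
next
  case (insert a S)
  let ?C = "\<lambda>(x, j). if j = k \<and> x \<in> S then c x else idf (x, j)"
  have "?C \<in> semi_mats" using insert by auto
  moreover have "elem a k (c a) \<in> semi_mats" using insert by (intro semi_mats_lower) auto
  ultimately have "mmul i ?C (elem a k (c a)) \<in> semi_mats" by (rule semi_mats_mult)
  then show ?case
  proof (rule semi_mats_cong)
    fix x j assume xj: "x < i" "j < i"
    have a: "a \<noteq> k" "a < i" "a \<notin> S" using insert by auto
    have "mmul i ?C (elem a k (c a)) (x, j) = (\<Sum>l<i. (if l = j then ?C (x, j) else 0) +
        (if l = a then (if j = k then ?C (x, a) * c a else 0) else 0))"
      unfolding mmul_def prod.case using a by (intro sum.cong) (auto simp: elem_def idf_def)
    also have "\<dots> = ?C (x, j) + (if j = k then ?C (x, a) * c a else 0)"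
      using xj a by (simp add: sum.distrib)
    also have "\<dots> = (if j = k \<and> x \<in> insert a S then c x else idf (x, j))"
      using a by (auto simp: idf_def)
    finally show "(\<lambda>(x, j). if j = k \<and> x \<in> insert a S then c x else idf (x, j)) (x, j) = mmul i ?C (elem a k (c a)) (x, j)"
      by simp
  qed
qed

text \<open>If the columns after \<open>k\<close> are those of the identity and the entry \<open>(k, k)\<close> is nonzero, split off
  the matrix which has the same column \<open>k\<close> and is the identity elsewhere.\<close>

lemma semi_mats_all_aux:
  assumes "k \<le> i" "\<And>j l. k \<le> j \<Longrightarrow> j < i \<Longrightarrow> l < i \<Longrightarrow> h (l, j) = idf (l, j)"
  shows "h \<in> semi_mats"
  using assms
proof (induction k arbitrary: h)
  case 0
  have "idf \<in> semi_mats" by (rule semi_mats_upper) (auto simp: idf_def)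
  then show ?case by (rule semi_mats_cong) (use 0 in auto)
next
  case (Suc k)
  have k: "k < i" using Suc by simp
  have nonzero: "h \<in> semi_mats" if hk: "h (k, k) \<noteq> 0"
    and cols: "\<And>j l. Suc k \<le> j \<Longrightarrow> j < i \<Longrightarrow> l < i \<Longrightarrow> h (l, j) = idf (l, j)" for h
  proof -
    \<comment> \<open>The product of \<open>C\<close> and \<open>U\<close> is the identity with
      column \<open>k\<close> replaced by that of \<open>h\<close>. \<open>H\<close> is what
      elimination with the pivot \<open>h (k, k)\<close> leaves; its columns from \<open>k\<close>
      on are those of the identity, so the induction hypothesis applies to it.\<close>
    define C where "C = (\<lambda>(x, j). if j = k \<and> x \<in> {k<..<i} then h (x, k) / h (k, k) else idf (x, j))"
    define U where "U = (\<lambda>(x, j). if j = k \<and> x \<le> k then h (x, k) else idf (x, j))"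
    define H where "H = (\<lambda>(x, j). if x = k then h (k, j) / h (k, k) else h (x, j) - h (x, k) * h (k, j) / h (k, k))"
    have "C \<in> semi_mats" unfolding C_def by (rule semi_mats_lower_column[OF k]) auto
    moreover have "U \<in> semi_mats" by (rule semi_mats_upper) (use hk in \<open>auto simp: U_def idf_def\<close>)
    moreover have "H \<in> semi_mats"
    proof (rule Suc.IH)
      fix j l assume jl: "k \<le> j" "j < i" "l < i"
      show "H (l, j) = idf (l, j)"
      proof (cases "j = k")
        case False
        then show ?thesis using jl k cols[of j l] cols[of j k] by (auto simp: H_def idf_def)
      qed (use hk in \<open>auto simp: H_def idf_def\<close>)
    qed (use k in simp)
    ultimately have "mmul i (mmul i C U) H \<in> semi_mats" by (intro semi_mats_mult)
    then show "h \<in> semi_mats"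
    proof (rule semi_mats_cong)
      fix x j assume xj: "x < i" "j < i"
      have CU: "mmul i C U (x, l) = (if l = k then h (x, k) else idf (x, l))" if l: "l < i" for l
      proof (cases "l = k")
        case True
        have "mmul i C U (x, l) = (\<Sum>y<i. (if y = x then (if x \<le> k then h (x, k) else 0) else 0) +
           (if y = k then (if x > k then h (x, k) else 0) else 0))"
          unfolding mmul_def prod.case using xj True hk by (intro sum.cong) (auto simp: C_def U_def idf_def)
        also have "\<dots> = h (x, k)" using xj k by (simp add: sum.distrib)
        finally show ?thesis using True by simp
      next
        case False
        have "mmul i C U (x, l) = (\<Sum>y<i. if y = l then C (x, l) else 0)"
          unfolding mmul_def prod.case using False by (intro sum.cong) (auto simp: U_def idf_def)
        also have "\<dots> = idf (x, l)" using l False by (simp add: C_def)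
        finally show ?thesis using False by simp
      qed
      have "mmul i (mmul i C U) H (x, j) = (\<Sum>l<i. (if l = k then h (x, k) * H (k, j) else 0) +
         (if l = x then (if x = k then 0 else H (x, j)) else 0))"
        unfolding mmul_def[of i "mmul i C U"] prod.case by (intro sum.cong) (auto simp: CU idf_def)
      also have "\<dots> = h (x, k) * H (k, j) + (if x = k then 0 else H (x, j))"
        using xj k by (simp add: sum.distrib)
      also have "\<dots> = h (x, j)" using hk by (auto simp: H_def)
      finally show "h (x, j) = mmul i (mmul i C U) H (x, j)" by simp
    qed
  qed
  show ?case
  proof (cases "h (k, k) = 0")
    case True
    \<comment> \<open>A zero pivot is perturbed to \<open>t\<close>; the limit \<open>t = 0\<close>
      recovers \<open>h\<close>.\<close>
    show ?thesis
    proof (rule semi_mats_limit)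
      fix t :: complex assume "t \<noteq> 0"
      then show "h + fscale t (\<lambda>y. if y = (k, k) then 1 else 0) \<in> semi_mats"
        using True Suc.prems by (intro nonzero) (auto simp: fun_apply)
    qed
  next
    case False
    then show ?thesis using Suc.prems by (intro nonzero) auto
  qed
qed

lemma highest_semi_invariant: "q \<in> Y \<Longrightarrow> F (act (emb i h) q) = det (mat i i h) ^ d * F q"
  using semi_mats_all_aux[of i h] by (simp add: semi_mats_def)

end

end

section \<open>The invariants of the highest weights\<close>

lemma sum_PiE_insert:
  assumes "x \<notin> S"
  shows "(\<Sum>g\<in>insert x S \<rightarrow>\<^sub>E J. f g) = (\<Sum>y\<in>J. \<Sum>g\<in>S \<rightarrow>\<^sub>E J. f (g(x := y)))"
proof -
  have "(\<Sum>g\<in>insert x S \<rightarrow>\<^sub>E J. f g) = (\<Sum>z\<in>J \<times> (S \<rightarrow>\<^sub>E J). f ((snd z)(x := fst z)))"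
    unfolding PiE_insert_eq
    by (subst sum.reindex) (use assms in \<open>auto simp: case_prod_beta intro: inj_combinator\<close>)
  then show ?thesis by (simp add: sum.cartesian_product case_prod_beta)
qed

context form_space
begin

text \<open>A scalar matrix \<open>c\<close> multiplies \<open>q\<close> by \<open>c ^ m\<close> and
  has weight \<open>c ^ (i * d)\<close>, so on \<open>Y\<close> only the component of degree
  \<open>K\<close> with \<open>m * K = i * d\<close> contributes. Its values on \<open>Y\<close>
  transform by the determinant power, hence the averaging operator does not change them, while it
  makes the form semi-invariant on all of \<open>Q\<close>.\<close>

lemma highest_extend:
  assumes Y: "stable Y" and i: "i \<le> N" and F: "polynomial_on fscale Q F" and high: "highest_on Y i d F"
  shows "(\<forall>q\<in>Y. F q = 0) \<or>
    (\<exists>K G. m * K = i * d \<and> G \<in> hom_poly fscale Q K \<and> semi_invariant i d G \<and> (\<forall>q\<in>Y. G q = F q))"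
proof -
  obtain D h where h: "\<And>k. h k \<in> hom_poly fscale Q k" "\<And>q. q \<in> Q \<Longrightarrow> F q = (\<Sum>k\<le>D. h k q)"
    using Q.polynomial_on_graded_hom[OF F] by blast
  have comp: "F q = (\<Sum>k\<le>D. if m * k = i * d then h k q else 0)" if q: "q \<in> Y" for q
  proof -
    have qQ: "q \<in> Q" using Y_Q[OF Y i F high q] .
    have "(\<Sum>k\<le>D. h k (fscale (c ^ m) q)) = c ^ (i * d) * (\<Sum>k\<le>D. h k q)" if c: "c \<noteq> 0" for c
    proof -
      have "F (act (c \<cdot>\<^sub>m 1\<^sub>m N) q) = (\<Prod>j<i. (c \<cdot>\<^sub>m 1\<^sub>m N) $$ (j, j) ^ d) * F q"
        by (rule highest_onD[OF high]) (use c q in auto)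
      also have "(\<Prod>j<i. (c \<cdot>\<^sub>m 1\<^sub>m N) $$ (j, j) ^ d) = (\<Prod>j<i. c ^ d)"
        using i by (intro prod.cong) auto
      finally show ?thesis
        by (simp add: act_scalar[OF qQ] h(2) qQ Q.W_scale power_mult[symmetric] mult.commute)
    qed
    from Q.graded_component[OF h(1) qQ this] show ?thesis using h(2)[OF qQ] by simp
  qed
  show ?thesis
  proof (cases "\<exists>K\<le>D. m * K = i * d")
    case False
    then show ?thesis using comp by (auto intro!: sum.neutral)
  next
    case True
    then obtain K where K: "K \<le> D" "m * K = i * d" by blast
    have FK: "F q = h K q" if "q \<in> Y" for q
    proof -
      have "F q = (\<Sum>k\<le>D. if k = K then h k q else 0)"
      proof -
        have "m * k = i * d \<longleftrightarrow> k = K" for k using K(2)[symmetric] m_pos by simp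
        then show ?thesis unfolding comp[OF that] by simp
      qed
      then show ?thesis using K by simp
    qed
    obtain G where G: "G \<in> hom_poly fscale Q K" "semi_invariant i d G"
      "\<And>q. q \<in> Q \<Longrightarrow> (\<And>g. h K (act (emb i g) q) = det (mat i i g) ^ d * h K q) \<Longrightarrow> G q = h K q"
      using reynolds[OF h(1) K(2) i] by blast
    have "G q = F q" if q: "q \<in> Y" for q
    proof -
      have "h K (act (emb i g) q) = det (mat i i g) ^ d * h K q" for g
        using highest_semi_invariant[OF Y i F high q, of g] FK[OF q] FK[OF Y_act[OF Y i F high q emb_carrier]] by simp
      from G(3)[OF Y_Q[OF Y i F high q] this] show ?thesis using FK[OF q] by simp
    qed
    then show ?thesis using K G by blast
  qed
qed

text \<open>From \<open>m * K = i * d\<close> and \<open>d < m\<close> follows \<open>K < i\<close>: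
  the degree is too small for a nonzero semi-invariant.\<close>

lemma highest_zero:
  assumes "stable Y" "0 < i" "i \<le> N" "polynomial_on fscale Q F" "highest_on Y i d F" "0 < d" "d < m" "q \<in> Y"
  shows "F q = 0"
proof (rule ccontr)
  assume "F q \<noteq> 0"
  then obtain K G where KG: "m * K = i * d" "G \<in> hom_poly fscale Q K" "semi_invariant i d G" "\<And>q. q \<in> Y \<Longrightarrow> G q = F q"
    using highest_extend[OF assms(1,3,4,5)] assms(8) by blast
  have "m * K < m * i" using KG(1) assms(2,7) by simp
  then have "K < i" by simp
  from semi_invariant_zero[OF KG(3) assms(3) KG(2) this assms(6)] have "G q = 0" by (simp add: zero_fun_apply)
  then show False using KG(4)[OF assms(8)] \<open>F q \<noteq> 0\<close> by simp
qed

lemma highest_unique: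
  assumes "stable Y" "i \<le> N" "polynomial_on fscale Q F" "highest_on Y i m F"
    and "P \<in> hom_poly fscale Q i" "semi_invariant i m P" "P \<noteq> 0"
  shows "\<exists>c. \<forall>q\<in>Y. F q = c * P q"
proof (cases "\<forall>q\<in>Y. F q = 0")
  case True
  then show ?thesis by (intro exI[of _ 0]) simp
next
  case False
  then obtain K G where KG: "m * K = i * m" "G \<in> hom_poly fscale Q K" "semi_invariant i m G" "\<And>q. q \<in> Y \<Longrightarrow> G q = F q"
    using highest_extend[OF assms(1-4)] by blast
  have "K = i" using KG(1) m_pos by simp
  then obtain c where "G = fscale c P" using semi_invariant_unique[OF KG(3) assms(6,2)] KG(2) assms(5,7) by blast
  then show ?thesis using KG(4) by (metis fscale_apply)
qed

text \<open>For \<open>q\<close> in \<open>Q\<close>, the symmetric \<open>m\<close>-linear form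
  with \<open>q\<close> on its diagonal; the arguments are \<open>u 0\<close> to
  \<open>u (m - 1)\<close>.\<close>

definition polarization :: "('a \<Rightarrow> complex) \<Rightarrow> (nat \<Rightarrow> 'a) \<Rightarrow> complex" where
  "polarization q u = (\<Sum>U\<in>Pow {..<m}. (- 1) ^ card ({..<m} - U) * q (\<Sum>r\<in>U. u r)) / fact m"

text \<open>The product of \<open>i\<close> copies of the polarization of \<open>q\<close>, antisymmetrized in each of the \<open>m\<close> slots
  (Cayley's first hyperdeterminant of the symmetric tensor \<open>q\<close>).\<close>

definition Pinv :: "nat \<Rightarrow> (nat \<Rightarrow> 'a) \<Rightarrow> ('a \<Rightarrow> complex) \<Rightarrow> complex" where
  "Pinv i v q = (if q \<in> Q then \<Sum>\<sigma>\<in>{..<m} \<rightarrow>\<^sub>E {\<pi>. \<pi> permutes {0..<i}}.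
     (\<Prod>r<m. signof (\<sigma> r)) * (\<Prod>a=0..<i. polarization q (\<lambda>r. v (\<sigma> r a))) else 0)"

lemma polarization_powers:
  assumes l: "\<And>j. j < n \<Longrightarrow> linear_on s (*) E (l j)" and u: "\<And>r. r < m \<Longrightarrow> u r \<in> E"
  shows "polarization (\<Sum>j<(n::nat). pw (l j)) u = (\<Sum>j<n. \<Prod>r<m. l j (u r))"
proof -
  have "(\<Sum>j<n. pw (l j)) (\<Sum>r\<in>U. u r) = (\<Sum>j<n. (\<Sum>r\<in>U. l j (u r)) ^ m)" if U: "U \<in> Pow {..<m}" for U
  proof -
    have uE: "u r \<in> E" if "r \<in> U" for r using that U u by auto
    then have "(\<Sum>r\<in>U. u r) \<in> E" by (rule W_sum)
    moreover have "l j (\<Sum>r\<in>U. u r) = (\<Sum>r\<in>U. l j (u r))" if "j < n" for j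
      by (rule linear_on_sum[OF l[OF that] uE])
    ultimately show ?thesis by (simp add: sum_fun_apply pw_def)
  qed
  then have "polarization (\<Sum>j<n. pw (l j)) u =
      (\<Sum>U\<in>Pow {..<m}. \<Sum>j<n. (- 1) ^ card ({..<m} - U) * (\<Sum>r\<in>U. l j (u r)) ^ m) / fact m"
    unfolding polarization_def by (simp add: sum_distrib_left)
  also have "\<dots> = (\<Sum>j<n. \<Sum>U\<in>Pow {..<m}. (- 1) ^ card ({..<m} - U) * (\<Sum>r\<in>U. l j (u r)) ^ m) / fact m"
    by (subst sum.swap) (rule refl)
  also have "\<dots> = (\<Sum>j<n. fact m * (\<Prod>r<m. l j (u r))) / fact m"
  proof -
    have "(\<Sum>U\<in>Pow {..<m}. (- 1) ^ card ({..<m} - U) * (\<Sum>r\<in>U. l j (u r)) ^ m) = fact m * (\<Prod>r<m. l j (u r))" for j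
      using sum_subset_signed_power[of "{..<m}" "\<lambda>r. l j (u r)"] by simp
    then show ?thesis by simp
  qed
  also have "\<dots> = (\<Sum>j<n. \<Prod>r<m. l j (u r))"
    by (simp flip: sum_distrib_left)
  finally show ?thesis .
qed

text \<open>Expanding the product over \<open>a\<close> chooses a linear form \<open>\<xi> a\<close>
  for each factor. After exchanging the products over \<open>a\<close> and \<open>r\<close>, the sum
  over \<open>\<sigma>\<close> factors into \<open>m\<close> equal Leibniz sums, one for each
  slot.\<close>

lemma Pinv_powers:
  assumes l: "\<And>j. j < n \<Longrightarrow> linear_on s (*) E (l j)" and v: "\<And>c. c < i \<Longrightarrow> v c \<in> E"
  shows "Pinv i v (\<Sum>j<(n::nat). pw (l j)) =
    (\<Sum>\<xi>\<in>{0..<i} \<rightarrow>\<^sub>E {..<n}. det (mat i i (\<lambda>(a, c). l (\<xi> a) (v c))) ^ m)"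
proof -
  let ?S = "{\<pi>. \<pi> permutes {0..<i}}" and ?X = "{0..<i} \<rightarrow>\<^sub>E {..<n}"
  let ?t = "\<lambda>\<xi> \<pi>. signof \<pi> * (\<Prod>a=0..<i. l (\<xi> a) (v (\<pi> a)))"
  have inQ: "(\<Sum>j<n. pw (l j)) \<in> Q" using l by (auto intro: Q.W_sum pw_in)
  have finS: "finite ?S" by (simp add: finite_permutations)
  have "(\<Prod>r<m. signof (\<sigma> r)) * (\<Prod>a=0..<i. polarization (\<Sum>j<n. pw (l j)) (\<lambda>r. v (\<sigma> r a))) =
      (\<Sum>\<xi>\<in>?X. \<Prod>r<m. ?t \<xi> (\<sigma> r))" if sig: "\<sigma> \<in> {..<m} \<rightarrow>\<^sub>E ?S" for \<sigma>
  proof -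
    have "polarization (\<Sum>j<n. pw (l j)) (\<lambda>r. v (\<sigma> r a)) = (\<Sum>j<n. \<Prod>r<m. l j (v (\<sigma> r a)))" if "a < i" for a
    proof (rule polarization_powers[OF l])
      fix r assume "r < m"
      then have "\<sigma> r permutes {0..<i}" using sig by (auto simp: PiE_iff)
      then have "\<sigma> r a < i" using permutes_in_image[of "\<sigma> r" "{0..<i}" a] that by simp
      then show "v (\<sigma> r a) \<in> E" by (rule v)
    qed
    then have "(\<Prod>a=0..<i. polarization (\<Sum>j<n. pw (l j)) (\<lambda>r. v (\<sigma> r a))) =
        (\<Prod>a=0..<i. \<Sum>j<n. \<Prod>r<m. l j (v (\<sigma> r a)))"
      by (intro prod.cong) auto
    also have "\<dots> = (\<Sum>\<xi>\<in>?X. \<Prod>a=0..<i. \<Prod>r<m. l (\<xi> a) (v (\<sigma> r a)))"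
      by (rule prod_sum_PiE) auto
    also have "\<dots> = (\<Sum>\<xi>\<in>?X. \<Prod>r<m. \<Prod>a=0..<i. l (\<xi> a) (v (\<sigma> r a)))"
      by (intro sum.cong refl prod.swap)
    finally show ?thesis by (simp add: sum_distrib_left prod.distrib)
  qed
  then have "Pinv i v (\<Sum>j<n. pw (l j)) = (\<Sum>\<sigma>\<in>{..<m} \<rightarrow>\<^sub>E ?S. \<Sum>\<xi>\<in>?X. \<Prod>r<m. ?t \<xi> (\<sigma> r))"
    unfolding Pinv_def using inQ by simp
  also have "\<dots> = (\<Sum>\<xi>\<in>?X. \<Sum>\<sigma>\<in>{..<m} \<rightarrow>\<^sub>E ?S. \<Prod>r<m. ?t \<xi> (\<sigma> r))"
    by (rule sum.swap)
  also have "\<dots> = (\<Sum>\<xi>\<in>?X. (\<Sum>\<pi>\<in>?S. ?t \<xi> \<pi>) ^ m)"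
    using prod_sum_PiE[of "{..<m}" "\<lambda>_. ?S" "\<lambda>_. ?t _"] finS by simp
  also have "\<dots> = (\<Sum>\<xi>\<in>?X. det (mat i i (\<lambda>(a, c). l (\<xi> a) (v c))) ^ m)"
  proof (intro sum.cong refl arg_cong[where f="\<lambda>x. x ^ m"])
    fix \<xi>
    show "(\<Sum>\<pi>\<in>?S. ?t \<xi> \<pi>) = det (mat i i (\<lambda>(a, c). l (\<xi> a) (v c)))"
      by (subst det_def'[of _ i]) (auto intro!: sum.cong prod.cong simp: permutes_in_image)
  qed
  finally show ?thesis .
qed

lemma Pinv_hom: "Pinv i v \<in> hom_poly fscale Q i"
proof (rule Q.hom_polyI)
  have ev: "linear_on fscale (*) Q (\<lambda>q. q x)" for x :: 'a
    by (simp add: linear_on_def fun_apply)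
  have polarization: "polynomial_on fscale Q (\<lambda>q. polarization q u)" for u
    unfolding polarization_def divide_inverse
    by (intro polynomial_on.mult polynomial_on.const polynomial_on_sum polynomial_on_cmult polynomial_on.linear[OF ev])
  have "polynomial_on fscale Q (\<lambda>q. \<Sum>\<sigma>\<in>{..<m} \<rightarrow>\<^sub>E {\<pi>. \<pi> permutes {0..<i}}.
     (\<Prod>r<m. signof (\<sigma> r)) * (\<Prod>a=0..<i. polarization q (\<lambda>r. v (\<sigma> r a))))"
    by (intro polynomial_on_sum polynomial_on_cmult polynomial_on_prod polarization)
  then show "polynomial_on fscale Q (Pinv i v)"
    by (rule polynomial_on_cong) (auto simp: Pinv_def Q.W_add Q.W_scale)
  have "polarization (fscale c q) u = c * polarization q u" for c q u
    by (simp add: polarization_def fun_apply sum_distrib_left mult_ac)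
  then show "Pinv i v (fscale c q) = c ^ i * Pinv i v q" if "q \<in> Q" for c q
    using that by (simp add: Pinv_def Q.W_scale prod.distrib sum_distrib_left mult_ac)
qed (simp add: Pinv_def)

lemma Pinv_act:
  assumes "q \<in> Q" "\<And>c. c < i \<Longrightarrow> v c \<in> E"
  shows "Pinv i v (act A q) = Pinv i (\<lambda>c. T A (v c)) q"
proof -
  obtain n l where l: "\<And>j. j < n \<Longrightarrow> linear_on s (*) E (l j)" and q: "q = (\<Sum>j<(n::nat). pw (l j))"
    using Q_sum_pw[OF assms(1)] by blast
  have "act A q = (\<Sum>j<n. pw (\<lambda>x. l j (T A x)))" by (simp add: q act_sum act_pw)
  then show ?thesis
    using Pinv_powers[of n "\<lambda>j x. l j (T A x)" i v] Pinv_powers[of n l i "\<lambda>c. T A (v c)"] l assms(2)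
    by (simp add: q linear_T T_in)
qed

text \<open>Such a matrix maps the span of the first \<open>i\<close> basis vectors into itself, so
  each minor is multiplied by the determinant of the leading block. This serves the matrices
  \<open>emb i h\<close>, the Borel subgroup and projected translates alike.\<close>

lemma Pinv_block:
  assumes "q \<in> Q" "i \<le> N" "A \<in> carrier_mat N N" "\<And>k j. j < i \<Longrightarrow> i \<le> k \<Longrightarrow> k < N \<Longrightarrow> A $$ (k, j) = 0"
  shows "Pinv i b (act A q) = det (mat i i (\<lambda>y. A $$ y)) ^ m * Pinv i b q"
proof -
  obtain n l where l: "\<And>j. j < n \<Longrightarrow> linear_on s (*) E (l j)" and q: "q = (\<Sum>j<(n::nat). pw (l j))"
    using Q_sum_pw[OF assms(1)] by blast
  have bE: "b c \<in> E" if "c < i" for c using that assms(2) by (simp add: b_in)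
  have "l j (T A (b c)) = (\<Sum>k<i. l j (b k) * A $$ (k, c))" if "j < n" "c < i" for j c
  proof -
    have "l j (T A (b c)) = (\<Sum>k<N. coord k (T A (b c)) * l j (b k))"
      by (rule linear_expand[OF l[OF that(1)] T_in])
    also have "\<dots> = (\<Sum>k<N. if k < i then l j (b k) * A $$ (k, c) else 0)"
      using that assms by (intro sum.cong) (auto simp: coord_T sum_coord_b)
    finally show ?thesis using sum_lessThan_le[OF assms(2)] by simp
  qed
  then have "mat i i (\<lambda>(a, c). l (\<xi> a) (T A (b c))) = mat i i (\<lambda>(a, c). l (\<xi> a) (b c)) * mat i i (\<lambda>y. A $$ y)"
    if "\<xi> \<in> {0..<i} \<rightarrow>\<^sub>E {..<n}" for \<xi>
    using that unfolding mat_mmul[symmetric] by (intro cong_mat) (auto simp: mmul_def PiE_iff)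
  then have "Pinv i (\<lambda>c. T A (b c)) q = (\<Sum>\<xi>\<in>{0..<i} \<rightarrow>\<^sub>E {..<n}.
      det (mat i i (\<lambda>y. A $$ y)) ^ m * det (mat i i (\<lambda>(a, c). l (\<xi> a) (b c))) ^ m)"
    unfolding q by (subst Pinv_powers[OF l]) (auto simp: T_in det_mult[of _ i] power_mult_distrib mult.commute)
  also have "\<dots> = det (mat i i (\<lambda>y. A $$ y)) ^ m * Pinv i b q"
    unfolding q by (subst Pinv_powers[OF l]) (auto simp: bE sum_distrib_left)
  finally show ?thesis using Pinv_act[OF assms(1) bE] by simp
qed

lemma Pinv_semi_invariant:
  assumes "i \<le> N"
  shows "semi_invariant i m (Pinv i b)"
  unfolding semi_invariant_def
proof (intro allI ballI)
  fix h q assume "q \<in> Q"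
  moreover have "mat i i (\<lambda>y. emb i h $$ y) = mat i i h"
    using assms by (intro eq_matI) (auto simp: emb_def)
  ultimately show "Pinv i b (act (emb i h) q) = det (mat i i h) ^ m * Pinv i b q"
    using assms by (subst Pinv_block) (auto simp: emb_def)
qed

text \<open>For a fixed last linear form, column operations make the last row vanish except at one place;
  expanding along it leaves a value of \<open>Pinv i\<close>.\<close>

lemma Pinv_descent:
  assumes q: "q \<in> Q" and zero: "\<And>v. (\<And>c. c < i \<Longrightarrow> v c \<in> E) \<Longrightarrow> Pinv i v q = 0"
    and v: "\<And>c. c < Suc i \<Longrightarrow> v c \<in> E"
  shows "Pinv (Suc i) v q = 0"
proof -
  obtain n l where l: "\<And>j. j < n \<Longrightarrow> linear_on s (*) E (l j)" and q_eq: "q = (\<Sum>j<(n::nat). pw (l j))"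
    using Q_sum_pw[OF q] by blast
  let ?X = "{0..<i} \<rightarrow>\<^sub>E {..<n}"
  let ?M = "\<lambda>v \<xi>. mat (Suc i) (Suc i) (\<lambda>(a, c). l (\<xi> a) (v c))"
  have "(\<Sum>\<xi>\<in>?X. det (?M v (\<xi>(i := j))) ^ m) = 0" if j: "j < n" for j
  proof (cases "\<forall>c<Suc i. l j (v c) = 0")
    case True
    have "det (?M v (\<xi>(i := j))) = 0" for \<xi>
      by (subst laplace_expansion_row[where i=i]) (use True in auto)
    then show ?thesis using m_pos by simp
  next
    case False
    then obtain c0 where c0: "c0 < Suc i" "l j (v c0) \<noteq> 0" by blast
    let ?y = "\<lambda>c. l j (v c) / l j (v c0)"
    \<comment> \<open>The vectors \<open>u c\<close> with \<open>c \<noteq> c0\<close> are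
      annihilated by \<open>l j\<close>; \<open>w\<close> lists them without a gap, and
      \<open>C\<close> undoes the column operations.\<close>
    define u where "u = (\<lambda>c. if c = c0 then v c0 else v c + s (- ?y c) (v c0))"
    define w where "w = (\<lambda>c. u (if c < c0 then c else Suc c))"
    define C where "C = mat (Suc i) (Suc i) (\<lambda>(k, c). if k = c then 1 else if k = c0 then ?y c else 0)"
    have C: "C \<in> carrier_mat (Suc i) (Suc i)" by (simp add: C_def)
    have u: "u c \<in> E" if "c < Suc i" for c
      using that v c0 by (auto simp: u_def intro: subspace_diff[OF W] W_scale)
    have w: "w c \<in> E" if "c < i" for c
      using that u by (simp add: w_def)
    have lu: "l k (u c) = (if c = c0 then l k (v c0) else l k (v c) - ?y c * l k (v c0))"
      if "k < n" "c < Suc i" for k c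
    proof -
      have "l k (v c + s (- ?y c) (v c0)) = l k (v c) + - ?y c * l k (v c0)"
        unfolding linear_onD(1)[OF l[OF that(1)] v[OF that(2)] W_scale[OF v[OF c0(1)]]]
          linear_onD(2)[OF l[OF that(1)] v[OF c0(1)]] ..
      then show ?thesis by (simp only: u_def) simp
    qed
    \<comment> \<open>The first factor depends on \<open>j\<close> but not on \<open>\<xi>\<close>,
      so the sum over \<open>\<xi>\<close> is a multiple of \<open>Pinv i w q\<close>.\<close>
    have *: "det (?M v (\<xi>(i := j))) ^ m =
      (det C * (l j (v c0) * (- 1) ^ (i + c0))) ^ m * det (mat i i (\<lambda>(a, c). l (\<xi> a) (w c))) ^ m"
      if xi: "\<xi> \<in> ?X" for \<xi>
    proof -
      let ?\<xi> = "\<xi>(i := j)"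
      have xin: "?\<xi> a < n" if "a < Suc i" for a using xi j that by (auto simp: PiE_iff)
      have "?M v ?\<xi> = ?M u ?\<xi> * C"
      proof (rule eq_matI)
        fix a c assume "a < dim_row (?M u ?\<xi> * C)" "c < dim_col (?M u ?\<xi> * C)"
        then have ac: "a < Suc i" "c < Suc i" by (auto simp: C_def)
        have "(?M u ?\<xi> * C) $$ (a, c) = (\<Sum>k<Suc i. ?M u ?\<xi> $$ (a, k) * C $$ (k, c))"
          by (rule mat_mult_entry[OF _ C ac]) simp
        also have "\<dots> = (\<Sum>k<Suc i. (if k = c then l (?\<xi> a) (u c) else 0) +
            (if k = c0 then (if c = c0 then 0 else l (?\<xi> a) (u c0) * ?y c) else 0))"
          using ac by (intro sum.cong) (auto simp: C_def)
        also have "\<dots> = l (?\<xi> a) (u c) + (if c = c0 then 0 else l (?\<xi> a) (u c0) * ?y c)"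
          using ac c0 by (simp only: sum.distrib sum.delta finite_lessThan lessThan_iff if_True)
        also have "\<dots> = l (?\<xi> a) (v c)"
          using lu[OF xin[OF ac(1)] ac(2)] lu[OF xin[OF ac(1)] c0(1)] by (simp del: fun_upd_apply)
        finally show "?M v ?\<xi> $$ (a, c) = (?M u ?\<xi> * C) $$ (a, c)" using ac by simp
      qed (auto simp: C_def)
      then have "det (?M v ?\<xi>) = det (?M u ?\<xi>) * det C"
        using det_mult[OF _ C] by simp
      moreover have "det (?M u ?\<xi>) = l j (v c0) * ((- 1) ^ (i + c0) * det (mat i i (\<lambda>(a, c). l (\<xi> a) (w c))))"
      proof -
        have "det (?M u ?\<xi>) = (\<Sum>c<Suc i. ?M u ?\<xi> $$ (i, c) * cofactor (?M u ?\<xi>) i c)"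
          by (rule laplace_expansion_row) auto
        also have "\<dots> = (\<Sum>c<Suc i. if c = c0 then l j (v c0) * cofactor (?M u ?\<xi>) i c0 else 0)"
          using c0 by (intro sum.cong) (auto simp: lu j)
        also have "\<dots> = l j (v c0) * cofactor (?M u ?\<xi>) i c0" using c0 by (simp del: sum.lessThan_Suc)
        also have "mat_delete (?M u ?\<xi>) i c0 = mat i i (\<lambda>(a, c). l (\<xi> a) (w c))"
          by (rule eq_matI) (auto simp: mat_delete_def w_def)
        then have "cofactor (?M u ?\<xi>) i c0 = (- 1) ^ (i + c0) * det (mat i i (\<lambda>(a, c). l (\<xi> a) (w c)))"
          by (simp add: cofactor_def)
        finally show ?thesis .
      qed
      ultimately show ?thesis by (simp add: power_mult_distrib mult_ac)
    qed
    have "(\<Sum>\<xi>\<in>?X. det (?M v (\<xi>(i := j))) ^ m) = (det C * (l j (v c0) * (- 1) ^ (i + c0))) ^ m * Pinv i w q"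
      unfolding q_eq by (subst Pinv_powers[OF l w]) (simp_all add: * sum_distrib_left del: fun_upd_apply)
    then show ?thesis using zero[OF w] by simp
  qed
  then have "(\<Sum>j<n. \<Sum>\<xi>\<in>?X. det (?M v (\<xi>(i := j))) ^ m) = 0" by (intro sum.neutral) auto
  then have "(\<Sum>\<xi>\<in>insert i {0..<i} \<rightarrow>\<^sub>E {..<n}. det (?M v \<xi>) ^ m) = 0"
    by (subst sum_PiE_insert) auto
  moreover have "insert i {0..<i} = {0..<Suc i}" by auto
  ultimately show ?thesis unfolding q_eq by (subst Pinv_powers[OF l v]) auto
qed

text \<open>By contraposition of the descent, nonvanishing passes from \<open>n\<close> vectors to
  some \<open>i\<close> vectors; a matrix moves the first \<open>i\<close> basis vectors to
  these.\<close>

lemma Pinv_nonzero: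
  assumes q: "q \<in> Q" and "i \<le> n" "n \<le> N" and v: "\<And>c. c < n \<Longrightarrow> v c \<in> E" "Pinv n v q \<noteq> 0"
  shows "\<exists>A\<in>carrier_mat N N. det A \<noteq> 0 \<and> Pinv i b (act A q) \<noteq> 0"
proof -
  have "\<exists>v. (\<forall>c<i. v c \<in> E) \<and> Pinv i v q \<noteq> 0"
    using assms(2)
  proof (induction rule: inc_induct)
    case base
    then show ?case using v by blast
  next
    case (step i)
    then show ?case using Pinv_descent[OF q, of i] by blast
  qed
  then obtain v where v: "\<And>c. c < i \<Longrightarrow> v c \<in> E" "Pinv i v q \<noteq> 0" by blast
  have iN: "i \<le> N" using assms by simp
  \<comment> \<open>The remaining columns are zero, so this matrix may be singular; density supplies
    an invertible one at the end.\<close>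
  define A where "A = mat N N (\<lambda>(k, c). coord k (if c < i then v c else 0))"
  have A: "A \<in> carrier_mat N N" by (simp add: A_def)
  have "T A (b c) = v c" if "c < i" for c
    using that iN coord_sum[OF v(1)[OF that]] by (simp add: T_b A_def)
  then have "Pinv i (\<lambda>c. T A (b c)) q = Pinv i v q"
  proof -
    assume *: "\<And>c. c < i \<Longrightarrow> T A (b c) = v c"
    have "polarization q (\<lambda>r. T A (b (\<sigma> r a))) = polarization q (\<lambda>r. v (\<sigma> r a))"
      if "\<sigma> \<in> {..<m} \<rightarrow>\<^sub>E {\<pi>. \<pi> permutes {0..<i}}" "a < i" for \<sigma> a
    proof -
      have "\<sigma> r a < i" if "r < m" for r
        using \<open>\<sigma> \<in> _\<close> \<open>a < i\<close> that permutes_in_image[of "\<sigma> r" "{0..<i}" a] by (auto simp: PiE_iff)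
      then have "(\<Sum>r\<in>U. T A (b (\<sigma> r a))) = (\<Sum>r\<in>U. v (\<sigma> r a))" if "U \<in> Pow {..<m}" for U
        using that * by (intro sum.cong) auto
      then show ?thesis by (simp add: polarization_def)
    qed
    then show ?thesis by (auto simp: Pinv_def intro!: sum.cong)
  qed
  then have "Pinv i b (act A q) \<noteq> 0"
    using Pinv_act[OF q, of i b A] b_in iN v(2) by simp
  then show ?thesis
    using act_density[OF Q.hom_poly_polynomial[OF Pinv_hom] q A, of i b] by blast
qed

end

section \<open>Irreducible submodules\<close>

text \<open>Induction on the degree: \<open>\<phi> (2 t) - 2 ^ D \<phi> t\<close> has degree less than \<open>D\<close> in \<open>t\<close>, and its value
  at \<open>0\<close> is a multiple of \<open>\<phi> 0\<close>.\<close>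

lemma subspace_limit:
  assumes "fs.subspace U" "\<And>t. t \<noteq> 0 \<Longrightarrow> \<phi> t \<in> U"
    and "\<And>q. \<exists>p. degree p \<le> D \<and> (\<forall>t. \<phi> t q = poly p t)"
  shows "\<phi> (0::complex) \<in> U"
  using assms(2,3)
proof (induction D arbitrary: \<phi>)
  case 0
  have "\<phi> 0 = \<phi> 1"
  proof
    fix q
    obtain p where "degree p \<le> 0" "\<forall>t. \<phi> t q = poly p t" using 0(2) by blast
    then show "\<phi> 0 q = \<phi> 1 q" by (auto elim: degree_eq_zeroE)
  qed
  then show ?case using 0(1)[of 1] by simp
next
  case (Suc D)
  let ?c = "2 ^ Suc D :: complex"
  define \<psi> where "\<psi> = (\<lambda>t. \<phi> (2 * t) - fscale ?c (\<phi> t))"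
  have "\<psi> 0 \<in> U"
  proof (rule Suc.IH)
    show "\<psi> t \<in> U" if "t \<noteq> 0" for t
      unfolding \<psi>_def using that
      by (intro fs.subspace_diff[OF assms(1)] fs.subspace_scale[OF assms(1)] Suc.prems) auto
    fix q
    obtain p where p: "degree p \<le> Suc D" "\<And>t. \<phi> t q = poly p t" using Suc.prems(2) by blast
    let ?p = "pcompose p [:0, 2:] - smult ?c p"
    have "coeff ?p n = 0" if "n > D" for n
      using that p(1) by (cases "n = Suc D") (auto simp: coeff_pcompose_linear coeff_eq_0)
    then have "degree ?p \<le> D" by (intro degree_le) auto
    moreover have "\<psi> t q = poly ?p t" for t
      by (simp add: \<psi>_def fun_apply p(2) poly_pcompose mult.commute)
    ultimately show "\<exists>p. degree p \<le> D \<and> (\<forall>t. \<psi> t q = poly p t)" by blast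
  qed
  then have "fscale (1 / (1 - ?c)) (\<psi> 0) \<in> U" by (rule fs.subspace_scale[OF assms(1)])
  moreover have "?c \<noteq> 1"
  proof
    assume "?c = 1"
    then have "cmod ?c = 1" by simp
    then have "(2::real) ^ Suc D = 1" by (simp add: norm_power norm_mult)
    then show False using one_less_power[of "2::real" "Suc D"] by simp
  qed
  then have "1 / (1 - ?c) * (1 - ?c) = 1" by simp
  then have "fscale (1 / (1 - ?c)) (fscale (1 - ?c) (\<phi> 0)) = \<phi> 0"
    by (simp only: fs.scale_scale fs.scale_one)
  moreover have "\<psi> 0 = fscale (1 - ?c) (\<phi> 0)"
    by (simp add: \<psi>_def fs.scale_left_diff_distrib)
  ultimately show ?case by (simp only:)
qed

context cspace
begin

text \<open>The degree bound is the same for all base points and directions, as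
  \<open>subspace_limit\<close> requires one bound for all arguments \<open>q\<close>.\<close>

lemma hom_poly_line:
  assumes "f \<in> hom_poly s W k" "a \<in> W" "x \<in> W"
  shows "\<exists>p. degree p \<le> k \<and> (\<forall>t. f (a + s t x) = poly p t)"
  using hom_poly_sub_span[THEN subsetD, OF assms(1)]
proof (induction rule: fs.span_induct_alt)
  case base
  show ?case by (rule exI[of _ 0]) (simp add: fun_apply)
next
  case (step c f g)
  then obtain l where l: "f = (\<lambda>x. if x \<in> W then l x ^ k else 0)" "linear_on s (*) W l"
    unfolding power_forms_def by blast
  obtain p where p: "degree p \<le> k" "\<And>t. g (a + s t x) = poly p t" using step by blast
  let ?p = "smult c ([:l a, l x:] ^ k) + p"
  have "degree ([:l a, l x:] ^ k) \<le> k"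
    using degree_power_le[of "[:l a, l x:]" k] degree_pCons_le[of "l a" "[:l x:]"]
    by (metis (no_types, lifting) degree_pCons_0 le_trans mult_le_mono1 One_nat_def mult_1)
  then have "degree ?p \<le> k"
    using p(1) by (intro degree_add_le order.trans[OF degree_smult_le]) auto
  moreover have "(fscale c f + g) (a + s t x) = poly ?p t" for t
    using assms by (simp add: fun_apply p(2) l(1) W_add W_scale linear_onD[OF l(2)])
  ultimately show ?case by blast
qed

end

context form_space
begin

abbreviation rho :: "('a \<Rightarrow> complex) set \<Rightarrow> ('a \<Rightarrow> 'a) \<Rightarrow> (('a \<Rightarrow> complex) \<Rightarrow> complex) \<Rightarrow> ('a \<Rightarrow> complex) \<Rightarrow> complex" where
  "rho Y g F \<equiv> translate Y (translate E g) F"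

abbreviation wt :: "nat \<Rightarrow> nat \<Rightarrow> nat \<Rightarrow> nat" where
  "wt d i \<equiv> \<lambda>j. d * fundamental_weight i j"

definition restr :: "('a \<Rightarrow> complex) set \<Rightarrow> (('a \<Rightarrow> complex) \<Rightarrow> complex) \<Rightarrow> ('a \<Rightarrow> complex) \<Rightarrow> complex" where
  "restr Y F = (\<lambda>q. if q \<in> Y then F q else 0)"

lemma restr_linear: "restr Y (F + G) = restr Y F + restr Y G" "restr Y (fscale c F) = fscale c (restr Y F)" "restr Y 0 = 0"
  by (auto simp: restr_def fun_eq_iff fun_apply)

lemma rho_eq: "stable Y \<Longrightarrow> g \<in> GL s E \<Longrightarrow> rho Y g F = restr Y (\<lambda>q. F (act (mat_of g) q))"
  unfolding restr_def by (rule translate_translate)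

lemma rho_T: "stable Y \<Longrightarrow> A \<in> carrier_mat N N \<Longrightarrow> det A \<noteq> 0 \<Longrightarrow> rho Y (T A) F = restr Y (\<lambda>q. F (act A q))"
  by (simp add: rho_eq T_GL mat_of_T)

lemma rho_restr:
  assumes "stable Y" "g \<in> GL s E"
  shows "rho Y g (restr Y F) = restr Y (rho Q g F)"
proof -
  have "act (mat_of g) q \<in> Y" "q \<in> Q" if "q \<in> Y" for q
    using that assms(1) mat_of_carrier by (auto simp: stable_def)
  then show ?thesis
    by (auto simp: rho_eq[OF assms] rho_eq[OF stable_Q assms(2)] restr_def fun_eq_iff)
qed

lemma rho_linear:
  assumes "stable Y" "g \<in> GL s E"
  shows "rho Y g (F + G) = rho Y g F + rho Y g G" "rho Y g (fscale c F) = fscale c (rho Y g F)"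
    "rho Y g 0 = 0"
  by (auto simp: rho_eq[OF assms] restr_def fun_eq_iff fun_apply)

lemma coordinate_ring_restr:
  "v \<in> coordinate_ring fscale Q Y \<longleftrightarrow> (\<exists>F. polynomial_on fscale Q F \<and> v = restr Y F)"
  by (auto simp: coordinate_ring_def restr_def)

lemma highest_weight_highest_on:
  assumes "stable Y" "i \<le> N" "highest_weight_vector s E N e (rho Y) (wt d i) (restr Y F)"
  shows "highest_on Y i d F"
  unfolding highest_on_def
proof (intro ballI impI)
  fix A :: "complex mat" and q assume A: "A \<in> carrier_mat N N" "\<forall>j k. j < k \<longrightarrow> k < N \<longrightarrow> A $$ (k, j) = 0"
    "\<forall>j<N. A $$ (j, j) \<noteq> 0" and q: "q \<in> Y"
  have g: "T A \<in> borel s E N e" "weight_char s N e (wt d i) (T A) = (\<Prod>j<i. A $$ (j, j) ^ d)"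
    using T_borel[OF A(1)] A assms(2) by auto
  then have "rho Y (T A) (restr Y F) = fscale (\<Prod>j<i. A $$ (j, j) ^ d) (restr Y F)"
    using assms(3) by (simp add: highest_weight_vector_def)
  then have "rho Y (T A) (restr Y F) q = (\<Prod>j<i. A $$ (j, j) ^ d) * F q"
    using q by (simp add: fun_apply restr_def)
  moreover have "rho Y (T A) (restr Y F) q = F (act A q)"
    using q A(1) assms(1) g(1) by (simp add: rho_eq borel_mat(1) mat_of_T restr_def stable_def)
  ultimately show "F (act A q) = (\<Prod>j<i. A $$ (j, j) ^ d) * F q" by simp
qed

lemma Pinv_highest_weight:
  assumes "stable Y" "i \<le> N" "restr Y (Pinv i b) \<noteq> 0"
  shows "highest_weight_vector s E N e (rho Y) (wt m i) (restr Y (Pinv i b))"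
  unfolding highest_weight_vector_def
proof (intro conjI ballI assms(3))
  fix g assume g: "g \<in> borel s E N e"
  let ?A = "mat_of g"
  have A: "?A \<in> carrier_mat N N" by (rule mat_of_carrier)
  have "det (mat i i (\<lambda>y. ?A $$ y)) = prod_list (diag_mat (mat i i (\<lambda>y. ?A $$ y)))"
    using borel_mat(2)[OF g] assms(2) by (intro det_upper_triangular) auto
  also have "\<dots> = (\<Prod>j<i. ?A $$ (j, j))"
    by (simp add: diag_mat_def prod.distinct_set_conv_list[symmetric] lessThan_atLeast0)
  finally have det: "det (mat i i (\<lambda>y. ?A $$ y)) ^ m = weight_char s N e (wt m i) g"
    using borel_mat(3)[OF g assms(2)] by (simp add: prod_power_distrib)
  have "Pinv i b (act ?A q) = weight_char s N e (wt m i) g * Pinv i b q" "act ?A q \<in> Y" if "q \<in> Y" for q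
    using that assms(1,2) A borel_mat(2)[OF g]
    by (auto simp: stable_def det[symmetric] subset_iff intro!: Pinv_block)
  then show "rho Y g (restr Y (Pinv i b)) = fscale (weight_char s N e (wt m i) g) (restr Y (Pinv i b))"
    unfolding rho_eq[OF assms(1) borel_mat(1)[OF g]] by (auto simp: restr_def fun_eq_iff fun_apply)
qed

section \<open>The cyclic module generated by the invariant\<close>

definition orb :: "nat \<Rightarrow> complex mat \<Rightarrow> ('a \<Rightarrow> complex) \<Rightarrow> complex" where
  "orb i A = restr Q (\<lambda>q. Pinv i b (act A q))"

definition V :: "nat \<Rightarrow> (('a \<Rightarrow> complex) \<Rightarrow> complex) set" where
  "V i = fs.span {orb i A | A. A \<in> carrier_mat N N \<and> det A \<noteq> 0}"

lemma orb_eq_rho: "A \<in> carrier_mat N N \<Longrightarrow> det A \<noteq> 0 \<Longrightarrow> orb i A = rho Q (T A) (Pinv i b)"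
  by (simp add: orb_def rho_T stable_Q)

lemma orb_one: "orb i (1\<^sub>m N) = Pinv i b"
  using Q.hom_poly_outside[OF Pinv_hom] by (auto simp: orb_def restr_def act_one fun_eq_iff)

lemma Pinv_in_V: "Pinv i b \<in> V i"
proof -
  have "orb i (1\<^sub>m N) \<in> V i"
    unfolding V_def by (intro fs.span_base CollectI exI[of _ "1\<^sub>m N"] conjI refl) auto
  then show ?thesis by (simp only: orb_one)
qed

lemma V_hom: "V i \<subseteq> hom_poly fscale Q i"
  unfolding V_def
proof (rule fs.span_minimal[OF _ Q.subspace_hom_poly], safe)
  fix A :: "complex mat"
  show "orb i A \<in> hom_poly fscale Q i"
  proof (rule Q.hom_polyI)
    show "polynomial_on fscale Q (orb i A)"
      by (rule polynomial_on_cong[OF polynomial_on_act[OF Q.hom_poly_polynomial[OF Pinv_hom[of i b]], of A]])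
        (auto simp: orb_def restr_def Q.W_add Q.W_scale)
  qed (auto simp: orb_def restr_def act_scale Q.W_scale act_in Q.hom_poly_homogeneous[OF Pinv_hom])
qed

lemma V_submodule: "Defs.submodule (GL s E) (rho Q) (V i)"
  unfolding Defs.submodule_def
proof (intro conjI ballI)
  show "fs.subspace (V i)" by (simp only: V_def fs.subspace_span)
  fix g f assume g: "g \<in> GL s E" and "f \<in> V i"
  from \<open>f \<in> V i\<close> show "rho Q g f \<in> V i"
    unfolding V_def
  proof (induction rule: fs.span_induct_alt)
    case base
    show ?case by (simp only: rho_linear[OF stable_Q g] fs.span_zero)
  next
    case (step c f h)
    then obtain A where A: "f = orb i A" "A \<in> carrier_mat N N" "det A \<noteq> 0" by blast
    have "rho Q g f = orb i (mat_of g * A)"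
      by (auto simp: rho_eq[OF stable_Q g] orb_def restr_def A(1) act_in act_mult[OF mat_of_carrier A(2)] fun_eq_iff)
    moreover have "mat_of g * A \<in> carrier_mat N N" "det (mat_of g * A) \<noteq> 0"
      using A GL_mat(2)[OF g] by (auto simp: det_mult[OF mat_of_carrier A(2)] intro!: mult_carrier_mat[OF mat_of_carrier])
    ultimately have "rho Q g f \<in> fs.span {orb i A | A. A \<in> carrier_mat N N \<and> det A \<noteq> 0}"
      by (intro fs.span_base) blast
    then show ?case
      using step unfolding rho_linear[OF stable_Q g] by (intro fs.span_add fs.span_scale)
  qed
qed

lemma V_sub_submodule:
  assumes "stable Y" "Defs.submodule (GL s E) (rho Y) M" "restr Y (Pinv i b) \<in> M" "f \<in> V i"
  shows "restr Y f \<in> M"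
proof -
  have M: "fs.subspace M" "\<And>g v. g \<in> GL s E \<Longrightarrow> v \<in> M \<Longrightarrow> rho Y g v \<in> M"
    using assms(2) unfolding Defs.submodule_def by blast+
  show ?thesis
    using assms(4) unfolding V_def
  proof (induction rule: fs.span_induct_alt)
    case base
    show ?case by (simp only: restr_linear fs.subspace_0[OF M(1)])
  next
    case (step c f h)
    then obtain A where A: "f = orb i A" "A \<in> carrier_mat N N" "det A \<noteq> 0" by blast
    have "rho Y (T A) (restr Y (Pinv i b)) \<in> M" by (rule M(2)[OF T_GL[OF A(2,3)] assms(3)])
    then have "restr Y f \<in> M"
      by (simp only: A(1) rho_restr[OF assms(1) T_GL[OF A(2,3)]] orb_eq_rho[OF A(2,3)])
    then show ?case using step(2)
      unfolding restr_linear by (intro fs.subspace_add[OF M(1)] fs.subspace_scale[OF M(1)])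
  qed
qed

lemma restr_Q: "f \<in> hom_poly fscale Q k \<Longrightarrow> restr Q f = f"
  using Q.hom_poly_outside by (auto simp: restr_def fun_eq_iff)

lemma emb_idf_carrier_mult: "A \<in> carrier_mat N N \<Longrightarrow> i \<le> k \<Longrightarrow> k < N \<Longrightarrow> j < N \<Longrightarrow> (emb i idf * A) $$ (k, j) = 0"
  by (subst mat_mult_entry[of _ N]) (auto simp: emb_def)

text \<open>Projection sends the whole module to the highest weight line:
  \<open>emb i idf * A\<close> has zero rows from \<open>i\<close> on, so each projected translate
  is a multiple of the invariant.\<close>

lemma V_proj:
  assumes i: "i \<le> N" and "f \<in> V i"
  shows "\<exists>c. \<forall>q\<in>Q. f (act (emb i idf) q) = c * Pinv i b q"
  using assms(2) unfolding V_def
proof (induction rule: fs.span_induct_alt)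
  case base
  show ?case by (rule exI[of _ 0]) (simp add: fun_apply)
next
  case (step a f h)
  then obtain A c where A: "f = orb i A" "A \<in> carrier_mat N N"
    and c: "\<And>q. q \<in> Q \<Longrightarrow> h (act (emb i idf) q) = c * Pinv i b q" by blast
  have "f (act (emb i idf) q) = det (mat i i (\<lambda>y. (emb i idf * A) $$ y)) ^ m * Pinv i b q" if q: "q \<in> Q" for q
  proof -
    have "f (act (emb i idf) q) = Pinv i b (act (emb i idf * A) q)"
      using q by (simp add: A(1) orb_def restr_def act_in act_mult[OF emb_carrier A(2)])
    also have "\<dots> = det (mat i i (\<lambda>y. (emb i idf * A) $$ y)) ^ m * Pinv i b q"
      using A(2) i by (intro Pinv_block[OF q i] mult_carrier_mat[OF emb_carrier] emb_idf_carrier_mult) auto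
    finally show ?thesis .
  qed
  then show ?case
    using c by (intro exI[of _ "a * det (mat i i (\<lambda>y. (emb i idf * A) $$ y)) ^ m + c"])
      (simp add: fun_apply algebra_simps)
qed

text \<open>\<open>q0 i\<close> is unchanged by the projection, which is inserted so that a sum of
  \<open>i\<close> powers is a substitution, possibly singular, into a projected form.\<close>

lemma powers_eq_act:
  assumes "i \<le> N" "\<And>j. j < i \<Longrightarrow> linear_on s (*) E (l j)"
  shows "(\<Sum>j<i. pw (l j)) = act (mat N N (\<lambda>(j, c). if j < i then l j (b c) else 0)) (act (emb i idf) (q0 i))"
proof -
  have "pw (l j) = pw (\<lambda>x. coord j (T (emb i idf) (T (mat N N (\<lambda>(j, c). if j < i then l j (b c) else 0)) x)))"
    if j: "j < i" for j
  proof -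
    have "l j x = coord j (T (emb i idf) (T (mat N N (\<lambda>(j, c). if j < i then l j (b c) else 0)) x))"
      if "x \<in> E" for x
    proof -
      let ?y = "T (mat N N (\<lambda>(j, c). if j < i then l j (b c) else 0)) x"
      have "coord j (T (emb i idf) ?y) = (\<Sum>k<i. if k = j then coord k ?y else 0)"
        unfolding coord_T_emb[OF assms(1) j] by (intro sum.cong) (auto simp: idf_def)
      also have "\<dots> = coord j ?y" using j by simp
      also have "\<dots> = l j x"
        using j assms(1) by (simp add: coord_T linear_expand[OF assms(2)[OF j] that] mult.commute)
      finally show ?thesis by simp
    qed
    then show ?thesis by (auto simp: pw_def fun_eq_iff)
  qed
  then show ?thesis by (simp add: q0_def act_sum act_pw)
qed

text \<open>Some translate \<open>f1\<close> of \<open>f\<close> is nonzero at a projected form;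
  otherwise density would make \<open>f\<close> vanish on all sums of \<open>i\<close> powers. The
  projection of \<open>f1\<close> lies in \<open>M\<close> as a limit of torus translates, and it is
  a nonzero multiple of the invariant.\<close>

lemma V_irreducible_aux:
  assumes i: "i \<le> N" and M: "Defs.submodule (GL s E) (rho Q) M" "M \<subseteq> V i" "f \<in> M" "f \<noteq> 0"
  shows "Pinv i b \<in> M"
proof -
  have subM: "fs.subspace M" and rhoM: "\<And>g v. g \<in> GL s E \<Longrightarrow> v \<in> M \<Longrightarrow> rho Q g v \<in> M"
    using M(1) unfolding Defs.submodule_def by blast+
  have homM: "h \<in> hom_poly fscale Q i" if "h \<in> M" for h using that M(2) V_hom by blast
  note polyf = Q.hom_poly_polynomial[OF homM[OF M(3)]]
  obtain G q1 where G: "G \<in> carrier_mat N N" "det G \<noteq> 0" "q1 \<in> Q" "f (act G (act (emb i idf) q1)) \<noteq> 0"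
  proof (rule ccontr)
    assume "\<not> thesis"
    with that have zero: "f (act G (act (emb i idf) q)) = 0"
      if "G \<in> carrier_mat N N" "det G \<noteq> 0" "q \<in> Q" for G q using that by blast
    have "f = 0"
    proof (rule hom_poly_zero_on_few_powers[OF homM[OF M(3)]])
      fix l :: "nat \<Rightarrow> 'a \<Rightarrow> complex" assume l: "\<And>a. linear_on s (*) E (l a)"
      show "f (\<Sum>a<i. pw (l a)) = 0"
        unfolding powers_eq_act[OF i l]
        by (rule act_density[OF polyf act_in[OF q0_in]]) (auto intro: zero q0_in)
    qed
    then show False using M(4) by simp
  qed
  define f1 where "f1 = rho Q (T G) f"
  have f1M: "f1 \<in> M" unfolding f1_def by (rule rhoM[OF T_GL[OF G(1,2)] M(3)])
  have f1: "f1 q = f (act G q)" if "q \<in> Q" for q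
    using that by (simp add: f1_def rho_T[OF stable_Q G(1,2)] restr_def)
  define \<phi> where "\<phi> = (\<lambda>t. restr Q (\<lambda>q. f1 (act (emb i idf + t \<cdot>\<^sub>m proj_compl i) q)))"
  have "\<phi> 0 \<in> M"
  \<comment> \<open>The degree in the matrix entries is at most \<open>m * i\<close>, uniformly in
    \<open>q\<close>; this keeps the value at \<open>t = 0\<close> inside the subspace
    \<open>M\<close>.\<close>
  proof (rule subspace_limit[OF subM, of \<phi> "m * i"])
    fix t :: complex assume t: "t \<noteq> 0"
    let ?A = "emb i idf + t \<cdot>\<^sub>m proj_compl i"
    have A: "?A \<in> carrier_mat N N" by simp
    have "det ?A = prod_list (diag_mat ?A)"
      by (rule det_upper_triangular[OF _ A]) (auto simp: emb_def proj_compl_def idf_def)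
    also have "\<dots> \<noteq> 0" using t by (auto simp: prod_list_zero_iff diag_mat_def emb_def proj_compl_def idf_def
        split: if_splits)
    finally show "\<phi> t \<in> M"
      using rhoM[OF T_GL[OF A] f1M] rho_T[OF stable_Q A] by (simp add: \<phi>_def)
  next
    fix q
    show "\<exists>p. degree p \<le> m * i \<and> (\<forall>t. \<phi> t q = poly p t)"
    proof (cases "q \<in> Q")
      case True
      have "mat N N ((\<lambda>y. emb i idf $$ y) + fscale t (\<lambda>y. proj_compl i $$ y)) = emb i idf + t \<cdot>\<^sub>m proj_compl i" for t
        by (rule eq_matI) (auto simp: fun_apply emb_def proj_compl_def)
      then show ?thesis
        using UN.hom_poly_line[OF hom_act[OF homM[OF f1M] True], of "\<lambda>y. emb i idf $$ y" "\<lambda>y. proj_compl i $$ y"] True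
        by (simp add: \<phi>_def restr_def)
    next
      case False
      then show ?thesis by (intro exI[of _ 0]) (simp add: \<phi>_def restr_def)
    qed
  qed
  moreover have "emb i idf + 0 \<cdot>\<^sub>m proj_compl i = emb i idf"
    by (rule eq_matI) (auto simp: emb_def proj_compl_def)
  then have phi0: "\<phi> 0 = restr Q (\<lambda>q. f1 (act (emb i idf) q))" by (simp add: \<phi>_def)
  obtain c where c: "\<And>q. q \<in> Q \<Longrightarrow> f1 (act (emb i idf) q) = c * Pinv i b q"
    using V_proj[OF i, of f1] f1M M(2) by blast
  have "c \<noteq> 0" using c[OF G(3)] G(4) f1[OF act_in[OF G(3)]] by auto
  have "Pinv i b = fscale (1 / c) (\<phi> 0)"
    unfolding phi0 using c \<open>c \<noteq> 0\<close> Q.hom_poly_outside[OF Pinv_hom] by (auto simp: restr_def fun_eq_iff fun_apply)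
  ultimately show ?thesis using fs.subspace_scale[OF subM] by metis
qed

lemma V_irreducible:
  assumes i: "i \<le> N" and P: "Pinv i b \<noteq> 0"
  shows "irreducible_submodule (GL s E) (rho Q) (V i)"
  unfolding irreducible_submodule_def
proof (intro conjI allI impI V_submodule)
  show "V i \<noteq> {0}" using Pinv_in_V P by blast
  fix M assume M: "Defs.submodule (GL s E) (rho Q) M" "M \<subseteq> V i"
  have "0 \<in> M" using M(1) fs.subspace_0 unfolding Defs.submodule_def by blast
  show "M = {0} \<or> M = V i"
  proof (cases "\<exists>f\<in>M. f \<noteq> 0")
    case True
    then have "Pinv i b \<in> M" using V_irreducible_aux[OF i M] by blast
    then have PM: "restr Q (Pinv i b) \<in> M" by (simp only: restr_Q[OF Pinv_hom])
    have "f \<in> M" if f: "f \<in> V i" for f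
      using V_sub_submodule[OF stable_Q M(1) PM f] by (simp only: restr_Q[OF subsetD[OF V_hom f]])
    then show ?thesis using M(2) by blast
  next
    case False
    then show ?thesis using \<open>0 \<in> M\<close> by blast
  qed
qed

text \<open>Restriction is equivariant, so submodules of the image pull back to submodules of the
  irreducible \<open>V i\<close>; the image is nonzero because it contains the restricted
  invariant.\<close>

lemma restr_V_irreducible:
  assumes Y: "stable Y" and i: "i \<le> N" and P: "restr Y (Pinv i b) \<noteq> 0"
  shows "irreducible_submodule (GL s E) (rho Y) (restr Y ` V i)"
  unfolding irreducible_submodule_def
proof (intro conjI allI impI)
  have Pnz: "Pinv i b \<noteq> 0" using P restr_linear(3) by metis
  have subV: "fs.subspace (V i)" and rhoV: "\<And>g v. g \<in> GL s E \<Longrightarrow> v \<in> V i \<Longrightarrow> rho Q g v \<in> V i"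
    using V_submodule[of i] unfolding Defs.submodule_def by blast+
  show "Defs.submodule (GL s E) (rho Y) (restr Y ` V i)"
    unfolding Defs.submodule_def
  proof (intro conjI ballI)
    show "fs.subspace (restr Y ` V i)"
      unfolding fs.subspace_def
    proof (intro conjI ballI allI)
      show "0 \<in> restr Y ` V i" using fs.subspace_0[OF subV] restr_linear(3) by (metis imageI)
      show "x + y \<in> restr Y ` V i" if "x \<in> restr Y ` V i" "y \<in> restr Y ` V i" for x y
        using that fs.subspace_add[OF subV] restr_linear(1)[symmetric] by (auto intro!: imageI)
      show "fscale c x \<in> restr Y ` V i" if "x \<in> restr Y ` V i" for c x
        using that fs.subspace_scale[OF subV] restr_linear(2)[symmetric] by (auto intro!: imageI)
    qed
    show "rho Y g v \<in> restr Y ` V i" if "g \<in> GL s E" "v \<in> restr Y ` V i" for g v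
      using that rhoV rho_restr[OF Y] by auto
  qed
  show "restr Y ` V i \<noteq> {0}" using Pinv_in_V P by blast
  fix M assume M: "Defs.submodule (GL s E) (rho Y) M" "M \<subseteq> restr Y ` V i"
  have subM: "fs.subspace M" and rhoM: "\<And>g v. g \<in> GL s E \<Longrightarrow> v \<in> M \<Longrightarrow> rho Y g v \<in> M"
    using M(1) unfolding Defs.submodule_def by blast+
  let ?M = "{f \<in> V i. restr Y f \<in> M}"
  have "Defs.submodule (GL s E) (rho Q) ?M"
    unfolding Defs.submodule_def
  proof (intro conjI ballI)
    show "fs.subspace ?M"
      unfolding fs.subspace_def
      using subV subM by (auto simp: restr_linear fs.subspace_0 fs.subspace_add fs.subspace_scale)
    show "rho Q g v \<in> ?M" if "g \<in> GL s E" "v \<in> ?M" for g v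
      using that rhoV rhoM rho_restr[OF Y] by fastforce
  qed
  then have "?M = {0} \<or> ?M = V i"
    using V_irreducible[OF i Pnz] unfolding irreducible_submodule_def by blast
  then show "M = {0} \<or> M = restr Y ` V i"
  proof
    assume M0: "?M = {0}"
    have "x = 0" if x: "x \<in> M" for x
    proof -
      obtain f where "f \<in> V i" "x = restr Y f" using M(2) x by blast
      then have "f \<in> ?M" using x by simp
      then have "f = 0" using M0 by blast
      then show ?thesis using \<open>x = restr Y f\<close> restr_linear(3) by simp
    qed
    then show ?thesis using fs.subspace_0[OF subM] by blast
  next
    assume "?M = V i"
    then show ?thesis using M(2) by blast
  qed
qed

text \<open>A highest weight vector of \<open>U\<close> is a nonzero multiple of the restricted
  invariant, so \<open>U\<close> contains the submodule \<open>restr Y\<close> \<open>V i\<close>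
  and equals it by irreducibility. \<open>M\<close> is kept variable to cover both the forms of
  degree \<open>i\<close> and full coordinate rings.\<close>

lemma irreducible_copy_iff:
  assumes Y: "stable Y" and i: "i \<le> N" and P: "restr Y (Pinv i b) \<noteq> 0"
    and M: "M \<subseteq> coordinate_ring fscale Q Y" "restr Y ` V i \<subseteq> M"
  shows "irreducible_copy s E N e (rho Y) (wt m i) M U \<longleftrightarrow> U = restr Y ` V i"
proof
  assume "U = restr Y ` V i"
  then show "irreducible_copy s E N e (rho Y) (wt m i) M U"
    unfolding irreducible_copy_def
    using M(2) restr_V_irreducible[OF Y i P] Pinv_highest_weight[OF Y i P] Pinv_in_V by blast
next
  assume U: "irreducible_copy s E N e (rho Y) (wt m i) M U"
  have Pnz: "Pinv i b \<noteq> 0" using P restr_linear(3) by metis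
  obtain v where v: "v \<in> U" "highest_weight_vector s E N e (rho Y) (wt m i) v"
    using U unfolding irreducible_copy_def by blast
  obtain F where F: "polynomial_on fscale Q F" "v = restr Y F"
    using v(1) U M(1) unfolding irreducible_copy_def coordinate_ring_restr[symmetric] by (meson subsetD coordinate_ring_restr)
  have "highest_on Y i m F" by (rule highest_weight_highest_on[OF Y i v(2)[unfolded F(2)]])
  then obtain c where c: "\<And>q. q \<in> Y \<Longrightarrow> F q = c * Pinv i b q"
    using highest_unique[OF Y i F(1) _ Pinv_hom Pinv_semi_invariant[OF i] Pnz] by blast
  then have vc: "v = fscale c (restr Y (Pinv i b))" unfolding F(2) by (auto simp: restr_def fun_eq_iff fun_apply)
  moreover have "v \<noteq> 0" using v(2) unfolding highest_weight_vector_def by blast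
  ultimately have "c \<noteq> 0" by auto
  have irr: "Defs.submodule (GL s E) (rho Y) U" "\<And>N'. Defs.submodule (GL s E) (rho Y) N' \<Longrightarrow> N' \<subseteq> U \<Longrightarrow> N' = {0} \<or> N' = U"
    using U unfolding irreducible_copy_def irreducible_submodule_def by blast+
  have "fscale (1 / c) v \<in> U"
    using irr(1) v(1) fs.subspace_scale unfolding Defs.submodule_def by blast
  then have "restr Y (Pinv i b) \<in> U" using vc \<open>c \<noteq> 0\<close> by simp
  then have "restr Y ` V i \<subseteq> U" using V_sub_submodule[OF Y irr(1)] by blast
  moreover have "Defs.submodule (GL s E) (rho Y) (restr Y ` V i)" "restr Y ` V i \<noteq> {0}"
    using restr_V_irreducible[OF Y i P] unfolding irreducible_submodule_def by blast+
  ultimately show "U = restr Y ` V i" using irr(2) by blast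
qed

lemma not_occurs:
  assumes Y: "stable Y" and "0 < i" "i \<le> N" "0 < d" "d < m"
  shows "\<not> occurs s E N e (rho Y) (wt d i) (coordinate_ring fscale Q Y)"
proof
  assume "occurs s E N e (rho Y) (wt d i) (coordinate_ring fscale Q Y)"
  then obtain v where v: "v \<in> coordinate_ring fscale Q Y" "highest_weight_vector s E N e (rho Y) (wt d i) v"
    unfolding occurs_def irreducible_copy_def by blast
  obtain F where F: "polynomial_on fscale Q F" "v = restr Y F"
    using v(1) coordinate_ring_restr by blast
  have "highest_on Y i d F" by (rule highest_weight_highest_on[OF Y assms(3) v(2)[unfolded F(2)]])
  then have "v = 0"
    using highest_zero[OF Y assms(2,3) F(1) _ assms(4,5)] by (auto simp: F(2) restr_def fun_eq_iff fun_apply)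
  then show False using v(2) unfolding highest_weight_vector_def by blast
qed

lemma restr_V_coordinate_ring: "restr Y ` V i \<subseteq> coordinate_ring fscale Q Y"
  using V_hom Q.hom_poly_polynomial coordinate_ring_restr by blast

lemma occurs_once:
  assumes Y: "stable Y" and i: "i \<le> N" and P: "restr Y (Pinv i b) \<noteq> 0"
  shows "occurs_with_multiplicity s E N e (rho Y) (wt m i) (coordinate_ring fscale Q Y) 1"
proof -
  have copies: "Collect (irreducible_copy s E N e (rho Y) (wt m i) (coordinate_ring fscale Q Y)) = {restr Y ` V i}"
    using irreducible_copy_iff[OF assms order_refl restr_V_coordinate_ring] by blast
  show ?thesis
    unfolding occurs_with_multiplicity_def copies by (intro exI[of _ "{restr Y ` V i}"]) simp
qed

section \<open>The orbit of a form and its closure\<close>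

lemma orbit_eq:
  "(\<lambda>g. translate E g q) ` GL s E = {act A q | A. A \<in> carrier_mat N N \<and> det A \<noteq> 0}"
proof (intro equalityI subsetI)
  fix r assume "r \<in> (\<lambda>g. translate E g q) ` GL s E"
  then obtain g where g: "g \<in> GL s E" "r = translate E g q" by blast
  obtain B where B: "B \<in> carrier_mat N N" "B * mat_of g = 1\<^sub>m N" "det B \<noteq> 0"
    using GL_inverse[OF mat_of_carrier GL_mat(2)[OF g(1)]] by blast
  then show "r \<in> {act A q | A. A \<in> carrier_mat N N \<and> det A \<noteq> 0}"
    using translate_eq[OF g(1) B(1,2)] g(2) by blast
next
  fix r assume "r \<in> {act A q | A. A \<in> carrier_mat N N \<and> det A \<noteq> 0}"
  then obtain A where A: "A \<in> carrier_mat N N" "det A \<noteq> 0" "r = act A q" by blast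
  obtain B where B: "B \<in> carrier_mat N N" "A * B = 1\<^sub>m N" "det B \<noteq> 0"
    using GL_inverse[OF A(1,2)] by blast
  have tr: "translate E (T B) q = act A q"
    by (rule translate_eq[OF T_GL[OF B(1,3)] A(1)]) (simp add: mat_of_T[OF B(1)] B(2))
  then show "r \<in> (\<lambda>g. translate E g q) ` GL s E" 
    unfolding A(3) tr[symmetric] by (intro imageI T_GL[OF B(1,3)])
qed

text \<open>An equation of the orbit composed with an invertible substitution is again an equation
  of the orbit, hence holds at \<open>r\<close>; density extends this from invertible matrices to
  \<open>A\<close>.\<close>

lemma stable_orbit_closure:
  assumes q: "q \<in> Q"
  shows "stable (zariski_closure fscale Q ((\<lambda>g. translate E g q) ` GL s E))" (is "stable ?X")
  unfolding stable_def
proof (intro conjI ballI)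
  show "?X \<subseteq> Q" by (auto simp: zariski_closure_def)
  fix A :: "complex mat" and r assume A: "A \<in> carrier_mat N N" and r: "r \<in> ?X"
  have rQ: "r \<in> Q" using r by (simp add: zariski_closure_def)
  have "f (act A r) = 0"
    if f: "polynomial_on fscale Q f" "\<And>y. y \<in> (\<lambda>g. translate E g q) ` GL s E \<Longrightarrow> f y = 0" for f
  proof (rule act_density[OF f(1) rQ A])
    fix G :: "complex mat" assume G: "G \<in> carrier_mat N N" "det G \<noteq> 0"
    have "f (act G y) = 0" if y: "y \<in> (\<lambda>g. translate E g q) ` GL s E" for y
    proof (rule f(2))
      obtain B where B: "B \<in> carrier_mat N N" "det B \<noteq> 0" "y = act B q"
        using y unfolding orbit_eq by blast
      then have "act G y = act (B * G) q" "B * G \<in> carrier_mat N N" "det (B * G) \<noteq> 0"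
        using G by (auto simp: act_mult det_mult[of _ N])
      then show "act G y \<in> (\<lambda>g. translate E g q) ` GL s E" unfolding orbit_eq by blast
    qed
    then show "f (act G r) = 0"
      using r polynomial_on_act[OF f(1), of G] unfolding zariski_closure_def by blast
  qed
  then show "act A r \<in> ?X" using act_in[OF rQ] unfolding zariski_closure_def by blast
qed

lemma orbit_subset_closure:
  assumes "q \<in> Q" "A \<in> carrier_mat N N" "det A \<noteq> 0"
  shows "act A q \<in> zariski_closure fscale Q ((\<lambda>g. translate E g q) ` GL s E)"
proof -
  have "act A q \<in> (\<lambda>g. translate E g q) ` GL s E" unfolding orbit_eq using assms by blast
  then show ?thesis using act_in[OF assms(1)] unfolding zariski_closure_def by blast
qed

end

section \<open>Latin squares and the determinant\<close>

lemma finite_latin_squares: "finite (latin_squares m)"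
proof (rule finite_subset)
  show "latin_squares m \<subseteq> {1..m} \<rightarrow>\<^sub>E ({1..m} \<rightarrow>\<^sub>E {1..m})" by (auto simp: latin_squares_def)
  show "finite ({1..m} \<rightarrow>\<^sub>E ({1..m} \<rightarrow>\<^sub>E {1..m} :: (nat \<Rightarrow> nat) set))" by (intro finite_PiE) auto
qed

lemma column_sign_cases:
  assumes "A \<in> latin_squares m" "q \<in> {1..m}"
  shows "column_sign m A q = 1 \<or> column_sign m A q = - 1"
proof -
  have "inj_on (\<lambda>p. A p q) {1..m}" using assms by (auto simp: latin_squares_def bij_betw_def)
  then have "(\<Prod>(p, p')\<in>index_pairs m. int (A p' q) - int (A p q)) \<noteq> 0"
  proof (subst prod_zero_iff[OF finite_index_pairs], safe)
    fix p p' assume "1 \<le> p" "p < p'" "p' \<le> m" "int (A p' q) - int (A p q) = 0"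
    then show False using inj_onD[OF \<open>inj_on _ _\<close>, of p p'] by simp
  qed
  then show ?thesis by (auto simp: column_sign_def sgn_if)
qed

lemma sum_column_signs:
  "(\<Sum>A\<in>latin_squares m. \<Prod>q=1..m. column_sign m A q) =
     int (card {A \<in> latin_squares m. column_even m A}) - int (card {A \<in> latin_squares m. \<not> column_even m A})"
proof -
  have "(\<Prod>q=1..m. column_sign m A q) = 1 \<or> (\<Prod>q=1..m. column_sign m A q) = - 1"
    if A: "A \<in> latin_squares m" for A
  proof -
    have "(\<Prod>q\<in>S. column_sign m A q) = 1 \<or> (\<Prod>q\<in>S. column_sign m A q) = - 1" if "finite S" "S \<subseteq> {1..m}" for S
      using that
    proof (induction S rule: finite_induct)
      case (insert q S)
      then show ?case using column_sign_cases[OF A, of q] by auto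
    qed simp
    then show ?thesis by blast
  qed
  then have "(\<Sum>A\<in>latin_squares m. \<Prod>q=1..m. column_sign m A q) =
    (\<Sum>A\<in>latin_squares m. (if column_even m A then 1 else 0) - (if \<not> column_even m A then 1 else 0))"
    by (intro sum.cong refl) (auto simp: column_even_def)
  moreover have "(\<Sum>A\<in>latin_squares m. if R A then 1 else 0) = int (card {A \<in> latin_squares m. R A})" for R
    using sum.inter_filter[OF finite_latin_squares, of "\<lambda>_. 1 :: int" m R] by simp
  ultimately show ?thesis by (simp only: sum_subtractf)
qed

text \<open>The tuples that contribute to the invariant of size \<open>m\<close> at the determinant.
  Columns are permutations by the choice of \<open>\<sigma>\<close>; the second condition is the one
  on rows.\<close>

definition latin_perms :: "nat \<Rightarrow> (nat \<Rightarrow> nat \<Rightarrow> nat) set" where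
  "latin_perms m = {\<sigma> \<in> {..<m} \<rightarrow>\<^sub>E {\<pi>. \<pi> permutes {0..<m}}. \<forall>a<m. bij_betw (\<lambda>r. \<sigma> r a) {..<m} {..<m}}"

text \<open>Column \<open>r + 1\<close> of the Latin square is the permutation \<open>\<sigma> r\<close>, shifted by one.\<close>

lemma latin_perms_sum:
  "(\<Sum>\<sigma>\<in>latin_perms m. \<Prod>r<m. sign (\<sigma> r)) = (\<Sum>A\<in>latin_squares m. \<Prod>q=1..m. column_sign m A q)"
proof -
  define f where "f = (\<lambda>\<sigma> :: nat \<Rightarrow> nat \<Rightarrow> nat. restrict (\<lambda>p. restrict (\<lambda>q. Suc (\<sigma> (q - 1) (p - 1))) {1..m}) {1..m})"
  \<comment> \<open>Outside the square a permutation is the identity, whereas the entries of a Latin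
    square are \<open>undefined\<close>; hence the case distinction on \<open>a\<close>.\<close>
  define g where "g = (\<lambda>A :: nat \<Rightarrow> nat \<Rightarrow> nat. restrict (\<lambda>r a. if a < m then A (Suc a) (Suc r) - 1 else a) {..<m})"
  have shift: "bij_betw Suc {..<m} {1..m}" "bij_betw (\<lambda>p. p - 1) {1..m} {..<m}"
    by (rule bij_betw_byWitness[where f'="\<lambda>p. p - 1"], auto)
      (rule bij_betw_byWitness[where f'=Suc], auto)
  have shift': "bij_betw (\<lambda>q. Suc (h (q - 1))) {1..m} {1..m}" if "bij_betw h {..<m} {..<m}" for h
    using bij_betw_trans[OF bij_betw_trans[OF shift(2) that] shift(1)] by (simp add: comp_def)
  have shift'': "bij_betw (\<lambda>r. h (Suc r) - 1) {..<m} {..<m}" if "bij_betw h {1..m} {1..m}" for h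
    using bij_betw_trans[OF bij_betw_trans[OF shift(1) that] shift(2)] by (simp add: comp_def)
  have sig: "\<sigma> r permutes {0..<m}" if "\<sigma> \<in> latin_perms m" "r < m" for \<sigma> r
    using that by (auto simp: latin_perms_def PiE_iff)
  show ?thesis
  proof (rule sum.reindex_bij_witness[where i=g and j=f])
    fix \<sigma> assume s: "\<sigma> \<in> latin_perms m"
    have lt: "\<sigma> r a < m" if "r < m" "a < m" for r a
      using permutes_in_image[OF sig[OF s that(1)], of a] that(2) by simp
    show "g (f \<sigma>) = \<sigma>"
    proof (intro ext)
      fix r a
      show "g (f \<sigma>) r a = \<sigma> r a"
      proof (cases "r < m")
        case True
        then show ?thesis using sig[OF s True] by (auto simp: g_def f_def permutes_def)
      next
        case False
        then have "\<sigma> r = undefined" using s by (auto simp: latin_perms_def PiE_def extensional_def)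
        then show ?thesis using False by (simp add: g_def)
      qed
    qed
    show "f \<sigma> \<in> latin_squares m"
      unfolding latin_squares_def
    proof (intro CollectI conjI ballI)
      have "Suc (\<sigma> (q - 1) (p - 1)) \<in> {1..m}" if "p \<in> {1..m}" "q \<in> {1..m}" for p q
      proof -
        have "q - 1 < m" "p - 1 < m" using that by auto
        from lt[OF this] show ?thesis by auto
      qed
      then show "f \<sigma> \<in> {1..m} \<rightarrow>\<^sub>E {1..m} \<rightarrow>\<^sub>E {1..m}"
        by (auto simp: f_def)
      fix p assume p: "p \<in> {1..m}"
      then have "bij_betw (\<lambda>r. \<sigma> r (p - 1)) {..<m} {..<m}"
        using s by (auto simp: latin_perms_def)
      from shift'[OF this] show "bij_betw (\<lambda>q. f \<sigma> p q) {1..m} {1..m}"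
        by (subst bij_betw_cong[of _ _ "\<lambda>q. Suc (\<sigma> (q - 1) (p - 1))"]) (use p in \<open>auto simp: f_def\<close>)
    next
      fix q assume q: "q \<in> {1..m}"
      then have "q - 1 < m" by auto
      then have "bij_betw (\<sigma> (q - 1)) {..<m} {..<m}"
        using permutes_imp_bij[OF sig[OF s]] by (simp add: lessThan_atLeast0)
      from shift'[OF this] show "bij_betw (\<lambda>p. f \<sigma> p q) {1..m} {1..m}"
        by (subst bij_betw_cong[of _ _ "\<lambda>p. Suc (\<sigma> (q - 1) (p - 1))"]) (use q in \<open>auto simp: f_def\<close>)
    qed
    show "(\<Prod>q=1..m. column_sign m (f \<sigma>) q) = (\<Prod>r<m. sign (\<sigma> r))"
    proof -
      have "column_sign m (f \<sigma>) q = sign (\<sigma> (q - 1))" if q: "q \<in> {1..m}" for q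
      proof -
        have "(\<Prod>(p, p')\<in>index_pairs m. int (f \<sigma> p' q) - int (f \<sigma> p q)) =
          (\<Prod>(p, p')\<in>index_pairs m. int (\<sigma> (q - 1) (p' - 1)) - int (\<sigma> (q - 1) (p - 1)))"
          using q by (intro prod.cong refl) (auto simp: f_def)
        moreover have "\<sigma> (q - 1) permutes {0..<m}" using sig[OF s] q by auto
        ultimately show ?thesis
          unfolding column_sign_def by (simp only: sgn_diff_prod_permutes)
      qed
      then have "(\<Prod>q=1..m. column_sign m (f \<sigma>) q) = (\<Prod>q=1..m. sign (\<sigma> (q - 1)))"
        by (intro prod.cong) auto
      also have "\<dots> = (\<Prod>r<m. sign (\<sigma> r))"
        using prod.reindex_bij_betw[OF shift(2), of "\<lambda>r. sign (\<sigma> r)"] by simp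
      finally show ?thesis .
    qed
  next
    fix A assume A: "A \<in> latin_squares m"
    have AP: "A \<in> {1..m} \<rightarrow>\<^sub>E ({1..m} \<rightarrow>\<^sub>E {1..m})"
      and row: "\<And>p. p \<in> {1..m} \<Longrightarrow> bij_betw (\<lambda>q. A p q) {1..m} {1..m}"
      and col: "\<And>q. q \<in> {1..m} \<Longrightarrow> bij_betw (\<lambda>p. A p q) {1..m} {1..m}"
      using A by (auto simp: latin_squares_def)
    show "g A \<in> latin_perms m"
      unfolding latin_perms_def
    proof (intro CollectI conjI allI impI)
      have "(\<lambda>a. if a < m then A (Suc a) (Suc r) - 1 else a) permutes {0..<m}" if r: "r < m" for r
      proof (rule bij_imp_permutes)
        have "bij_betw (\<lambda>a. A (Suc a) (Suc r) - 1) {..<m} {..<m}" using col[of "Suc r"] r by (intro shift'') auto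
        then show "bij_betw (\<lambda>a. if a < m then A (Suc a) (Suc r) - 1 else a) {0..<m} {0..<m}"
          by (subst bij_betw_cong[of _ _ "\<lambda>a. A (Suc a) (Suc r) - 1"]) (auto simp: lessThan_atLeast0)
      qed auto
      then show "g A \<in> {..<m} \<rightarrow>\<^sub>E {\<pi>. \<pi> permutes {0..<m}}" by (auto simp: g_def)
      fix a assume a: "a < m"
      have "bij_betw (\<lambda>r. A (Suc a) (Suc r) - 1) {..<m} {..<m}" using row[of "Suc a"] a by (intro shift'') auto
      then show "bij_betw (\<lambda>r. g A r a) {..<m} {..<m}"
        by (subst bij_betw_cong[of _ _ "\<lambda>r. A (Suc a) (Suc r) - 1"]) (use a in \<open>auto simp: g_def\<close>)
    qed
    show "f (g A) = A"
    proof (intro ext)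
      fix p q
      show "f (g A) p q = A p q"
      proof (cases "p \<in> {1..m}")
        case p: True
        then have Ap: "A p \<in> {1..m} \<rightarrow>\<^sub>E {1..m}" using AP by auto
        show ?thesis
        proof (cases "q \<in> {1..m}")
          case True
          then have "A p q \<in> {1..m}" using Ap by auto
          then show ?thesis using p True by (auto simp: f_def g_def)
        next
          case False
          then have "A p q = undefined" using Ap by (auto simp: PiE_def extensional_def)
          then show ?thesis using p False by (auto simp: f_def)
        qed
      next
        case False
        then have "A p = undefined" using AP by (auto simp: PiE_def extensional_def)
        then show ?thesis using False by (auto simp: f_def)
      qed
    qed
  qed
qed

text \<open>A summand is \<open>1\<close> exactly when \<open>\<tau>\<close> is a right inverse of
  \<open>b\<close> on the finite set \<open>S\<close>; there is one such permutation if
  \<open>b\<close> is bijective on \<open>S\<close> and none otherwise.\<close>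

lemma sum_permutes_inverse:
  assumes "finite S" "b ` S \<subseteq> S"
  shows "(\<Sum>\<tau> | \<tau> permutes S. \<Prod>j\<in>S. if b (\<tau> j) = j then 1 else 0) = (if bij_betw b S S then 1 else (0::complex))"
proof -
  have prod: "(\<Prod>j\<in>S. if b (\<tau> j) = j then 1 else (0::complex)) = (if \<forall>j\<in>S. b (\<tau> j) = j then 1 else 0)" for \<tau>
    using assms(1) by (auto intro!: prod.neutral)
  have sum: "(\<Sum>\<tau> | \<tau> permutes S. \<Prod>j\<in>S. if b (\<tau> j) = j then 1 else 0) =
    (of_nat (card {\<tau>. \<tau> permutes S \<and> (\<forall>j\<in>S. b (\<tau> j) = j)}) :: complex)"
    unfolding prod using finite_permutations[OF assms(1)]
    by (simp add: sum.If_cases Int_def)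
  show ?thesis
  proof (cases "bij_betw b S S")
    case True
    let ?b = "\<lambda>x. if x \<in> S then b x else x"
    have perm: "?b permutes S"
      using True by (intro bij_imp_permutes) (auto simp: bij_betw_cong[of S ?b b])
    have "{\<tau>. \<tau> permutes S \<and> (\<forall>j\<in>S. b (\<tau> j) = j)} = {inv_into UNIV ?b}"
    proof (intro equalityI subsetI)
      fix \<tau> assume \<tau>: "\<tau> \<in> {\<tau>. \<tau> permutes S \<and> (\<forall>j\<in>S. b (\<tau> j) = j)}"
      have bt: "?b (\<tau> x) = x" for x
        using \<tau> permutes_in_image[of \<tau> S x] by (auto simp: permutes_def)
      have "inv_into UNIV ?b x = \<tau> x" for x unfolding permutes_inv_eq[OF perm] by (rule bt)
      then show "\<tau> \<in> {inv_into UNIV ?b}" by auto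
    next
      fix \<tau> assume "\<tau> \<in> {inv_into UNIV ?b}"
      then have \<tau>: "\<tau> = inv_into UNIV ?b" by simp
      have "b (\<tau> j) = j" if "j \<in> S" for j
        using permutes_inverses(1)[OF perm, of j] permutes_in_image[OF permutes_inv[OF perm], of j] that
        by (simp add: \<tau>)
      then show "\<tau> \<in> {\<tau>. \<tau> permutes S \<and> (\<forall>j\<in>S. b (\<tau> j) = j)}" using permutes_inv[OF perm] \<tau> by simp
    qed
    then show ?thesis unfolding sum using True by simp
  next
    case False
    have "\<not> (\<tau> permutes S \<and> (\<forall>j\<in>S. b (\<tau> j) = j))" for \<tau>
    proof
      assume \<tau>: "\<tau> permutes S \<and> (\<forall>j\<in>S. b (\<tau> j) = j)"
      have "S \<subseteq> b ` S"
      proof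
        fix j assume "j \<in> S"
        then have "\<tau> j \<in> S" "b (\<tau> j) = j" using \<tau> permutes_in_image[of \<tau> S j] by auto
        then show "j \<in> b ` S" by force
      qed
      then have "b ` S = S" using assms(2) by blast
      then have "bij_betw b S S" using assms(1) by (simp add: bij_betw_def eq_card_imp_inj_on)
      then show False using False by simp
    qed
    then have empty: "{\<tau>. \<tau> permutes S \<and> (\<forall>j\<in>S. b (\<tau> j) = j)} = {}" by blast
    show ?thesis unfolding sum empty using False by simp
  qed
qed

locale end_space = form_space "pointwise s" "endos s" N e m + v: vector_space s
  for s :: "complex \<Rightarrow> 'v::ab_group_add \<Rightarrow> 'v" and N e m +
  assumes dim_v: "v.dim UNIV = m"
begin

definition B :: "'v set" where "B = v.extend_basis {}"

lemma indep_B: "v.independent B" and span_B: "v.span B = UNIV"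
  unfolding B_def
  by (rule v.independent_extend_basis[OF v.independent_empty], rule v.span_extend_basis[OF v.independent_empty])

lemma card_B: "card B = m"
  using v.basis_card_eq_dim[of B UNIV] indep_B span_B dim_v by simp

lemma finite_B: "finite B"
  using card_B m_pos by (intro card_ge_0_finite) simp

abbreviation rep :: "'v \<Rightarrow> 'v \<Rightarrow> complex" where "rep \<equiv> v.representation B"

lemma rep_add: "rep (x + y) c = rep x c + rep y c"
  using v.representation_add[OF indep_B, of y x] span_B by simp

lemma rep_scale: "rep (s a x) c = a * rep x c"
  using v.representation_scale[OF indep_B, of x a] span_B by simp

lemma rep_basis: "c \<in> B \<Longrightarrow> rep c d = (if d = c then 1 else 0)"
  using v.representation_basis[OF indep_B, of c] by auto

lemma det_fun_eq: "X \<in> endos s \<Longrightarrow>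
   det_fun s X = (\<Sum>\<pi> | \<pi> permutes B. of_int (sign \<pi>) * (\<Prod>c\<in>B. rep (X c) (\<pi> c)))"
  by (simp add: det_fun_def B_def Let_def)

lemma det_fun_in: "det_fun s \<in> Q"
  unfolding Q_def
proof (rule hom_polyI)
  have lin: "linear_on (pointwise s) (*) (endos s) (\<lambda>X. rep (X c) d)" for c d
    by (simp add: linear_on_def pointwise_def plus_fun_apply rep_add rep_scale)
  have "polynomial_on (pointwise s) (endos s)
    (\<lambda>X. \<Sum>\<pi> | \<pi> permutes B. of_int (sign \<pi>) * (\<Prod>c\<in>B. rep (X c) (\<pi> c)))"
    by (intro polynomial_on_sum polynomial_on_cmult polynomial_on_prod polynomial_on.linear[OF lin])
  then show "polynomial_on (pointwise s) (endos s) (det_fun s)"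
    by (rule polynomial_on_cong) (auto simp: det_fun_eq W_add W_scale)
  show "det_fun s (pointwise s c X) = c ^ m * det_fun s X" if "X \<in> endos s" for c X
    unfolding det_fun_eq[OF W_scale[OF that]] det_fun_eq[OF that]
    by (simp add: pointwise_def rep_scale prod.distrib card_B sum_distrib_left mult_ac)
qed (simp add: det_fun_def)

lemma det_fun_diagonal:
  assumes X: "X \<in> endos s" "\<And>c. c \<in> B \<Longrightarrow> X c = s (t c) c"
  shows "det_fun s X = (\<Prod>c\<in>B. t c)"
proof -
  have "(\<Prod>c\<in>B. rep (X c) (\<pi> c)) = (if \<pi> = id then \<Prod>c\<in>B. t c else 0)" if \<pi>: "\<pi> permutes B" for \<pi>
  proof (cases "\<pi> = id")
    case True
    then show ?thesis by (auto simp: X(2) rep_scale rep_basis intro!: prod.cong)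
  next
    case False
    then obtain c where "\<pi> c \<noteq> c" by (auto simp: fun_eq_iff)
    then have "c \<in> B" using \<pi> by (auto simp: permutes_def)
    then have "rep (X c) (\<pi> c) = 0" using \<open>\<pi> c \<noteq> c\<close> by (simp add: X(2) rep_scale rep_basis)
    then show ?thesis using \<open>c \<in> B\<close> False finite_B by (auto intro: prod_zero)
  qed
  then have "det_fun s X = (\<Sum>\<pi> | \<pi> permutes B. if \<pi> = id then \<Prod>c\<in>B. t c else 0)"
    unfolding det_fun_eq[OF X(1)] by (intro sum.cong) auto
  also have "\<dots> = (\<Prod>c\<in>B. t c)" using finite_permutations[OF finite_B] permutes_id by simp
  finally show ?thesis .
qed

text \<open>On diagonal matrices the determinant is the product of the coordinates, whose polarization is
  \<open>1 / m!\<close> at the tuples of distinct basis vectors and \<open>0\<close> at all other tuples of basis vectors.\<close>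

lemma Pinv_det:
  assumes "card {A \<in> latin_squares m. column_even m A} \<noteq> card {A \<in> latin_squares m. \<not> column_even m A}"
  shows "\<exists>v. (\<forall>c. v c \<in> endos s) \<and> Pinv m v (det_fun s) \<noteq> 0"
proof -
  obtain \<beta> where \<beta>: "bij_betw \<beta> {..<m} B"
    using ex_bij_betw_nat_finite[OF finite_B] by (auto simp: card_B lessThan_atLeast0)
  \<comment> \<open>The diagonal matrix units with respect to \<open>B\<close>, enumerated by
    \<open>\<beta>\<close>.\<close>
  define v where "v = (\<lambda>c x. s (rep x (\<beta> c)) (\<beta> c))"
  have vE: "v c \<in> endos s" for c
    unfolding endos_def v_def
    by (auto simp: Vector_Spaces.linear_iff rep_add rep_scale v.scale_left_distrib intro: v.vector_space_axioms)
  \<comment> \<open>The \<open>j\<close>-th diagonal entry of the sum counts the indices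
    \<open>r\<close> with \<open>h r = j\<close>, which gives the shape needed for the signed subset
    sum.\<close>
  have detv: "det_fun s (\<Sum>r\<in>U. v (h r)) = (\<Prod>j<m. \<Sum>r\<in>U. if h r = j then 1 else 0)"
    if h: "\<And>r. r \<in> U \<Longrightarrow> h r < m" for U and h :: "nat \<Rightarrow> nat"
  proof -
    let ?t = "\<lambda>c. \<Sum>r\<in>U. if \<beta> (h r) = c then 1 else 0 :: complex"
    have "det_fun s (\<Sum>r\<in>U. v (h r)) = (\<Prod>c\<in>B. ?t c)"
    proof (rule det_fun_diagonal)
      show "(\<Sum>r\<in>U. v (h r)) \<in> endos s" using vE by (intro W_sum)
      fix c assume c: "c \<in> B"
      have "(\<Sum>r\<in>U. v (h r)) c = (\<Sum>r\<in>U. s (if \<beta> (h r) = c then 1 else 0) c)"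
      proof -
        have "(\<Sum>r\<in>U. f r) c = (\<Sum>r\<in>U. f r c)" for f :: "nat \<Rightarrow> 'v \<Rightarrow> 'v"
          by (induction U rule: infinite_finite_induct) (auto simp: plus_fun_apply zero_fun_apply)
        then show ?thesis using c by (auto simp: v_def rep_basis intro!: sum.cong)
      qed
      then show "(\<Sum>r\<in>U. v (h r)) c = s (?t c) c" by (simp add: v.scale_sum_left)
    qed
    also have "\<dots> = (\<Prod>j<m. ?t (\<beta> j))" by (rule prod.reindex_bij_betw[OF \<beta>, symmetric])
    also have "\<dots> = (\<Prod>j<m. \<Sum>r\<in>U. if h r = j then 1 else 0)"
    proof (intro prod.cong sum.cong refl)
      fix j r assume "j \<in> {..<m}" "r \<in> U"
      then have "\<beta> (h r) = \<beta> j \<longleftrightarrow> h r = j"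
        using \<beta> h unfolding bij_betw_def by (auto dest: inj_onD)
      then show "(if \<beta> (h r) = \<beta> j then 1 else 0 :: complex) = (if h r = j then 1 else 0)" by simp
    qed
    finally show ?thesis .
  qed
  have polarization: "polarization (det_fun s) (\<lambda>r. v (h r)) = (if bij_betw h {..<m} {..<m} then 1 else 0) / fact m"
    if h: "\<And>r. r < m \<Longrightarrow> h r < m" for h
  proof -
    have "(\<Sum>U\<in>Pow {..<m}. (- 1) ^ card ({..<m} - U) * det_fun s (\<Sum>r\<in>U. v (h r))) =
      (\<Sum>U\<in>Pow {..<m}. (- 1) ^ card ({..<m} - U) * (\<Prod>j\<in>{..<m}. \<Sum>r\<in>U. if h r = j then 1 else 0))"
      using h by (intro sum.cong refl arg_cong2[of _ _ _ _ "(*)"] detv) auto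
    also have "\<dots> = (\<Sum>\<tau> | \<tau> permutes {..<m}. \<Prod>j\<in>{..<m}. if h (\<tau> j) = j then 1 else 0)"
      by (rule sum_subset_signed_prod) simp
    also have "\<dots> = (if bij_betw h {..<m} {..<m} then 1 else 0)"
      using h by (intro sum_permutes_inverse) auto
    finally show ?thesis by (simp add: polarization_def)
  qed
  let ?S = "{..<m} \<rightarrow>\<^sub>E {\<pi>. \<pi> permutes {0..<m}}"
  \<comment> \<open>A tuple survives exactly if for each \<open>a\<close> the basis indices
    \<open>\<sigma> r a\<close> are distinct; then each of the \<open>m\<close> polarizations
    contributes \<open>1 / fact m\<close>.\<close>
  have "Pinv m v (det_fun s) = (\<Sum>\<sigma>\<in>?S. if \<forall>a<m. bij_betw (\<lambda>r. \<sigma> r a) {..<m} {..<m}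
      then (\<Prod>r<m. signof (\<sigma> r)) * (1 / fact m) ^ m else 0)"
    unfolding Pinv_def if_P[OF det_fun_in]
  proof (rule sum.cong[OF refl])
    fix \<sigma> assume \<sigma>: "\<sigma> \<in> ?S"
    have "polarization (det_fun s) (\<lambda>r. v (\<sigma> r a)) = (if bij_betw (\<lambda>r. \<sigma> r a) {..<m} {..<m} then 1 else 0) / fact m"
      if "a < m" for a
    proof (rule polarization)
      fix r assume "r < m"
      then have "\<sigma> r permutes {0..<m}" using \<sigma> by (auto simp: PiE_iff)
      then show "\<sigma> r a < m" using permutes_in_image[of "\<sigma> r" "{0..<m}" a] that by simp
    qed
    then have "(\<Prod>a=0..<m. polarization (det_fun s) (\<lambda>r. v (\<sigma> r a))) =
      (\<Prod>a=0..<m. (if bij_betw (\<lambda>r. \<sigma> r a) {..<m} {..<m} then 1 else 0) / fact m)"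
      by (intro prod.cong) auto
    also have "\<dots> = (if \<forall>a<m. bij_betw (\<lambda>r. \<sigma> r a) {..<m} {..<m} then (1 / fact m) ^ m else 0)"
      by (auto intro: prod_zero)
    finally show "(\<Prod>r<m. signof (\<sigma> r)) * (\<Prod>a=0..<m. polarization (det_fun s) (\<lambda>r. v (\<sigma> r a))) =
      (if \<forall>a<m. bij_betw (\<lambda>r. \<sigma> r a) {..<m} {..<m} then (\<Prod>r<m. signof (\<sigma> r)) * (1 / fact m) ^ m else 0)"
      by simp
  qed
  also have "\<dots> = (\<Sum>\<sigma>\<in>latin_perms m. (\<Prod>r<m. signof (\<sigma> r)) * (1 / fact m) ^ m)"
    unfolding latin_perms_def
    by (rule sum.mono_neutral_cong_right) (auto simp: finite_PiE finite_permutations)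
  also have "\<dots> = of_int (\<Sum>\<sigma>\<in>latin_perms m. \<Prod>r<m. sign (\<sigma> r)) * (1 / fact m) ^ m"
    by (simp add: sum_distrib_right)
  also have "\<dots> \<noteq> 0"
    unfolding latin_perms_sum sum_column_signs using assms by simp
  finally show ?thesis using vE by blast
qed

end

theorem theorem6p1:
  fixes s :: "complex \<Rightarrow> 'v::ab_group_add \<Rightarrow> 'v"
    and m :: nat
    and e :: "nat \<Rightarrow> 'v \<Rightarrow> 'v"
  assumes "m > 0" and "even m"
    and "card {A \<in> latin_squares m. column_even m A} \<noteq> card {A \<in> latin_squares m. \<not> column_even m A}"
    and "vector_space s" and "vector_space.dim s UNIV = m"
    and "ordered_basis (pointwise s) (endos s) (m\<^sup>2) e"
  shows
    "let E = endos s; sE = pointwise s; N = m\<^sup>2; Q = forms s m; X = det_orbit_closure s m;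
         CQ = coordinate_ring fscale Q Q; CX = coordinate_ring fscale Q X;
         \<rho>Q = form_action s Q; \<rho>X = form_action s X;
         wt = (\<lambda>d i j. d * fundamental_weight i j)
     in
      (\<forall>i\<in>{1..m}.
         (\<exists>!V. irreducible_copy sE E N e \<rho>Q (wt m i) (hom_poly fscale Q i) V) \<and>
         (\<forall>V P. irreducible_copy sE E N e \<rho>Q (wt m i) (hom_poly fscale Q i) V \<longrightarrow> P \<in> V \<longrightarrow>
            highest_weight_vector sE E N e \<rho>Q (wt m i) P \<longrightarrow> (\<exists>q\<in>X. P q \<noteq> 0))) \<and>
      (\<forall>i\<in>{1..m}. occurs_with_multiplicity sE E N e \<rho>X (wt m i) CX 1) \<and>
      (\<forall>d i. 0 < d \<longrightarrow> d < m \<longrightarrow> i \<in> {1..m\<^sup>2} \<longrightarrow>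
         \<not> occurs sE E N e \<rho>Q (wt d i) CQ \<and> \<not> occurs sE E N e \<rho>X (wt d i) CX)"
proof -
  interpret v: vector_space s by (rule assms(4))
  have vs: "vector_space (pointwise s)"
    by unfold_locales
      (simp_all add: pointwise_def fun_eq_iff plus_fun_apply v.scale_right_distrib v.scale_left_distrib)
  interpret pv: vector_space "pointwise s" by (rule vs)
  have sub: "module.subspace (pointwise s) (endos s)"
    unfolding pv.subspace_def
    using v.vector_space_axioms
    by (auto simp: endos_def Vector_Spaces.linear_iff pointwise_def plus_fun_apply zero_fun_apply
        v.scale_right_distrib v.scale_left_commute algebra_simps)
  interpret end_space s "m\<^sup>2" e m
    by (intro end_space.intro form_space.intro based_space.intro cspace.intro cspace_axioms.intro
        based_space_axioms.intro form_space_axioms.intro end_space_axioms.intro vs sub assms)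
  let ?X = "det_orbit_closure s m"
  have Q: "forms s m = Q" by (simp add: forms_def Q_def)
  have X: "?X = zariski_closure fscale Q ((\<lambda>g. translate (endos s) g (det_fun s)) ` GL (pointwise s) (endos s))"
    by (simp add: det_orbit_closure_def Q)
  have rho: "form_action s Y = rho Y" for Y by (simp add: form_action_def fun_eq_iff)
  have stX: "stable ?X" unfolding X by (rule stable_orbit_closure[OF det_fun_in])
  have XQ: "?X \<subseteq> Q" using stX by (simp add: stable_def)
  have mm: "m \<le> m\<^sup>2" by (simp add: power2_eq_square)
  \<comment> \<open>Latin squares give nonvanishing for size \<open>m\<close> at the determinant;
    descent reaches size \<open>i\<close> at a point of its orbit.\<close>
  have nonzero: "\<exists>q\<in>?X. Pinv i b q \<noteq> 0" if im: "i \<le> m" for i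
  proof -
    obtain u where u: "\<And>c. u c \<in> endos s" "Pinv m u (det_fun s) \<noteq> 0"
      using Pinv_det[OF assms(3)] by blast
    obtain A where "A \<in> carrier_mat (m\<^sup>2) (m\<^sup>2)" "det A \<noteq> 0" "Pinv i b (act A (det_fun s)) \<noteq> 0"
      using Pinv_nonzero[OF det_fun_in im mm u(1) u(2)] by blast
    then show ?thesis unfolding X using orbit_subset_closure[OF det_fun_in] by blast
  qed
  have resX: "restr ?X (Pinv i b) \<noteq> 0" if "i \<le> m" for i
    using nonzero[OF that] by (auto simp: restr_def fun_eq_iff zero_fun_apply)
  have Pnz: "Pinv i b \<noteq> 0" if "i \<le> m" for i
    using nonzero[OF that] by (auto simp: zero_fun_apply)
  have hom: "hom_poly fscale Q i \<subseteq> coordinate_ring fscale Q Q" for i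
    using Q.hom_poly_polynomial restr_Q unfolding coordinate_ring_restr by (metis subsetI coordinate_ring_restr)
  \<comment> \<open>Elements of \<open>V i\<close> already vanish outside \<open>Q\<close>, so the
    criterion for stable sets applies with \<open>Y = Q\<close> and returns \<open>V i\<close>
    itself.\<close>
  have resV: "restr Q ` V i = V i" for i
    using V_hom[of i] restr_Q by force
  have part1: "(\<exists>!V. irreducible_copy (pointwise s) (endos s) (m\<^sup>2) e (rho Q) (wt m i) (hom_poly fscale Q i) V) \<and>
    (\<forall>V P. irreducible_copy (pointwise s) (endos s) (m\<^sup>2) e (rho Q) (wt m i) (hom_poly fscale Q i) V \<longrightarrow> P \<in> V \<longrightarrow>
       highest_weight_vector (pointwise s) (endos s) (m\<^sup>2) e (rho Q) (wt m i) P \<longrightarrow> (\<exists>q\<in>?X. P q \<noteq> 0))"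
    if i: "i \<in> {1..m}" for i
  proof (intro conjI allI impI)
    have im: "i \<le> m" and iN: "i \<le> m\<^sup>2" using i mm by auto
    have copy: "irreducible_copy (pointwise s) (endos s) (m\<^sup>2) e (rho Q) (wt m i) (hom_poly fscale Q i) U \<longleftrightarrow> U = V i" for U
      using irreducible_copy_iff[OF stable_Q iN _ hom[of i]] V_hom[of i] Pnz[OF im]
      by (simp only: resV restr_Q[OF Pinv_hom] not_False_eq_True simp_thms)
    then show "\<exists>!V. irreducible_copy (pointwise s) (endos s) (m\<^sup>2) e (rho Q) (wt m i) (hom_poly fscale Q i) V"
      by blast
    fix U P
    assume U: "irreducible_copy (pointwise s) (endos s) (m\<^sup>2) e (rho Q) (wt m i) (hom_poly fscale Q i) U" "P \<in> U"
      and P: "highest_weight_vector (pointwise s) (endos s) (m\<^sup>2) e (rho Q) (wt m i) P"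
    have Ph: "P \<in> hom_poly fscale Q i" using U copy V_hom by blast
    have "highest_on Q i m P"
      using highest_weight_highest_on[OF stable_Q iN, of m P] P by (simp only: restr_Q[OF Ph] simp_thms)
    then obtain c where c: "\<And>q. q \<in> Q \<Longrightarrow> P q = c * Pinv i b q"
      using highest_unique[OF stable_Q iN Q.hom_poly_polynomial[OF Ph] _ Pinv_hom Pinv_semi_invariant[OF iN] Pnz[OF im]] by blast
    have "c \<noteq> 0"
    proof
      assume "c = 0"
      then have "P = 0" using c Q.hom_poly_outside[OF Ph] by (auto simp: fun_eq_iff zero_fun_apply)
      then show False using P by (simp add: highest_weight_vector_def)
    qed
    obtain q where q: "q \<in> ?X" "Pinv i b q \<noteq> 0" using nonzero[OF im] by blast
    then have "P q \<noteq> 0" using \<open>c \<noteq> 0\<close> c[OF subsetD[OF XQ q(1)]] by simp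
    then show "\<exists>q\<in>?X. P q \<noteq> 0" using q(1) by blast
  qed
  have part2: "occurs_with_multiplicity (pointwise s) (endos s) (m\<^sup>2) e (rho ?X) (wt m i) (coordinate_ring fscale Q ?X) 1"
    if i: "i \<in> {1..m}" for i
    using i mm by (intro occurs_once[OF stX] resX) auto
  have part3: "\<not> occurs (pointwise s) (endos s) (m\<^sup>2) e (rho Y) (wt d i) (coordinate_ring fscale Q Y)"
    if "stable Y" "0 < d" "d < m" "i \<in> {1..m\<^sup>2}" for Y d i
    using that by (intro not_occurs) auto
  show ?thesis
    unfolding Let_def Q rho
    by (rule conjI, rule ballI, rule part1, assumption, rule conjI, rule ballI, rule part2, assumption,
        intro allI impI conjI, (rule part3[OF stable_Q], assumption+), (rule part3[OF stX], assumption+))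
qed

end
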